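(* Let $d\ge1$ and $0<\mu\le\frac12$. Then the conclusions of the Ferromagnetism theorem hold with $L_\#(\mu)=L_*(\mu)$ and $U_\#(\mu)=U_*(\mu,\alpha_*(\mu))$; that is, for all even $L\ge L_*(\mu)$ and all $U\ge U_*(\mu,\alpha_*(\mu))$ one has $E^{(\mathrm{hfz})}_{\mu,U}=\mathrm{Tr}\{[-\Delta-\mu]_-\}$, and if moreover $\mu$ is not an eigenvalue of $-\Delta$, every minimizer $(\gamma_\uparrow,\gamma_\downarrow)$ of the HFz functional is either $(\mathbb{1}[-\Delta<\mu],0)$ or $(0,\mathbb{1}[-\Delta<\mu])$. Here $$L_*(\mu)=2M_*(\mu)=24(4d)^2\mu^{-2},\qquad \kappa(\mu)=\frac{\mu^d}{4^{2d+1}e^d d^d}\Big[1+2\ln 2\,(d^{-1}+1)+\ln(4d\mu^{-1})\Big]^{-2d},$$ $$\alpha_*(\mu)=\frac{|S^{d-1}|\,\mu^{(2+d)/2}}{2^{1+d/2}(2\pi)^d(4d)^5},\qquad \delta_*(\mu,\alpha)=\min\Big\{\frac{\alpha^2}{(12d)^2},\ \frac{\alpha}{3\mu[4M_*(\mu)+1]^d},\ \frac{\kappa(\mu)}{2}\Big\},$$ $$U_*(\mu,\alpha)=\max\Big\{\frac{2\mu}{\delta_*(\mu,\alpha)},\ \frac{24d^2}{\alpha\,\delta_*(\mu,\alpha)}\Big\},$$ and $|S^{d-1}|=2\pi^{d/2}/\Gamma(d/2)$.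
   Context: $\Lambda=\mathbb{Z}_L^d$ periodic lattice, $L$ even; $T_{x,y}=1$ if $|x-y|_1=1$, else $0$; $\Delta_{x,y}=T_{x,y}-2d\delta_{x,y}$; $K_\mu=-\Delta-\mu$; $[X]_-=\min\{X,0\}$ so $\mathrm{Tr}[X]_-$ is the sum of negative eigenvalues of $X$. The HFz functional is $\mathcal{E}^{(\mathrm{hfz})}_{\mu,U}(\gamma_\uparrow,\gamma_\downarrow)=\mathrm{Tr}\{K_\mu(\gamma_\uparrow+\gamma_\downarrow)\}+U\sum_{x}\rho_\uparrow(x)\rho_\downarrow(x)$ with $\rho_\sigma(x)=(\gamma_\sigma)_{x,x}$, and $E^{(\mathrm{hfz})}_{\mu,U}$ is its minimum over Hermitian $\Lambda\times\Lambda$ matrices $0\le\gamma_\uparrow,\gamma_\downarrow\le1$. *)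

theory Defs
  imports "HOL-Analysis.Analysis"
begin

definition lattice :: "nat \<Rightarrow> nat \<Rightarrow> nat list set" where
  "lattice d L = {x. length x = d \<and> (\<forall>i<d. x ! i < L)}"

definition tdist1 :: "nat \<Rightarrow> nat list \<Rightarrow> nat list \<Rightarrow> int" where
  "tdist1 L x y = (\<Sum>i<length x. min \<bar>int (x!i) - int (y!i)\<bar> (int L - \<bar>int (x!i) - int (y!i)\<bar>))"

text \<open>Matrices on a finite index set S are functions S x S -> complex (values outside
  S x S are irrelevant / required to be zero where noted).\<close>
type_synonym cmat = "nat list \<Rightarrow> nat list \<Rightarrow> complex"
type_synonym cvec = "nat list \<Rightarrow> complex"

definition hopT :: "nat \<Rightarrow> cmat" where
  "hopT L x y = (if tdist1 L x y = 1 then 1 else 0)"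

definition lapl :: "nat \<Rightarrow> nat \<Rightarrow> cmat" where
  "lapl d L x y = hopT L x y - (if x = y then of_nat (2*d) else 0)"

definition Kmu :: "nat \<Rightarrow> nat \<Rightarrow> real \<Rightarrow> cmat" where
  "Kmu d L \<mu> x y = - lapl d L x y - (if x = y then complex_of_real \<mu> else 0)"

definition mneg :: "cmat \<Rightarrow> cmat" where
  "mneg A x y = - A x y"

definition mmul :: "nat list set \<Rightarrow> cmat \<Rightarrow> cmat \<Rightarrow> cmat" where
  "mmul S A B x y = (\<Sum>z\<in>S. A x z * B z y)"

definition mtrace :: "nat list set \<Rightarrow> cmat \<Rightarrow> complex" where
  "mtrace S A = (\<Sum>x\<in>S. A x x)"

definition hermitian :: "nat list set \<Rightarrow> cmat \<Rightarrow> bool" where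
  "hermitian S A \<longleftrightarrow> (\<forall>x\<in>S. \<forall>y\<in>S. A x y = cnj (A y x))"

definition supported :: "nat list set \<Rightarrow> cmat \<Rightarrow> bool" where
  "supported S A \<longleftrightarrow> (\<forall>x y. (x \<notin> S \<or> y \<notin> S) \<longrightarrow> A x y = 0)"

definition psd :: "nat list set \<Rightarrow> cmat \<Rightarrow> bool" where
  "psd S A \<longleftrightarrow> hermitian S A \<and>
     (\<forall>v::cvec. 0 \<le> Re (\<Sum>x\<in>S. \<Sum>y\<in>S. cnj (v x) * A x y * v y))"

definition idm :: cmat where
  "idm x y = (if x = y then 1 else 0)"

definition between01 :: "nat list set \<Rightarrow> cmat \<Rightarrow> bool" where
  "between01 S A \<longleftrightarrow> psd S A \<and> psd S (\<lambda>x y. idm x y - A x y)"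

definition vecs :: "nat list set \<Rightarrow> cvec set" where
  "vecs S = {v. \<forall>x. x \<notin> S \<longrightarrow> v x = 0}"

definition apply_mat :: "nat list set \<Rightarrow> cmat \<Rightarrow> cvec \<Rightarrow> cvec" where
  "apply_mat S A v = (\<lambda>x. if x \<in> S then (\<Sum>y\<in>S. A x y * v y) else 0)"

definition eigspace :: "nat list set \<Rightarrow> cmat \<Rightarrow> complex \<Rightarrow> cvec set" where
  "eigspace S A lam = {v \<in> vecs S. apply_mat S A v = (\<lambda>x. lam * v x)}"

definition is_eigenvalue :: "nat list set \<Rightarrow> cmat \<Rightarrow> complex \<Rightarrow> bool" where
  "is_eigenvalue S A lam \<longleftrightarrow> (\<exists>v \<in> eigspace S A lam. \<exists>x\<in>S. v x \<noteq> 0)"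

definition cspan :: "cvec set \<Rightarrow> cvec set" where
  "cspan B = {w. \<exists>F c. finite F \<and> F \<subseteq> B \<and> w = (\<lambda>x. \<Sum>v\<in>F. c v * v x)}"

definition mrange :: "nat list set \<Rightarrow> cmat \<Rightarrow> cvec set" where
  "mrange S P = apply_mat S P ` UNIV"

definition spec_proj_below :: "nat list set \<Rightarrow> cmat \<Rightarrow> real \<Rightarrow> cmat" where
  "spec_proj_below S A t = (THE P. supported S P \<and> hermitian S P \<and> mmul S P P = P \<and>
      mrange S P = cspan (\<Union>lam\<in>{lam::real. lam < t}. eigspace S A (complex_of_real lam)))"

text \<open>[X]_- = min{X,0} by functional calculus, i.e. X 1[X<0]; Tr [X]_- .\<close>
definition negpart :: "nat list set \<Rightarrow> cmat \<Rightarrow> cmat" where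
  "negpart S X = mmul S X (spec_proj_below S X 0)"

definition tr_neg :: "nat list set \<Rightarrow> cmat \<Rightarrow> real" where
  "tr_neg S X = Re (mtrace S (negpart S X))"

definition hfz :: "nat \<Rightarrow> nat \<Rightarrow> real \<Rightarrow> real \<Rightarrow> cmat \<Rightarrow> cmat \<Rightarrow> real" where
  "hfz d L \<mu> U gu gd =
     Re (mtrace (lattice d L) (mmul (lattice d L) (Kmu d L \<mu>) (\<lambda>x y. gu x y + gd x y)))
     + U * (\<Sum>x\<in>lattice d L. Re (gu x x) * Re (gd x x))"

definition hfz_admissible :: "nat \<Rightarrow> nat \<Rightarrow> cmat \<Rightarrow> cmat \<Rightarrow> bool" where
  "hfz_admissible d L gu gd \<longleftrightarrow> between01 (lattice d L) gu \<and> between01 (lattice d L) gd"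

definition hfz_energy :: "nat \<Rightarrow> nat \<Rightarrow> real \<Rightarrow> real \<Rightarrow> real" where
  "hfz_energy d L \<mu> U = Inf {hfz d L \<mu> U gu gd | gu gd. hfz_admissible d L gu gd}"

definition hfz_minimizer :: "nat \<Rightarrow> nat \<Rightarrow> real \<Rightarrow> real \<Rightarrow> cmat \<Rightarrow> cmat \<Rightarrow> bool" where
  "hfz_minimizer d L \<mu> U gu gd \<longleftrightarrow> hfz_admissible d L gu gd \<and>
     (\<forall>gu' gd'. hfz_admissible d L gu' gd' \<longrightarrow> hfz d L \<mu> U gu gd \<le> hfz d L \<mu> U gu' gd')"

definition meq :: "nat list set \<Rightarrow> cmat \<Rightarrow> cmat \<Rightarrow> bool" where
  "meq S A B \<longleftrightarrow> (\<forall>x\<in>S. \<forall>y\<in>S. A x y = B x y)"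

definition Mstar :: "nat \<Rightarrow> real \<Rightarrow> real" where
  "Mstar d \<mu> = 12 * (4 * real d)^2 / \<mu>^2"

definition Lstar :: "nat \<Rightarrow> real \<Rightarrow> real" where
  "Lstar d \<mu> = 2 * Mstar d \<mu>"

definition kappa :: "nat \<Rightarrow> real \<Rightarrow> real" where
  "kappa d \<mu> = \<mu>^d / (4^(2*d+1) * exp 1 ^ d * real d ^ d)
     * (1 + 2 * ln 2 * (1 / real d + 1) + ln (4 * real d / \<mu>)) powr (- 2 * real d)"

definition sphere_area :: "nat \<Rightarrow> real" where
  "sphere_area d = 2 * pi powr (real d / 2) / Gamma (real d / 2)"

definition alpha_star :: "nat \<Rightarrow> real \<Rightarrow> real" where
  "alpha_star d \<mu> = sphere_area d * \<mu> powr ((2 + real d) / 2)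
     / (2 powr (1 + real d / 2) * (2 * pi)^d * (4 * real d)^5)"

definition delta_star :: "nat \<Rightarrow> real \<Rightarrow> real \<Rightarrow> real" where
  "delta_star d \<mu> \<alpha> = Min {\<alpha>^2 / (12 * real d)^2,
       \<alpha> / (3 * \<mu> * (4 * Mstar d \<mu> + 1)^d), kappa d \<mu> / 2}"

definition U_star :: "nat \<Rightarrow> real \<Rightarrow> real \<Rightarrow> real" where
  "U_star d \<mu> \<alpha> = max (2 * \<mu> / delta_star d \<mu> \<alpha>) (24 * (real d)^2 / (\<alpha> * delta_star d \<mu> \<alpha>))"

end

theory Submission
  imports Defs
begin

text \<open>Let \<open>E\<close> be minus the energy per site of the free Fermi sea. Plane waves have constant modulus, so
  a density matrix living on a domain \<open>A\<close> has energy at least \<open>- E |A|\<close> (Berezin, Li and Yau). Truncated plane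
  waves are not eigenvectors: their defect is concentrated on the boundary of \<open>A\<close>, and as a state of energy
  at least 1 it partly lies above the Fermi level. This improves the bound by a multiple of the size of the boundary.

  For given \<open>\<gamma>\<^sub>\<up>, \<gamma>\<^sub>\<down>\<close> with site densities \<open>\<rho>\<^sub>\<up>, \<rho>\<^sub>\<down>\<close> let \<open>A\<close> be the sites with
  \<open>\<rho>\<^sub>\<up> \<ge> \<delta>\<close>, \<open>B\<close> the remaining sites with \<open>\<rho>\<^sub>\<down> \<ge> \<delta>\<close>, and \<open>C\<close> the rest. Cutting
  \<open>\<gamma>\<^sub>\<up>\<close> down to \<open>A\<close> and \<open>\<gamma>\<^sub>\<down>\<close> to \<open>B\<close> costs little: in the wrong domain a particle pays \<open>U \<delta>\<close>,
  bonds across a domain wall are paid for by the boundary energy, and every site of \<open>C\<close> saves \<open>E\<close>.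
  In the equality case there are no domain walls and \<open>C\<close> is empty, so by connectedness one domain is the whole lattice.\<close>

subsection \<open>Hermitian matrices and orthonormal bases\<close>

text \<open>A bond between a dense site and a sparse site of density \<rho> carries an entry of
  order sqrt \<rho>, which is not linear in \<rho> and so cannot be charged to the repulsion alone.
  The weighted inequality 2 Re G(x,y) \<le> t + \<rho>/t splits it: \<rho>/t is charged to U
  \<delta> \<rho>, while t, a cost per bond that does not shrink with \<rho>, needs a gain
  proportional to the number of boundary sites with a constant independent of L. This is why the
  Berezin-Li-Yau bound alone is not enough. The gain per boundary site is a = 9E/(2048 d^3): 9/16 is
  the square of the cosine bound 3/4 below the Fermi level, 1/(8d) the share of a boundary state
  above that level, and 1/(16 d^2) the price of dividing by the square of an energy difference of at
  most 4d. With t = a/(4d) on domain sites one needs U \<delta> \<ge> 16 d^2/a, and \<delta> =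
  (E/(8d))^2 is what the saving E on an empty site can afford. So U of order d^7/E^3 suffices. The
  prescribed \<open>U_star\<close> exceeds this because E has a lower bound depending only on d and
  \<mu>, and that bound is a factor of \<open>alpha_star\<close>.\<close>

definition ip :: "nat list set \<Rightarrow> cvec \<Rightarrow> cvec \<Rightarrow> complex" where
  "ip S u v = (\<Sum>x\<in>S. cnj (u x) * v x)"

definition nsq :: "nat list set \<Rightarrow> cvec \<Rightarrow> real" where
  "nsq S v = (\<Sum>x\<in>S. (cmod (v x))\<^sup>2)"

text \<open>This is \<open>apply_mat\<close> without the cutoff outside \<open>S\<close>. Vectors
  matter only on \<open>S\<close>, and the rules \<open>ip_cong\<close>, \<open>mv_cong\<close>,
  \<open>nsq_cong\<close> take the place of equality of functions.\<close>

definition mv :: "nat list set \<Rightarrow> cmat \<Rightarrow> cvec \<Rightarrow> cvec" where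
  "mv S M v = (\<lambda>x. \<Sum>y\<in>S. M x y * v y)"

definition orthonormal :: "nat list set \<Rightarrow> 'i set \<Rightarrow> ('i \<Rightarrow> cvec) \<Rightarrow> bool" where
  "orthonormal S I \<phi> \<longleftrightarrow> (\<forall>i\<in>I. \<forall>j\<in>I. ip S (\<phi> i) (\<phi> j) = of_bool (i = j))"

definition complete_family :: "nat list set \<Rightarrow> 'i set \<Rightarrow> ('i \<Rightarrow> cvec) \<Rightarrow> bool" where
  "complete_family S I \<phi> \<longleftrightarrow> (\<forall>x\<in>S. \<forall>y\<in>S. (\<Sum>i\<in>I. \<phi> i x * cnj (\<phi> i y)) = of_bool (x = y))"

lemma sum_mult_of_bool:
  fixes f :: "'a \<Rightarrow> 'b::comm_semiring_1"
  assumes "finite S" "x \<in> S"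
  shows "(\<Sum>y\<in>S. f y * of_bool (x = y)) = f x" "(\<Sum>y\<in>S. of_bool (x = y) * f y) = f x"
    "(\<Sum>y\<in>S. f y * of_bool (y = x)) = f x" "(\<Sum>y\<in>S. of_bool (y = x) * f y) = f x"
  using assms by (simp_all add: sum.remove)

lemma ip_self: "ip S v v = of_real (nsq S v)"
  by (simp add: ip_def nsq_def complex_norm_square mult.commute[of "cnj _"] del: of_real_power)

lemma cnj_ip: "cnj (ip S u v) = ip S v u"
  by (simp add: ip_def mult.commute)

lemma nsq_nonneg: "0 \<le> nsq S v"
  by (simp add: nsq_def sum_nonneg)

lemma nsq_eq_0_iff: "finite S \<Longrightarrow> nsq S v = 0 \<longleftrightarrow> (\<forall>x\<in>S. v x = 0)"
  by (simp add: nsq_def sum_nonneg_eq_0_iff)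

lemma ip_add_right: "ip S u (\<lambda>x. v x + w x) = ip S u v + ip S u w"
  and ip_add_left: "ip S (\<lambda>x. v x + w x) u = ip S v u + ip S w u"
  and ip_diff_right: "ip S u (\<lambda>x. v x - w x) = ip S u v - ip S u w"
  and ip_diff_left: "ip S (\<lambda>x. v x - w x) u = ip S v u - ip S w u"
  and ip_scale_right: "ip S u (\<lambda>x. c * v x) = c * ip S u v"
  and ip_scale_left: "ip S (\<lambda>x. c * v x) u = cnj c * ip S v u"
  by (simp_all add: ip_def sum.distrib sum_subtractf sum_distrib_left algebra_simps)

lemma ip_sum_right: "ip S u (\<lambda>x. \<Sum>i\<in>I. f i x) = (\<Sum>i\<in>I. ip S u (f i))"
  unfolding ip_def sum_distrib_left by (rule sum.swap)

lemma ip_sum_left: "ip S (\<lambda>x. \<Sum>i\<in>I. f i x) u = (\<Sum>i\<in>I. ip S (f i) u)"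
  unfolding ip_def cnj_sum sum_distrib_right by (rule sum.swap)

lemma ip_cong: "(\<And>x. x \<in> S \<Longrightarrow> u x = u' x) \<Longrightarrow> (\<And>x. x \<in> S \<Longrightarrow> v x = v' x) \<Longrightarrow> ip S u v = ip S u' v'"
  by (simp add: ip_def)

lemma nsq_cong: "(\<And>x. x \<in> S \<Longrightarrow> u x = u' x) \<Longrightarrow> nsq S u = nsq S u'"
  by (simp add: nsq_def)

lemma mv_cong: "(\<And>x. x \<in> S \<Longrightarrow> u x = u' x) \<Longrightarrow> mv S M u = mv S M u'"
  by (simp add: mv_def)

lemma nsq_scale: "nsq S (\<lambda>x. c * v x) = (cmod c)\<^sup>2 * nsq S v"
  by (simp add: nsq_def sum_distrib_left norm_mult power_mult_distrib)

lemma hermitian_ip: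
  assumes "hermitian S M"
  shows "ip S (mv S M u) v = ip S u (mv S M v)"
proof -
  have "ip S (mv S M u) v = (\<Sum>x\<in>S. \<Sum>y\<in>S. cnj (u y) * (M y x * v x))"
    unfolding ip_def mv_def cnj_sum sum_distrib_right
  proof (intro sum.cong refl)
    fix x y assume "x \<in> S" "y \<in> S"
    then have "M y x = cnj (M x y)" using assms unfolding hermitian_def by blast
    then show "cnj (M x y * u y) * v x = cnj (u y) * (M y x * v x)" by simp
  qed
  also have "\<dots> = ip S u (mv S M v)"
    unfolding ip_def mv_def sum_distrib_left by (rule sum.swap)
  finally show ?thesis .
qed

lemma psd_iff: "psd S M \<longleftrightarrow> hermitian S M \<and> (\<forall>v. 0 \<le> Re (ip S v (mv S M v)))"
  by (simp add: psd_def ip_def mv_def sum_distrib_left mult.assoc)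

lemma mv_add: "mv S M (\<lambda>x. v x + w x) = (\<lambda>x. mv S M v x + mv S M w x)"
  and mv_scale: "mv S M (\<lambda>x. c * v x) = (\<lambda>x. c * mv S M v x)"
  by (auto simp: mv_def sum.distrib sum_distrib_left algebra_simps)

text \<open>For small negative t the linear term wins. A positive majorant \<open>c\<close> of
  \<open>b\<close> makes t = -a/c work whatever the sign of \<open>b\<close>.\<close>

lemma quadratic_nonneg_imp_linear_zero:
  fixes a b :: real
  assumes "\<And>t. 0 \<le> 2 * t * a + t\<^sup>2 * b" "0 \<le> a"
  shows "a = 0"
proof (rule ccontr)
  assume "a \<noteq> 0"
  then have a: "a > 0" using assms(2) by simp
  define c where "c = \<bar>b\<bar> + 1"
  have c: "c > 0" "b \<le> c" by (auto simp: c_def)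
  have "0 \<le> 2 * (- a / c) * a + (- a / c)\<^sup>2 * b" by (rule assms(1))
  also have "\<dots> \<le> 2 * (- a / c) * a + (- a / c)\<^sup>2 * c"
    using c by (intro add_left_mono mult_left_mono) auto
  also have "\<dots> = - (a\<^sup>2 / c)" using c by (simp add: field_simps power2_eq_square)
  finally show False using a c by (simp add: field_simps)
qed

text \<open>Perturbing \<open>v\<close> in the direction M v changes the form at first order by 2t
  |M v|^2, which nonnegativity forbids unless M v = 0. Positivity is asked only on \<open>W\<close>:
  this is everything for a positive semidefinite matrix, and the complement of the eigenvectors
  already found in the spectral theorem.\<close>

lemma psd_kernel_on_invariant:
  assumes S: "finite S" and h: "hermitian S M"
    and W: "v \<in> W" "mv S M v \<in> W" "\<And>u w t. u \<in> W \<Longrightarrow> w \<in> W \<Longrightarrow> (\<lambda>x. u x + complex_of_real t * w x) \<in> W"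
    and pos: "\<And>w. w \<in> W \<Longrightarrow> 0 \<le> Re (ip S w (mv S M w))"
    and zero: "Re (ip S v (mv S M v)) = 0"
  shows "\<forall>x\<in>S. mv S M v x = 0"
proof -
  define w where "w = mv S M v"
  have "nsq S w = 0"
  proof (rule quadratic_nonneg_imp_linear_zero)
    fix t :: real
    have "0 \<le> Re (ip S (\<lambda>x. v x + of_real t * w x) (mv S M (\<lambda>x. v x + of_real t * w x)))"
      using pos W(3)[OF W(1) W(2), of t] by (simp add: w_def)
    also have "ip S (\<lambda>x. v x + of_real t * w x) (mv S M (\<lambda>x. v x + of_real t * w x))
       = ip S v w + of_real t * ip S v (mv S M w) + of_real t * ip S w w + of_real (t\<^sup>2) * ip S w (mv S M w)"
      unfolding mv_add mv_scale ip_add_left ip_add_right ip_scale_left ip_scale_right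
      by (simp add: w_def algebra_simps power2_eq_square)
    also have "ip S v (mv S M w) = ip S w w"
      using hermitian_ip[OF h, of v w] by (simp add: w_def)
    finally show "0 \<le> 2 * t * nsq S w + t\<^sup>2 * Re (ip S w (mv S M w))"
      using zero by (simp add: ip_self w_def)
  qed (rule nsq_nonneg)
  then show ?thesis using nsq_eq_0_iff[OF S] by (simp add: w_def)
qed

lemma psd_kernel:
  assumes "finite S" "psd S M" "Re (ip S v (mv S M v)) = 0"
  shows "\<forall>x\<in>S. mv S M v x = 0"
  using psd_kernel_on_invariant[of S M v UNIV] assms by (simp add: psd_iff)

text \<open>Vectors are functions on all lists, so compactness is meant in the product topology: the
  unit sphere is a closed part of a product of closed discs, with factor {0} outside
  \<open>S\<close>. The closed set \<open>C\<close> will hold orthogonality constraints.\<close>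

lemma compact_unit_vectors:
  assumes S: "finite S" and cl: "closed C"
  shows "compact ({v. (\<forall>x. x \<notin> S \<longrightarrow> v x = 0) \<and> nsq S v = 1} \<inter> C)"
proof -
  define K where "K x = (if x \<in> S then cball (0::complex) 1 else {0})" for x :: "nat list"
  have "compactin (product_topology (\<lambda>i. euclidean) UNIV) (PiE UNIV K)"
    unfolding compactin_PiE by (auto simp: K_def)
  then have cK: "compact (PiE UNIV K)"
    by (simp add: euclidean_product_topology)
  have cont: "continuous_on UNIV (nsq S)"
    unfolding nsq_def by (intro continuous_intros continuous_on_product_coordinates)
  have "closed (nsq S -` {1})"
    using continuous_closed_vimage[of "{1::real}" "nsq S"] cont
    by (simp add: continuous_on_eq_continuous_at)
  moreover have "{v. (\<forall>x. x \<notin> S \<longrightarrow> v x = 0) \<and> nsq S v = 1} \<inter> C = PiE UNIV K \<inter> (nsq S -` {1} \<inter> C)"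
  proof -
    have "cmod (v x) \<le> 1" if "nsq S v = 1" "x \<in> S" for v x
    proof -
      have "(cmod (v x))\<^sup>2 \<le> nsq S v"
        unfolding nsq_def using S that by (intro member_le_sum) auto
      then show ?thesis using that by (simp add: power2_le_iff_abs_le abs_square_le_1)
    qed
    then show ?thesis by (auto simp: K_def PiE_iff split: if_splits)
  qed
  ultimately show ?thesis using cK cl by (simp add: compact_Int_closed closed_Int)
qed

section \<open>Bessel's identity, completeness and Parseval's identity\<close>

lemma bessel:
  assumes "finite I" "orthonormal S I \<phi>"
  shows "nsq S (\<lambda>x. v x - (\<Sum>i\<in>I. ip S (\<phi> i) v * \<phi> i x)) = nsq S v - (\<Sum>i\<in>I. (cmod (ip S (\<phi> i) v))\<^sup>2)"
proof -
  let ?r = "\<lambda>x. v x - (\<Sum>i\<in>I. ip S (\<phi> i) v * \<phi> i x)"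
  have orth: "ip S (\<phi> j) ?r = 0" if "j \<in> I" for j
  proof -
    have "ip S (\<phi> j) ?r = ip S (\<phi> j) v - (\<Sum>i\<in>I. ip S (\<phi> i) v * of_bool (j = i))"
      unfolding ip_diff_right ip_sum_right ip_scale_right
      using assms(2) that by (simp add: orthonormal_def)
    also have "\<dots> = 0" using assms(1) that by (simp add: sum_mult_of_bool)
    finally show ?thesis .
  qed
  have "ip S ?r ?r = ip S v ?r"
    using orth by (simp add: ip_diff_left ip_sum_left ip_scale_left)
  also have "\<dots> = ip S v v - (\<Sum>i\<in>I. ip S (\<phi> i) v * cnj (ip S (\<phi> i) v))"
    by (simp add: ip_diff_right ip_sum_right ip_scale_right cnj_ip)
  also have "\<dots> = of_real (nsq S v - (\<Sum>i\<in>I. (cmod (ip S (\<phi> i) v))\<^sup>2))"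
    by (simp add: ip_self flip: complex_norm_square)
  finally show ?thesis unfolding ip_self of_real_eq_iff .
qed

lemma bessel_le:
  assumes "finite I" "orthonormal S I \<phi>"
  shows "(\<Sum>i\<in>I. (cmod (ip S (\<phi> i) v))\<^sup>2) \<le> nsq S v"
  using bessel[OF assms, of v] nsq_nonneg[of S "\<lambda>x. v x - (\<Sum>i\<in>I. ip S (\<phi> i) v * \<phi> i x)"] by linarith

lemma ip_point: "finite S \<Longrightarrow> x \<in> S \<Longrightarrow> ip S u (\<lambda>y. of_bool (y = x)) = cnj (u x)"
  by (simp add: ip_def sum_mult_of_bool)

lemma nsq_point: "finite S \<Longrightarrow> x \<in> S \<Longrightarrow> nsq S (\<lambda>y. of_bool (y = x)) = 1"
  by (simp add: nsq_def of_bool_def if_distrib[of cmod] if_distrib[of "\<lambda>z. z\<^sup>2"] cong: if_cong)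

lemma orthonormal_nsq:
  assumes "orthonormal S I \<phi>" "i \<in> I"
  shows "nsq S (\<phi> i) = 1"
proof -
  have "complex_of_real (nsq S (\<phi> i)) = 1"
    using assms by (simp add: orthonormal_def flip: ip_self)
  then show ?thesis using of_real_eq_1_iff by blast
qed

lemma sum_nsq_orthonormal:
  assumes "orthonormal S I \<phi>" "finite I"
  shows "(\<Sum>x\<in>S. \<Sum>i\<in>I. (cmod (\<phi> i x))\<^sup>2) = card I"
proof -
  have "nsq S (\<phi> i) = 1" if "i \<in> I" for i using orthonormal_nsq[OF assms(1) that] .
  then show ?thesis by (subst sum.swap) (simp add: flip: nsq_def)
qed

text \<open>By Bessel the residues of the point vectors have squared norms 1 - (sum of the squared
  moduli at x), and these add up to card S - card I = 0. So every residue vanishes, which is the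
  resolution of the identity; counting replaces dimension theory.\<close>

lemma orthonormal_complete_family:
  assumes S: "finite S" and I: "finite I" and on: "orthonormal S I \<phi>" and card: "card I = card S"
  shows "complete_family S I \<phi>"
proof -
  have b: "nsq S (\<lambda>y. of_bool (y = x) - (\<Sum>i\<in>I. cnj (\<phi> i x) * \<phi> i y)) = 1 - (\<Sum>i\<in>I. (cmod (\<phi> i x))\<^sup>2)"
    if "x \<in> S" for x
    using bessel[OF I on, of "\<lambda>y. of_bool (y = x)"] S that by (simp add: ip_point nsq_point)
  have "(\<Sum>x\<in>S. 1 - (\<Sum>i\<in>I. (cmod (\<phi> i x))\<^sup>2)) = 0"
    using sum_nsq_orthonormal[OF on I] card by (simp add: sum_subtractf)
  moreover have "0 \<le> 1 - (\<Sum>i\<in>I. (cmod (\<phi> i x))\<^sup>2)" if "x \<in> S" for x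
    using b[OF that] nsq_nonneg[of S "\<lambda>y. of_bool (y = x) - (\<Sum>i\<in>I. cnj (\<phi> i x) * \<phi> i y)"] by linarith
  ultimately have "1 - (\<Sum>i\<in>I. (cmod (\<phi> i x))\<^sup>2) = 0" if "x \<in> S" for x
    using S that by (simp add: sum_nonneg_eq_0_iff)
  then have "\<forall>y\<in>S. of_bool (y = x) - (\<Sum>i\<in>I. cnj (\<phi> i x) * \<phi> i y) = 0" if "x \<in> S" for x
    using b[OF that] that nsq_eq_0_iff[OF S] by simp
  then have "of_bool (x = y) = (\<Sum>i\<in>I. \<phi> i x * cnj (\<phi> i y))" if "x \<in> S" "y \<in> S" for x y
    using that by (simp add: mult.commute)
  then show ?thesis by (simp add: complete_family_def)
qed

lemma complete_expand:
  assumes "finite S" "complete_family S I \<phi>" "x \<in> S"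
  shows "v x = (\<Sum>i\<in>I. ip S (\<phi> i) v * \<phi> i x)"
proof -
  have "(\<Sum>i\<in>I. ip S (\<phi> i) v * \<phi> i x) = (\<Sum>y\<in>S. (\<Sum>i\<in>I. \<phi> i x * cnj (\<phi> i y)) * v y)"
    unfolding ip_def sum_distrib_right
    by (subst sum.swap) (simp add: mult_ac)
  also have "\<dots> = (\<Sum>y\<in>S. of_bool (x = y) * v y)"
    using assms by (intro sum.cong refl) (metis complete_family_def)
  also have "\<dots> = v x" using assms by (simp add: sum_mult_of_bool)
  finally show ?thesis by simp
qed

lemma parseval_ip:
  assumes "finite S" "complete_family S I \<phi>"
  shows "ip S u v = (\<Sum>i\<in>I. ip S u (\<phi> i) * ip S (\<phi> i) v)"
proof -
  have "ip S u v = ip S u (\<lambda>x. \<Sum>i\<in>I. ip S (\<phi> i) v * \<phi> i x)"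
    using complete_expand[OF assms] by (intro ip_cong) auto
  then show ?thesis unfolding ip_sum_right ip_scale_right by (simp add: mult.commute)
qed

lemma parseval:
  assumes "finite S" "complete_family S I \<phi>"
  shows "nsq S v = (\<Sum>i\<in>I. (cmod (ip S (\<phi> i) v))\<^sup>2)"
proof -
  have "complex_of_real (nsq S v) = of_real (\<Sum>i\<in>I. (cmod (ip S (\<phi> i) v))\<^sup>2)"
    unfolding ip_self[symmetric] parseval_ip[OF assms, of v v] of_real_sum
    by (intro sum.cong refl) (metis cnj_ip complex_norm_square mult.commute of_real_power)
  then show ?thesis unfolding of_real_eq_iff .
qed

text \<open>The index type is left free: the eigenvectors of a domain are numbered by naturals, the
  plane waves of the whole lattice by their momenta.\<close>

definition eigbasis :: "nat list set \<Rightarrow> cmat \<Rightarrow> 'i set \<Rightarrow> ('i \<Rightarrow> cvec) \<Rightarrow> ('i \<Rightarrow> real) \<Rightarrow> bool" where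
  "eigbasis S M I \<phi> l \<longleftrightarrow> finite I \<and> orthonormal S I \<phi> \<and> complete_family S I \<phi> \<and>
     (\<forall>i\<in>I. \<forall>x\<in>S. mv S M (\<phi> i) x = of_real (l i) * \<phi> i x)"

lemma eigbasis_ip_mv:
  assumes "eigbasis S M I \<phi> l" "hermitian S M" "i \<in> I"
  shows "ip S (\<phi> i) (mv S M v) = of_real (l i) * ip S (\<phi> i) v"
proof -
  have "ip S (\<phi> i) (mv S M v) = ip S (mv S M (\<phi> i)) v"
    using hermitian_ip[OF assms(2)] by simp
  also have "\<dots> = ip S (\<lambda>x. of_real (l i) * \<phi> i x) v"
    using assms by (intro ip_cong) (auto simp: eigbasis_def)
  finally show ?thesis by (simp add: ip_scale_left)
qed

lemma eigbasis_quadratic_form: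
  assumes "finite S" "eigbasis S M I \<phi> l" "hermitian S M"
  shows "Re (ip S v (mv S M v)) = (\<Sum>i\<in>I. l i * (cmod (ip S (\<phi> i) v))\<^sup>2)"
proof -
  have "ip S v (mv S M v) = (\<Sum>i\<in>I. ip S v (\<phi> i) * ip S (\<phi> i) (mv S M v))"
    using assms by (intro parseval_ip) (auto simp: eigbasis_def)
  also have "\<dots> = (\<Sum>i\<in>I. of_real (l i * (cmod (ip S (\<phi> i) v))\<^sup>2))"
  proof (intro sum.cong refl)
    fix i assume "i \<in> I"
    have "ip S v (\<phi> i) * ip S (\<phi> i) v = of_real ((cmod (ip S (\<phi> i) v))\<^sup>2)"
      using complex_norm_square[of "ip S (\<phi> i) v"] by (simp add: cnj_ip mult.commute)
    then show "ip S v (\<phi> i) * ip S (\<phi> i) (mv S M v) = of_real (l i * (cmod (ip S (\<phi> i) v))\<^sup>2)"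
      using eigbasis_ip_mv[OF assms(2,3) \<open>i \<in> I\<close>, of v] by (simp add: mult.left_commute)
  qed
  finally show ?thesis by (simp flip: of_real_sum)
qed

text \<open>Minimise the Rayleigh quotient over the unit vectors orthogonal to the \<open>n\<close>
  eigenvectors already found. Subtracting the minimum m leaves a form that is nonnegative on this
  complement and zero at the minimiser, which is therefore an eigenvector.\<close>

lemma orthonormal_eigenvectors_exist:
  assumes S: "finite S" and h: "hermitian S M" and n: "n \<le> card S"
  shows "\<exists>\<phi> l. orthonormal S {..<n} \<phi> \<and> (\<forall>i<n. \<forall>x\<in>S. mv S M (\<phi> i) x = of_real (l i) * \<phi> i x)"
  using n
proof (induction n)
  case 0
  show ?case by (simp add: orthonormal_def)
next
  case (Suc n)
  then obtain \<phi> and l :: "nat \<Rightarrow> real" where on: "orthonormal S {..<n} \<phi>"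
    and eig: "\<And>i x. i < n \<Longrightarrow> x \<in> S \<Longrightarrow> mv S M (\<phi> i) x = of_real (l i) * \<phi> i x"
    by auto
  define C where "C = {v. \<forall>i<n. ip S (\<phi> i) v = 0}"
  define W where "W = {v. (\<forall>x. x \<notin> S \<longrightarrow> v x = 0) \<and> nsq S v = 1} \<inter> C"
  have "closed (\<Inter>i<n. (\<lambda>v. ip S (\<phi> i) v) -` {0})"
  proof (intro closed_INT ballI)
    fix i
    have "continuous_on UNIV (\<lambda>v. ip S (\<phi> i) v)"
      unfolding ip_def by (intro continuous_intros continuous_on_product_coordinates)
    then show "closed ((\<lambda>v. ip S (\<phi> i) v) -` {0})"
      using continuous_closed_vimage[of "{0::complex}" "ip S (\<phi> i)"]
      by (simp add: continuous_on_eq_continuous_at)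
  qed
  moreover have "C = (\<Inter>i<n. (\<lambda>v. ip S (\<phi> i) v) -` {0})" by (auto simp: C_def)
  ultimately have "closed C" by simp
  then have cW: "compact W" unfolding W_def by (rule compact_unit_vectors[OF S])
  \<comment> \<open>A nonzero vector satisfying the constraints can be scaled to norm 1 and cut off
    outside \<open>S\<close>, since orthogonality sees only \<open>S\<close>.\<close>
  have normalise: "\<exists>c>0. (\<lambda>x. if x \<in> S then of_real c * v x else 0) \<in> W \<and> c\<^sup>2 * nsq S v = 1"
    if "v \<in> C" "nsq S v \<noteq> 0" for v
  proof -
    have p: "nsq S v > 0" using that nsq_nonneg[of S v] by simp
    define c where "c = 1 / sqrt (nsq S v)"
    have c: "c > 0" "c\<^sup>2 * nsq S v = 1" using p by (auto simp: c_def power_divide)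
    let ?u = "\<lambda>x. if x \<in> S then of_real c * v x else 0"
    have "nsq S ?u = nsq S (\<lambda>x. of_real c * v x)" by (intro nsq_cong) auto
    also have "\<dots> = 1" using c by (simp add: nsq_scale)
    finally have "nsq S ?u = 1" .
    moreover have "ip S (\<phi> i) ?u = of_real c * ip S (\<phi> i) v" for i
      unfolding ip_scale_right[symmetric] by (intro ip_cong) auto
    ultimately have "?u \<in> W" using that by (auto simp: W_def C_def)
    then show ?thesis using c by blast
  qed
  \<comment> \<open>The squared moduli of the eigenvectors sum to n < card S over all sites, so at
    some site they sum to less than 1; the residue of the point vector there is nonzero.\<close>
  have "W \<noteq> {}"
  proof -
    have "\<exists>x\<in>S. (\<Sum>i<n. (cmod (\<phi> i x))\<^sup>2) < 1"
    proof (rule ccontr)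
      assume "\<not> ?thesis"
      then have "(\<Sum>x\<in>S. 1::real) \<le> (\<Sum>x\<in>S. \<Sum>i<n. (cmod (\<phi> i x))\<^sup>2)"
        by (intro sum_mono) (auto simp: not_less)
      then show False using sum_nsq_orthonormal[OF on] Suc.prems by simp
    qed
    then obtain x where x: "x \<in> S" "(\<Sum>i<n. (cmod (\<phi> i x))\<^sup>2) < 1" by blast
    let ?e = "\<lambda>y. of_bool (y = x) :: complex"
    let ?r = "\<lambda>y. ?e y - (\<Sum>i<n. ip S (\<phi> i) ?e * \<phi> i y)"
    have "nsq S ?r \<noteq> 0"
      using bessel[OF _ on, of ?e] x S by (simp add: ip_point nsq_point)
    moreover have "?r \<in> C"
      unfolding C_def
    proof safe
      fix j assume j: "j < n"
      have "ip S (\<phi> j) ?r = ip S (\<phi> j) ?e - (\<Sum>i<n. ip S (\<phi> i) ?e * of_bool (j = i))"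
        unfolding ip_diff_right ip_sum_right ip_scale_right
        using on j by (simp add: orthonormal_def)
      also have "\<dots> = 0" using j by (simp add: sum_mult_of_bool)
      finally show "ip S (\<phi> j) ?r = 0" .
    qed
    ultimately show ?thesis using normalise by blast
  qed
  moreover have "continuous_on W (\<lambda>v. Re (ip S v (mv S M v)))"
    unfolding ip_def mv_def
    by (intro continuous_intros continuous_on_subset[OF continuous_on_product_coordinates]) auto
  ultimately obtain v where v: "v \<in> W" "\<And>w. w \<in> W \<Longrightarrow> Re (ip S v (mv S M v)) \<le> Re (ip S w (mv S M w))"
    using continuous_attains_inf[OF cW] by blast
  define m where "m = Re (ip S v (mv S M v))"
  define N where "N = (\<lambda>x y. M x y - (if x = y then complex_of_real m else 0))"
  have hN: "hermitian S N" unfolding hermitian_def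
  proof safe
    fix x y assume "x \<in> S" "y \<in> S"
    then have "M x y = cnj (M y x)" using h unfolding hermitian_def by blast
    then show "N x y = cnj (N y x)" unfolding N_def complex_cnj_diff by (rule arg_cong2) simp
  qed
  have mvN: "mv S N w x = mv S M w x - of_real m * w x" if "x \<in> S" for w x
  proof -
    have "mv S N w x = (\<Sum>y\<in>S. M x y * w y - of_real m * w y * of_bool (x = y))"
      unfolding mv_def N_def by (intro sum.cong) (auto simp: algebra_simps)
    then show ?thesis
      using sum_mult_of_bool(1)[OF S that, of "\<lambda>y. of_real m * w y"] by (simp add: sum_subtractf mv_def)
  qed
  have qN: "Re (ip S w (mv S N w)) = Re (ip S w (mv S M w)) - m * nsq S w" for w
  proof -
    have "ip S w (mv S N w) = ip S w (\<lambda>x. mv S M w x - of_real m * w x)"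
      by (intro ip_cong) (auto simp: mvN)
    then show ?thesis by (simp add: ip_diff_right ip_scale_right ip_self)
  qed
  have pos: "0 \<le> Re (ip S w (mv S N w))" if "w \<in> C" for w
  proof (cases "nsq S w = 0")
    case True
    then have "ip S w (mv S N w) = 0" using nsq_eq_0_iff[OF S] by (simp add: ip_def)
    then show ?thesis by simp
  next
    case False
    then obtain c where c: "c > 0" "(\<lambda>x. if x \<in> S then of_real c * w x else 0) \<in> W" "c\<^sup>2 * nsq S w = 1"
      using normalise[OF \<open>w \<in> C\<close> False] by blast
    let ?u = "\<lambda>x. if x \<in> S then of_real c * w x else 0"
    have "mv S M ?u = mv S M (\<lambda>x. of_real c * w x)" by (intro mv_cong) auto
    then have "ip S ?u (mv S M ?u) = ip S (\<lambda>x. of_real c * w x) (mv S M (\<lambda>x. of_real c * w x))"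
      by (intro ip_cong) auto
    then have "Re (ip S ?u (mv S M ?u)) = c\<^sup>2 * Re (ip S w (mv S M w))"
      by (simp add: mv_scale ip_scale_left ip_scale_right power2_eq_square)
    then have "m \<le> c\<^sup>2 * Re (ip S w (mv S M w))" using v(2)[OF c(2)] by (simp add: m_def)
    then have "c\<^sup>2 * (m * nsq S w) \<le> c\<^sup>2 * Re (ip S w (mv S M w))"
      using c(3) by (simp add: mult.left_commute)
    then show ?thesis using c(1) qN by simp
  qed
  have "\<forall>x\<in>S. mv S N v x = 0"
  proof (rule psd_kernel_on_invariant[OF S hN])
    show "v \<in> C" using v(1) by (simp add: W_def)
    \<comment> \<open>The complement is invariant: \<open>N\<close> is hermitian and each
      \<open>\<phi> i\<close> is one of its eigenvectors.\<close>
    show "mv S N v \<in> C"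
      unfolding C_def
    proof safe
      fix i assume i: "i < n"
      have "ip S (\<phi> i) (mv S N v) = ip S (mv S N (\<phi> i)) v" using hermitian_ip[OF hN] by simp
      also have "\<dots> = ip S (\<lambda>x. of_real (l i - m) * \<phi> i x) v"
        using eig[OF i] by (intro ip_cong) (auto simp: mvN algebra_simps)
      also have "\<dots> = 0" using v(1) i by (simp add: ip_scale_left W_def C_def)
      finally show "ip S (\<phi> i) (mv S N v) = 0" .
    qed
    show "(\<lambda>x. u x + complex_of_real t * w x) \<in> C" if "u \<in> C" "w \<in> C" for u w t
      using that by (auto simp: C_def ip_add_right ip_scale_right)
    show "Re (ip S v (mv S N v)) = 0" using v(1) by (simp add: qN m_def W_def)
  qed (rule pos)
  then have vm: "\<forall>x\<in>S. mv S M v x = of_real m * v x" by (simp add: mvN)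
  have vo: "ip S (\<phi> i) v = 0" "ip S v (\<phi> i) = 0" if "i < n" for i
    using v(1) that cnj_ip[of S "\<phi> i" v] by (auto simp: W_def C_def)
  have "ip S v v = 1" using v(1) by (simp add: ip_self W_def)
  then have "orthonormal S {..<Suc n} (\<phi>(n := v))"
    using on vo by (auto simp: orthonormal_def less_Suc_eq)
  moreover have "\<forall>i<Suc n. \<forall>x\<in>S. mv S M ((\<phi>(n := v)) i) x = of_real ((l(n := m)) i) * (\<phi>(n := v)) i x"
    using vm eig by (auto simp: less_Suc_eq)
  ultimately show ?case by blast
qed

theorem spectral_theorem:
  assumes "finite S" "hermitian S M"
  obtains \<phi> l where "eigbasis S M {..<card S} \<phi> l"
proof -
  obtain \<phi> and l :: "nat \<Rightarrow> real" where "orthonormal S {..<card S} \<phi>"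
    and "\<forall>i<card S. \<forall>x\<in>S. mv S M (\<phi> i) x = of_real (l i) * \<phi> i x"
    using orthonormal_eigenvectors_exist[OF assms, of "card S"] by blast
  then have "eigbasis S M {..<card S} \<phi> l"
    using orthonormal_complete_family[OF assms(1) finite_lessThan] by (simp add: eigbasis_def)
  then show thesis by (rule that)
qed

section \<open>Spectral decomposition of entries, traces and spectral projections\<close>

lemma mv_point:
  assumes "finite S" "z \<in> S"
  shows "mv S M (\<lambda>y. of_bool (y = z)) = (\<lambda>x. M x z)"
  using assms by (simp add: mv_def sum_mult_of_bool)

text \<open>Apply M to the resolution of the identity. In this form a minimiser is later rebuilt
  from the fact that plane waves are its eigenvectors.\<close>

lemma eigbasis_entry:
  assumes S: "finite S" and e: "eigbasis S M I \<phi> l" and xy: "x \<in> S" "y \<in> S"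
  shows "M x y = (\<Sum>i\<in>I. of_real (l i) * \<phi> i x * cnj (\<phi> i y))"
proof -
  have "(\<Sum>i\<in>I. of_real (l i) * \<phi> i x * cnj (\<phi> i y)) = (\<Sum>i\<in>I. \<Sum>z\<in>S. M x z * (\<phi> i z * cnj (\<phi> i y)))"
  proof (intro sum.cong refl)
    fix i assume "i \<in> I"
    then have "of_real (l i) * \<phi> i x = mv S M (\<phi> i) x" using e xy by (simp add: eigbasis_def)
    then show "of_real (l i) * \<phi> i x * cnj (\<phi> i y) = (\<Sum>z\<in>S. M x z * (\<phi> i z * cnj (\<phi> i y)))"
      by (simp add: mv_def sum_distrib_right mult.assoc)
  qed
  also have "\<dots> = (\<Sum>z\<in>S. M x z * (\<Sum>i\<in>I. \<phi> i z * cnj (\<phi> i y)))"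
    unfolding sum_distrib_left by (rule sum.swap)
  also have "\<dots> = (\<Sum>z\<in>S. M x z * of_bool (z = y))"
    using e xy by (intro sum.cong refl) (simp add: eigbasis_def complete_family_def)
  finally show ?thesis using S xy by (simp add: sum_mult_of_bool)
qed

lemma eigbasis_trace:
  assumes S: "finite S" and e: "eigbasis S M I \<phi> l"
  shows "mtrace S (mmul S M G) = (\<Sum>i\<in>I. of_real (l i) * ip S (\<phi> i) (mv S G (\<phi> i)))"
proof -
  have "mtrace S (mmul S M G) = (\<Sum>x\<in>S. \<Sum>z\<in>S. \<Sum>i\<in>I. of_real (l i) * \<phi> i x * cnj (\<phi> i z) * G z x)"
    unfolding mtrace_def mmul_def by (simp add: eigbasis_entry[OF S e] sum_distrib_right)
  also have "\<dots> = (\<Sum>x\<in>S. \<Sum>i\<in>I. \<Sum>z\<in>S. of_real (l i) * \<phi> i x * cnj (\<phi> i z) * G z x)"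
    by (intro sum.cong refl sum.swap)
  also have "\<dots> = (\<Sum>i\<in>I. \<Sum>x\<in>S. \<Sum>z\<in>S. of_real (l i) * \<phi> i x * cnj (\<phi> i z) * G z x)"
    by (rule sum.swap)
  also have "\<dots> = (\<Sum>i\<in>I. \<Sum>z\<in>S. \<Sum>x\<in>S. of_real (l i) * \<phi> i x * cnj (\<phi> i z) * G z x)"
    by (intro sum.cong refl sum.swap)
  also have "\<dots> = (\<Sum>i\<in>I. of_real (l i) * ip S (\<phi> i) (mv S G (\<phi> i)))"
    by (simp add: ip_def mv_def sum_distrib_left mult_ac)
  finally show ?thesis .
qed

text \<open>For an orthonormal family this is the orthogonal projection onto the span of the members
  in \<open>J\<close>. It is cut off outside \<open>S\<close> because \<open>spec_proj_below\<close>
  demands a supported matrix.\<close>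

definition spec_part :: "nat list set \<Rightarrow> 'i set \<Rightarrow> ('i \<Rightarrow> cvec) \<Rightarrow> cmat" where
  "spec_part S J \<phi> = (\<lambda>x y. if x \<in> S \<and> y \<in> S then \<Sum>i\<in>J. \<phi> i x * cnj (\<phi> i y) else 0)"

lemma mv_spec_part:
  assumes "x \<in> S"
  shows "mv S (spec_part S J \<phi>) v x = (\<Sum>i\<in>J. ip S (\<phi> i) v * \<phi> i x)"
proof -
  have "mv S (spec_part S J \<phi>) v x = (\<Sum>y\<in>S. \<Sum>i\<in>J. \<phi> i x * cnj (\<phi> i y) * v y)"
    using assms unfolding mv_def spec_part_def by (simp add: sum_distrib_right)
  also have "\<dots> = (\<Sum>i\<in>J. \<Sum>y\<in>S. \<phi> i x * cnj (\<phi> i y) * v y)" by (rule sum.swap)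
  finally show ?thesis by (simp add: ip_def sum_distrib_left sum_distrib_right mult_ac)
qed

lemma apply_mat_mv: "x \<in> S \<Longrightarrow> apply_mat S M v x = mv S M v x"
  by (simp add: apply_mat_def mv_def)

lemma apply_mat_outside: "x \<notin> S \<Longrightarrow> apply_mat S M v x = 0"
  by (simp add: apply_mat_def)

lemma hermitian_spec_part: "hermitian S (spec_part S J \<phi>)"
  unfolding hermitian_def by (simp add: spec_part_def mult.commute)

lemma supported_spec_part: "supported S (spec_part S J \<phi>)"
  by (simp add: supported_def spec_part_def)

lemma mmul_col: "mmul S A B x y = mv S A (\<lambda>z. B z y) x"
  by (simp add: mmul_def mv_def)

lemma ip_spec_part_col:
  assumes "finite J" "orthonormal S I \<phi>" "J \<subseteq> I" "i \<in> I" "y \<in> S"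
  shows "ip S (\<phi> i) (\<lambda>z. spec_part S J \<phi> z y) = of_bool (i \<in> J) * cnj (\<phi> i y)"
proof -
  have "ip S (\<phi> i) (\<lambda>z. spec_part S J \<phi> z y) = ip S (\<phi> i) (\<lambda>z. \<Sum>j\<in>J. cnj (\<phi> j y) * \<phi> j z)"
    using assms(5) by (intro ip_cong) (simp_all add: spec_part_def mult.commute)
  also have "\<dots> = (\<Sum>j\<in>J. cnj (\<phi> j y) * of_bool (i = j))"
    unfolding ip_sum_right ip_scale_right using assms by (intro sum.cong refl) (auto simp: orthonormal_def)
  also have "\<dots> = of_bool (i \<in> J) * cnj (\<phi> i y)"
  proof (cases "i \<in> J")
    case True then show ?thesis using assms(1) by (simp add: sum_mult_of_bool)
  next
    case False then show ?thesis by (auto intro: sum.neutral)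
  qed
  finally show ?thesis .
qed

lemma spec_part_idem:
  assumes "finite J" "orthonormal S I \<phi>" "J \<subseteq> I"
  shows "mmul S (spec_part S J \<phi>) (spec_part S J \<phi>) = spec_part S J \<phi>"
proof (intro ext)
  fix x y
  show "mmul S (spec_part S J \<phi>) (spec_part S J \<phi>) x y = spec_part S J \<phi> x y"
  proof (cases "x \<in> S \<and> y \<in> S")
    case True
    then have "mmul S (spec_part S J \<phi>) (spec_part S J \<phi>) x y
      = (\<Sum>i\<in>J. ip S (\<phi> i) (\<lambda>z. spec_part S J \<phi> z y) * \<phi> i x)"
      by (simp add: mmul_col mv_spec_part)
    also have "\<dots> = (\<Sum>i\<in>J. cnj (\<phi> i y) * \<phi> i x)"
    proof (intro sum.cong refl)
      fix i assume "i \<in> J"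
      then show "ip S (\<phi> i) (\<lambda>z. spec_part S J \<phi> z y) * \<phi> i x = cnj (\<phi> i y) * \<phi> i x"
        using ip_spec_part_col[OF assms, of i y] assms(3) True by auto
    qed
    also have "\<dots> = spec_part S J \<phi> x y" using True by (simp add: spec_part_def mult.commute)
    finally show ?thesis .
  next
    case False
    then show ?thesis by (auto simp: mmul_def spec_part_def)
  qed
qed

lemma apply_mat_mrange_idem:
  assumes "supported S P" "mmul S P P = P" "w \<in> mrange S P"
  shows "apply_mat S P w = w"
proof
  fix x
  obtain u where u: "w = apply_mat S P u" using assms(3) by (auto simp: mrange_def)
  show "apply_mat S P w x = w x"
  proof (cases "x \<in> S")
    case True
    have "apply_mat S P w x = (\<Sum>y\<in>S. P x y * (\<Sum>z\<in>S. P y z * u z))"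
      using True by (simp add: apply_mat_def u)
    also have "\<dots> = (\<Sum>y\<in>S. \<Sum>z\<in>S. P x y * P y z * u z)" by (simp add: sum_distrib_left mult.assoc)
    also have "\<dots> = (\<Sum>z\<in>S. \<Sum>y\<in>S. P x y * P y z * u z)" by (rule sum.swap)
    also have "\<dots> = (\<Sum>z\<in>S. mmul S P P x z * u z)" by (simp add: mmul_def sum_distrib_right)
    also have "\<dots> = w x" using True unfolding assms(2) by (simp add: apply_mat_def u)
    finally show ?thesis .
  next
    case False
    then show ?thesis by (simp add: u apply_mat_outside)
  qed
qed

lemma mmul_eq_of_mrange:
  assumes S: "finite S" and P: "supported S P" and Q: "supported S Q" "mmul S Q Q = Q"
    and sub: "mrange S P \<subseteq> mrange S Q"
  shows "mmul S Q P = P"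
proof (intro ext)
  fix x y
  show "mmul S Q P x y = P x y"
  proof (cases "x \<in> S \<and> y \<in> S")
    case True
    have col: "apply_mat S P (\<lambda>z. of_bool (z = y)) = (\<lambda>z. P z y)"
    proof
      fix z
      show "apply_mat S P (\<lambda>z. of_bool (z = y)) z = P z y"
        using True P mv_point[OF S, of y P]
        by (cases "z \<in> S") (auto simp: apply_mat_mv apply_mat_outside supported_def)
    qed
    then have "(\<lambda>z. P z y) \<in> mrange S Q" using sub unfolding mrange_def by (metis rangeI subsetD)
    then have "apply_mat S Q (\<lambda>z. P z y) = (\<lambda>z. P z y)" by (rule apply_mat_mrange_idem[OF Q])
    then have "apply_mat S Q (\<lambda>z. P z y) x = P x y" by (rule fun_cong)
    then show ?thesis using True by (simp add: apply_mat_mv mmul_col)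
  next
    case False
    then have "mmul S Q P x y = 0" "P x y = 0"
      using P Q(1) by (auto simp: mmul_def supported_def)
    then show ?thesis by simp
  qed
qed

text \<open>Equal ranges give QP = P and PQ = Q, and the adjoint of the first equation is PQ = P.
  This uniqueness is what resolves the definite description in
  \<open>spec_proj_below\<close>.\<close>

lemma orthogonal_projection_unique:
  assumes S: "finite S"
    and P: "supported S P" "hermitian S P" "mmul S P P = P"
    and Q: "supported S Q" "hermitian S Q" "mmul S Q Q = Q"
    and eq: "mrange S P = mrange S Q"
  shows "P = Q"
proof (intro ext)
  fix x y
  have QP: "mmul S Q P = P" and PQ: "mmul S P Q = Q"
    using mmul_eq_of_mrange[OF S] P Q eq by auto
  show "P x y = Q x y"
  proof (cases "x \<in> S \<and> y \<in> S")
    case True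
    have "P x y = cnj (mmul S Q P y x)"
      using True P(2) unfolding QP hermitian_def by blast
    also have "\<dots> = (\<Sum>z\<in>S. cnj (Q y z) * cnj (P z x))" by (simp add: mmul_def)
    also have "\<dots> = (\<Sum>z\<in>S. P x z * Q z y)"
    proof (intro sum.cong refl)
      fix z assume "z \<in> S"
      then have "Q z y = cnj (Q y z)" "P x z = cnj (P z x)"
        using True P(2) Q(2) unfolding hermitian_def by blast+
      then show "cnj (Q y z) * cnj (P z x) = P x z * Q z y" by simp
    qed
    also have "\<dots> = Q x y" using PQ by (metis mmul_def)
    finally show ?thesis .
  next
    case False
    then show ?thesis using P(1) Q(1) by (auto simp: supported_def)
  qed
qed

text \<open>The range is described by orthogonality to the remaining basis vectors, so that it can
  be matched with the same description of the sum of eigenspaces.\<close>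

lemma mrange_spec_part:
  assumes S: "finite S" and e: "eigbasis S M I \<phi> l" and h: "hermitian S M"
  shows "mrange S (spec_part S {i \<in> I. l i < t} \<phi>)
    = {w \<in> vecs S. \<forall>i\<in>I. \<not> l i < t \<longrightarrow> ip S (\<phi> i) w = 0}" (is "_ = ?W")
proof (intro equalityI subsetI)
  let ?J = "{i \<in> I. l i < t}"
  have fin: "finite I" and on: "orthonormal S I \<phi>" and cf: "complete_family S I \<phi>"
    using e by (auto simp: eigbasis_def)
  fix w assume "w \<in> mrange S (spec_part S ?J \<phi>)"
  then obtain v where v: "w = apply_mat S (spec_part S ?J \<phi>) v" by (auto simp: mrange_def)
  have "ip S (\<phi> i) w = 0" if i: "i \<in> I" "\<not> l i < t" for i
  proof -
    have "ip S (\<phi> i) w = ip S (\<phi> i) (\<lambda>x. \<Sum>j\<in>?J. ip S (\<phi> j) v * \<phi> j x)"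
      unfolding v by (intro ip_cong) (simp_all add: apply_mat_mv mv_spec_part)
    also have "\<dots> = (\<Sum>j\<in>?J. ip S (\<phi> j) v * of_bool (i = j))"
      unfolding ip_sum_right ip_scale_right using on i by (intro sum.cong refl) (auto simp: orthonormal_def)
    also have "\<dots> = 0" using i by (intro sum.neutral) auto
    finally show ?thesis .
  qed
  then show "w \<in> ?W" by (auto simp: v vecs_def apply_mat_outside)
next
  let ?J = "{i \<in> I. l i < t}"
  have fin: "finite I" and cf: "complete_family S I \<phi>"
    using e by (auto simp: eigbasis_def)
  fix w assume w: "w \<in> ?W"
  have "apply_mat S (spec_part S ?J \<phi>) w x = w x" for x
  proof (cases "x \<in> S")
    case True
    have "w x = (\<Sum>i\<in>I. ip S (\<phi> i) w * \<phi> i x)" by (rule complete_expand[OF S cf True])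
    also have "\<dots> = (\<Sum>i\<in>?J. ip S (\<phi> i) w * \<phi> i x)"
      using w fin by (intro sum.mono_neutral_right) auto
    finally show ?thesis using True by (simp add: apply_mat_mv mv_spec_part)
  next
    case False
    then show ?thesis using w by (simp add: apply_mat_outside vecs_def)
  qed
  then have "w = apply_mat S (spec_part S ?J \<phi>) w" by auto
  then show "w \<in> mrange S (spec_part S ?J \<phi>)" unfolding mrange_def by blast
qed

text \<open>Eigenvectors with eigenvalue below \<open>t\<close> are orthogonal to every basis vector
  with eigenvalue at least \<open>t\<close>, as M is hermitian. Conversely, a vector with this
  orthogonality expands in the other basis vectors alone.\<close>

lemma cspan_eigspaces_below:
  assumes S: "finite S" and e: "eigbasis S M I \<phi> l" and h: "hermitian S M"
  shows "cspan (\<Union>lam\<in>{lam::real. lam < t}. eigspace S M (complex_of_real lam))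
    = {w \<in> vecs S. \<forall>i\<in>I. \<not> l i < t \<longrightarrow> ip S (\<phi> i) w = 0}" (is "cspan ?E = ?W")
proof (intro equalityI subsetI)
  have EW: "v \<in> ?W" if v: "v \<in> ?E" for v
  proof -
    obtain lam where lam: "lam < t" "v \<in> vecs S" "apply_mat S M v = (\<lambda>x. of_real lam * v x)"
      using v by (auto simp: eigspace_def)
    have "ip S (\<phi> i) v = 0" if i: "i \<in> I" "\<not> l i < t" for i
    proof -
      have "of_real (l i) * ip S (\<phi> i) v = ip S (\<phi> i) (mv S M v)"
        using eigbasis_ip_mv[OF e h i(1)] by simp
      also have "\<dots> = ip S (\<phi> i) (\<lambda>x. of_real lam * v x)"
        by (intro ip_cong) (simp_all add: lam(3) flip: apply_mat_mv)
      finally have "(of_real (l i) - of_real lam) * ip S (\<phi> i) v = 0"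
        by (simp add: ip_scale_right left_diff_distrib)
      then show ?thesis using lam(1) i(2) by simp
    qed
    then show ?thesis using lam(2) by simp
  qed
  fix w assume "w \<in> cspan ?E"
  then obtain F c where F: "finite F" "F \<subseteq> ?E" and w: "w = (\<lambda>x. \<Sum>v\<in>F. c v * v x)"
    by (auto simp: cspan_def)
  have FW: "v \<in> ?W" if "v \<in> F" for v using EW F that by blast
  have "ip S (\<phi> i) w = 0" if i: "i \<in> I" "\<not> l i < t" for i
    unfolding w ip_sum_right ip_scale_right using FW i by (intro sum.neutral) auto
  moreover have "w x = 0" if "x \<notin> S" for x
    unfolding w using FW that by (intro sum.neutral) (auto simp: vecs_def)
  ultimately show "w \<in> ?W" by (simp add: vecs_def)
next
  have fin: "finite I" and on: "orthonormal S I \<phi>" and cf: "complete_family S I \<phi>"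
    using e by (auto simp: eigbasis_def)
  let ?J = "{i \<in> I. l i < t}"
  \<comment> \<open>\<open>eigspace\<close> contains only vectors that vanish off \<open>S\<close>,
    hence the cutoff. \<open>cspan\<close> sums over a set of vectors, so coefficients are indexed
    by vectors; injectivity of \<psi> allows this.\<close>
  define \<psi> where "\<psi> i = (\<lambda>x. if x \<in> S then \<phi> i x else 0)" for i
  have inj: "inj_on \<psi> I"
  proof (rule inj_onI)
    fix i j assume ij: "i \<in> I" "j \<in> I" "\<psi> i = \<psi> j"
    have "ip S (\<phi> i) (\<phi> j) = ip S (\<phi> i) (\<phi> i)"
    proof (intro ip_cong refl)
      fix x assume "x \<in> S"
      then show "\<phi> j x = \<phi> i x" using fun_cong[OF ij(3), of x] by (simp add: \<psi>_def)
    qed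
    then show "i = j" using on ij by (auto simp: orthonormal_def split: if_splits)
  qed
  fix w assume w: "w \<in> ?W"
  define c where "c v = ip S (\<phi> (inv_into I \<psi> v)) w" for v
  have c: "c (\<psi> i) = ip S (\<phi> i) w" if "i \<in> I" for i
    using inv_into_f_f[OF inj that] by (simp add: c_def)
  have "w x = (\<Sum>v\<in>\<psi> ` ?J. c v * v x)" for x
  proof -
    have "(\<Sum>v\<in>\<psi> ` ?J. c v * v x) = (\<Sum>i\<in>?J. ip S (\<phi> i) w * \<psi> i x)"
      using inj by (subst sum.reindex) (auto simp: c intro: inj_on_subset)
    also have "\<dots> = (\<Sum>i\<in>I. ip S (\<phi> i) w * \<psi> i x)"
      using w fin by (intro sum.mono_neutral_left) auto
    also have "\<dots> = w x"
      using w complete_expand[OF S cf, of x w] by (cases "x \<in> S") (auto simp: \<psi>_def vecs_def)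
    finally show ?thesis by simp
  qed
  moreover have "\<psi> ` ?J \<subseteq> ?E"
  proof safe
    fix i assume i: "i \<in> I" "l i < t"
    have "mv S M (\<psi> i) = mv S M (\<phi> i)" by (intro mv_cong) (simp add: \<psi>_def)
    then have "apply_mat S M (\<psi> i) = (\<lambda>x. of_real (l i) * \<psi> i x)"
      using e i(1) by (intro ext) (auto simp: eigbasis_def apply_mat_mv apply_mat_outside apply_mat_def mv_def \<psi>_def)
    then show "\<psi> i \<in> ?E" using i(2) by (auto simp: eigspace_def vecs_def \<psi>_def)
  qed
  ultimately show "w \<in> cspan ?E"
    unfolding cspan_def using fin by (intro CollectI exI[of _ "\<psi> ` ?J"] exI[of _ c]) auto
qed

lemma spec_proj_below_eq:
  assumes S: "finite S" and e: "eigbasis S M I \<phi> l" and h: "hermitian S M"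
  shows "spec_proj_below S M t = spec_part S {i \<in> I. l i < t} \<phi>"
  unfolding spec_proj_below_def
proof (rule the_equality)
  have fin: "finite {i \<in> I. l i < t}" and on: "orthonormal S I \<phi>" using e by (auto simp: eigbasis_def)
  have eq: "mrange S (spec_part S {i \<in> I. l i < t} \<phi>)
    = cspan (\<Union>lam\<in>{lam::real. lam < t}. eigspace S M (complex_of_real lam))"
    using mrange_spec_part[OF assms] cspan_eigspaces_below[OF assms] by simp
  note * = supported_spec_part hermitian_spec_part spec_part_idem[OF fin on Collect_restrict] eq
  show "supported S (spec_part S {i \<in> I. l i < t} \<phi>) \<and> hermitian S (spec_part S {i \<in> I. l i < t} \<phi>) \<and>
    mmul S (spec_part S {i \<in> I. l i < t} \<phi>) (spec_part S {i \<in> I. l i < t} \<phi>) = spec_part S {i \<in> I. l i < t} \<phi> \<and>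
    mrange S (spec_part S {i \<in> I. l i < t} \<phi>) = cspan (\<Union>lam\<in>{lam::real. lam < t}. eigspace S M (complex_of_real lam))"
    using * by auto
  fix P
  assume P: "supported S P \<and> hermitian S P \<and> mmul S P P = P \<and>
    mrange S P = cspan (\<Union>lam\<in>{lam::real. lam < t}. eigspace S M (complex_of_real lam))"
  then show "P = spec_part S {i \<in> I. l i < t} \<phi>"
    by (intro orthogonal_projection_unique[OF S _ _ _ *(1-3)]) (simp_all only: P *(4))
qed

lemma ip_spec_part_quadratic:
  assumes "finite J" "orthonormal S I \<phi>" "J \<subseteq> I" "i \<in> I"
  shows "ip S (\<phi> i) (mv S (spec_part S J \<phi>) (\<phi> i)) = of_bool (i \<in> J)"
proof -
  have "ip S (\<phi> i) (mv S (spec_part S J \<phi>) (\<phi> i)) = ip S (\<phi> i) (\<lambda>x. \<Sum>j\<in>J. ip S (\<phi> j) (\<phi> i) * \<phi> j x)"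
    by (intro ip_cong) (simp_all add: mv_spec_part)
  also have "\<dots> = (\<Sum>j\<in>J. of_bool (j = i) * of_bool (i = j))"
    unfolding ip_sum_right ip_scale_right
    using assms by (intro sum.cong refl) (simp add: orthonormal_def subset_iff)
  also have "\<dots> = of_bool (i \<in> J)"
  proof (cases "i \<in> J")
    case True
    then show ?thesis using assms(1) sum_mult_of_bool(1)[of J i "\<lambda>j. of_bool (j = i)"] by simp
  next
    case False
    then show ?thesis by (auto intro!: sum.neutral)
  qed
  finally show ?thesis .
qed

lemma tr_neg_eq:
  assumes S: "finite S" and e: "eigbasis S M I \<phi> l" and h: "hermitian S M"
  shows "tr_neg S M = (\<Sum>i\<in>I. min (l i) 0)"
proof -
  have fin: "finite I" and on: "orthonormal S I \<phi>" using e by (auto simp: eigbasis_def)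
  have "tr_neg S M = Re (\<Sum>i\<in>I. of_real (l i) * of_bool (i \<in> {i \<in> I. l i < 0}))"
    unfolding tr_neg_def negpart_def spec_proj_below_eq[OF assms] eigbasis_trace[OF S e]
    using fin on by (intro arg_cong[where f = Re] sum.cong refl) (subst ip_spec_part_quadratic, auto)
  also have "\<dots> = (\<Sum>i\<in>I. min (l i) 0)" unfolding Re_sum by (intro sum.cong) auto
  finally show ?thesis .
qed

lemma hermitian_diff:
  assumes "hermitian S A" "hermitian S B"
  shows "hermitian S (\<lambda>x y. A x y - B x y)"
  unfolding hermitian_def complex_cnj_diff
proof (intro ballI)
  fix x y assume "x \<in> S" "y \<in> S"
  then have "A x y = cnj (A y x)" "B x y = cnj (B y x)"
    using assms unfolding hermitian_def by blast+
  then show "A x y - B x y = cnj (A y x) - cnj (B y x)" by (rule arg_cong2)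
qed

lemma hermitian_idm: "hermitian S idm"
  by (simp add: hermitian_def idm_def)

lemma mv_idm_minus:
  assumes "finite S" "x \<in> S"
  shows "mv S (\<lambda>x y. idm x y - M x y) v x = v x - mv S M v x"
proof -
  have "mv S idm v x = v x"
    using sum_mult_of_bool(2)[OF assms, of v] by (simp add: mv_def idm_def of_bool_def)
  then show ?thesis by (simp add: mv_def left_diff_distrib sum_subtractf)
qed

lemma ip_idm_minus:
  assumes "finite S"
  shows "ip S v (mv S (\<lambda>x y. idm x y - M x y) v) = of_real (nsq S v) - ip S v (mv S M v)"
proof -
  have "ip S v (mv S (\<lambda>x y. idm x y - M x y) v) = ip S v (\<lambda>x. v x - mv S M v x)"
    by (intro ip_cong) (simp_all add: mv_idm_minus[OF assms])
  then show ?thesis by (simp add: ip_diff_right ip_self)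
qed

lemma between01_spec_part:
  assumes S: "finite S" and I: "finite I" and on: "orthonormal S I \<phi>" and J: "J \<subseteq> I"
  shows "between01 S (spec_part S J \<phi>)"
proof -
  have J': "finite J" "orthonormal S J \<phi>" using I J on finite_subset by (auto simp: orthonormal_def subset_iff)
  have q: "Re (ip S v (mv S (spec_part S J \<phi>) v)) = (\<Sum>i\<in>J. (cmod (ip S (\<phi> i) v))\<^sup>2)" for v
  proof -
    have "ip S v (mv S (spec_part S J \<phi>) v) = ip S v (\<lambda>x. \<Sum>i\<in>J. ip S (\<phi> i) v * \<phi> i x)"
      by (intro ip_cong) (simp_all add: mv_spec_part)
    also have "\<dots> = (\<Sum>i\<in>J. of_real ((cmod (ip S (\<phi> i) v))\<^sup>2))"
      unfolding ip_sum_right ip_scale_right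
      by (intro sum.cong refl) (metis cnj_ip complex_norm_square of_real_power)
    finally show ?thesis by (simp flip: of_real_sum)
  qed
  have "Re (ip S v (mv S (\<lambda>x y. idm x y - spec_part S J \<phi> x y) v)) = nsq S v - (\<Sum>i\<in>J. (cmod (ip S (\<phi> i) v))\<^sup>2)" for v
    by (simp add: ip_idm_minus[OF S] q)
  moreover have "hermitian S (\<lambda>x y. idm x y - spec_part S J \<phi> x y)"
    by (rule hermitian_diff[OF hermitian_idm hermitian_spec_part])
  ultimately show ?thesis
    unfolding between01_def psd_iff using hermitian_spec_part[of S J \<phi>] bessel_le[OF J'] q
    by (simp add: sum_nonneg)
qed

subsection \<open>The periodic lattice and its plane waves\<close>

lemma lattice_eq_lists: "lattice d L = {xs. set xs \<subseteq> {..<L} \<and> length xs = d}"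
  by (auto simp: lattice_def in_set_conv_nth subset_iff)

lemma finite_lattice: "finite (lattice d L)"
  unfolding lattice_eq_lists by (rule finite_lists_length_eq) simp

lemma card_lattice: "card (lattice d L) = L ^ d"
  unfolding lattice_eq_lists by (simp add: card_lists_length_eq)

lemma lattice_length: "x \<in> lattice d L \<Longrightarrow> length x = d"
  and lattice_nth: "x \<in> lattice d L \<Longrightarrow> i < d \<Longrightarrow> x ! i < L"
  by (auto simp: lattice_def)

lemma lattice_update: "x \<in> lattice d L \<Longrightarrow> m < L \<Longrightarrow> x[i := m] \<in> lattice d L"
  unfolding lattice_eq_lists using set_update_subset_insert[of x i m] by auto

lemma lattice_Suc: "lattice (Suc d) L = (\<lambda>(a, x). a # x) ` ({..<L} \<times> lattice d L)"
proof -
  have "xs \<in> (\<lambda>(a, x). a # x) ` ({..<L} \<times> lattice d L)" if xs: "xs \<in> lattice (Suc d) L" for xs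
  proof (cases xs)
    case Nil
    then show ?thesis using xs by (simp add: lattice_def)
  next
    case (Cons a x)
    then show ?thesis using xs by (auto simp: lattice_eq_lists image_iff)
  qed
  then show ?thesis by (auto simp: lattice_eq_lists)
qed

text \<open>Sums of products over the lattice factorise, which reduces orthogonality of plane waves
  to a single coordinate.\<close>

lemma sum_lattice_prod:
  fixes f :: "nat \<Rightarrow> nat \<Rightarrow> 'a::comm_semiring_1"
  shows "(\<Sum>x\<in>lattice d L. \<Prod>i<d. f i (x ! i)) = (\<Prod>i<d. \<Sum>n<L. f i n)"
proof (induction d arbitrary: f)
  case 0
  have "lattice 0 L = {[]}" by (auto simp: lattice_def)
  then show ?case by simp
next
  case (Suc d)
  have inj: "inj_on (\<lambda>(a, x). a # x) ({..<L} \<times> lattice d L)" by (auto simp: inj_on_def)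
  have "(\<Sum>x\<in>lattice (Suc d) L. \<Prod>i<Suc d. f i (x ! i))
     = (\<Sum>a<L. \<Sum>x\<in>lattice d L. \<Prod>i<Suc d. f i ((a # x) ! i))"
    unfolding lattice_Suc sum.cartesian_product by (subst sum.reindex[OF inj]) (simp add: case_prod_beta)
  also have "\<dots> = (\<Sum>a<L. f 0 a * (\<Sum>x\<in>lattice d L. \<Prod>i<d. f (Suc i) (x ! i)))"
    by (simp add: prod.lessThan_Suc_shift sum_distrib_left del: prod.lessThan_Suc)
  also have "\<dots> = (\<Sum>a<L. f 0 a) * (\<Prod>i<d. \<Sum>n<L. f (Suc i) n)"
    by (simp only: Suc.IH[of "\<lambda>i. f (Suc i)"] sum_distrib_right)
  finally show ?case by (simp add: prod.lessThan_Suc_shift del: prod.lessThan_Suc)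
qed

section \<open>Nearest neighbours on the discrete torus\<close>

definition cdist :: "nat \<Rightarrow> nat \<Rightarrow> nat \<Rightarrow> int" where
  "cdist L a b = min \<bar>int a - int b\<bar> (int L - \<bar>int a - int b\<bar>)"

text \<open>One step on the cycle Z_L. The backward step adds L - 1, which avoids truncated
  subtraction at 0.\<close>

definition cstep :: "nat \<Rightarrow> bool \<Rightarrow> nat \<Rightarrow> nat" where
  "cstep L s a = (if s then (a + 1) mod L else (a + (L - 1)) mod L)"

lemma cstep_alt:
  assumes "a < L"
  shows "cstep L s a = (if s then if a + 1 = L then 0 else a + 1 else if a = 0 then L - 1 else a - 1)"
proof -
  have "(a + (L - 1)) mod L = a - 1" if "a \<noteq> 0"
  proof -
    have "a + (L - 1) = (a - 1) + L" using that assms by simp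
    then have "(a + (L - 1)) mod L = (a - 1 + L) mod L" by (rule arg_cong)
    also have "\<dots> = a - 1" using assms by simp
    finally show ?thesis .
  qed
  moreover have "(a + 1) mod L = (if a + 1 = L then 0 else a + 1)" using assms by auto
  ultimately show ?thesis using assms by (cases "a = 0") (simp_all add: cstep_def)
qed

lemma cstep_less: "0 < L \<Longrightarrow> cstep L s a < L"
  by (simp add: cstep_def)

lemma cdist_nonneg: "a < L \<Longrightarrow> b < L \<Longrightarrow> 0 \<le> cdist L a b"
  by (auto simp: cdist_def)

lemma cdist_eq_0_iff: "a < L \<Longrightarrow> b < L \<Longrightarrow> cdist L a b = 0 \<longleftrightarrow> a = b"
  by (auto simp: cdist_def min_def)

lemma cdist_eq_1_iff:
  assumes "a < L" "b < L" "3 \<le> L"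
  shows "cdist L a b = 1 \<longleftrightarrow> (\<exists>s. b = cstep L s a)"
  unfolding ex_bool_eq using assms by (auto simp: cdist_def min_def cstep_alt abs_if split: if_splits)

lemma cstep_inj:
  assumes "a < L" "3 \<le> L" "cstep L s a = cstep L s' a"
  shows "s = s'"
  using assms by (auto simp: cstep_alt split: if_splits)

lemma cstep_ne: "a < L \<Longrightarrow> 3 \<le> L \<Longrightarrow> cstep L s a \<noteq> a"
  by (auto simp: cstep_alt)

lemma tdist1_cdist: "tdist1 L x y = (\<Sum>i<length x. cdist L (x ! i) (y ! i))"
  by (simp add: tdist1_def cdist_def)

lemma tdist1_commute: "length x = length y \<Longrightarrow> tdist1 L x y = tdist1 L y x"
  by (simp add: tdist1_def abs_minus_commute)

definition nbr :: "nat \<Rightarrow> nat list \<Rightarrow> nat \<times> bool \<Rightarrow> nat list" where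
  "nbr L x = (\<lambda>(i, s). x[i := cstep L s (x ! i)])"

definition dirs :: "nat \<Rightarrow> (nat \<times> bool) set" where
  "dirs d = {..<d} \<times> UNIV"

lemma card_dirs: "card (dirs d) = 2 * d"
  by (simp add: dirs_def card_cartesian_product)

lemma nbr_in_lattice:
  assumes "x \<in> lattice d L" "p \<in> dirs d"
  shows "nbr L x p \<in> lattice d L"
proof -
  obtain i s where p: "p = (i, s)" "i < d" using assms by (auto simp: dirs_def)
  have "0 < L" using lattice_nth[OF assms(1) p(2)] by linarith
  then show ?thesis using assms(1) by (simp add: p nbr_def lattice_update cstep_less)
qed

lemma sum_int_eq_1_iff:
  fixes f :: "'a \<Rightarrow> int"
  assumes "finite A" "\<And>a. a \<in> A \<Longrightarrow> 0 \<le> f a"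
  shows "sum f A = 1 \<longleftrightarrow> (\<exists>a\<in>A. f a = 1 \<and> (\<forall>b\<in>A. a \<noteq> b \<longrightarrow> f b = 0))"
proof -
  have "sum f A = int (\<Sum>a\<in>A. nat (f a))" using assms(2) by simp
  then have "sum f A = 1 \<longleftrightarrow> (\<Sum>a\<in>A. nat (f a)) = 1" by linarith
  also have "\<dots> \<longleftrightarrow> (\<exists>a\<in>A. nat (f a) = 1 \<and> (\<forall>b\<in>A. a \<noteq> b \<longrightarrow> nat (f b) = 0))"
    by (rule sum_eq_1_iff[OF assms(1)])
  also have "\<dots> \<longleftrightarrow> (\<exists>a\<in>A. f a = 1 \<and> (\<forall>b\<in>A. a \<noteq> b \<longrightarrow> f b = 0))"
    using assms(2) by (intro bex_cong conj_cong ball_cong refl) (force simp: nat_eq_iff)+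
  finally show ?thesis .
qed

text \<open>Nonnegative integers sum to 1 exactly when one of them is 1 and the others are 0: one
  coordinate moves by one step on its cycle and the rest agree.\<close>

lemma tdist1_eq_1_iff:
  assumes x: "x \<in> lattice d L" and y: "y \<in> lattice d L" and L: "3 \<le> L"
  shows "tdist1 L x y = 1 \<longleftrightarrow> y \<in> nbr L x ` dirs d"
proof -
  have len: "length x = d" "length y = d" using x y by (auto simp: lattice_length)
  have lt: "x ! i < L" "y ! i < L" if "i < d" for i using x y that by (auto simp: lattice_nth)
  have "tdist1 L x y = 1 \<longleftrightarrow> (\<exists>i\<in>{..<d}. cdist L (x ! i) (y ! i) = 1 \<and> (\<forall>j\<in>{..<d}. i \<noteq> j \<longrightarrow> cdist L (x ! j) (y ! j) = 0))"
    unfolding tdist1_cdist len using lt by (intro sum_int_eq_1_iff) (auto intro: cdist_nonneg)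
  also have "\<dots> \<longleftrightarrow> (\<exists>i<d. \<exists>s. y = x[i := cstep L s (x ! i)])"
  proof -
    have "(cdist L (x ! i) (y ! i) = 1 \<and> (\<forall>j\<in>{..<d}. i \<noteq> j \<longrightarrow> cdist L (x ! j) (y ! j) = 0))
       \<longleftrightarrow> (\<exists>s. y = x[i := cstep L s (x ! i)])" if i: "i < d" for i
    proof -
      have "(y = x[i := cstep L s (x ! i)]) \<longleftrightarrow> y ! i = cstep L s (x ! i) \<and> (\<forall>j<d. i \<noteq> j \<longrightarrow> x ! j = y ! j)" for s
        using i len by (auto simp: list_eq_iff_nth_eq nth_list_update)
      then show ?thesis using i lt L by (auto simp: cdist_eq_1_iff cdist_eq_0_iff)
    qed
    then show ?thesis by auto
  qed
  also have "\<dots> \<longleftrightarrow> y \<in> nbr L x ` dirs d" by (force simp: dirs_def nbr_def)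
  finally show ?thesis .
qed

text \<open>L \<ge> 3 separates forward from backward steps, which coincide on a cycle of length 2.
  Hence each site has exactly 2d neighbours.\<close>

lemma inj_on_nbr:
  assumes x: "x \<in> lattice d L" and L: "3 \<le> L"
  shows "inj_on (nbr L x) (dirs d)"
proof (rule inj_onI)
  fix p q assume pq: "p \<in> dirs d" "q \<in> dirs d" "nbr L x p = nbr L x q"
  obtain i s j s' where *: "p = (i, s)" "q = (j, s')" "i < d" "j < d"
    using pq by (auto simp: dirs_def)
  have len: "length x = d" using x by (rule lattice_length)
  have eq: "x[i := cstep L s (x ! i)] ! m = x[j := cstep L s' (x ! j)] ! m" for m
    using pq(3) by (simp add: nbr_def *)
  have "i = j"
    using eq[of i] cstep_ne[OF lattice_nth[OF x *(3)] L, of s] len * by (auto simp: nth_list_update split: if_splits)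
  moreover from this have "s = s'"
    using eq[of i] len * by (intro cstep_inj[OF lattice_nth[OF x *(3)] L]) auto
  ultimately show "p = q" by (simp add: *)
qed

lemma hopT_commute:
  assumes "x \<in> lattice d L" "y \<in> lattice d L"
  shows "hopT L x y = hopT L y x"
  using assms tdist1_commute[of x y L] by (simp add: hopT_def lattice_length)

definition nbrs :: "nat \<Rightarrow> nat \<Rightarrow> nat list \<Rightarrow> nat list set" where
  "nbrs d L x = {y \<in> lattice d L. tdist1 L x y = 1}"

lemma nbrs_eq: "x \<in> lattice d L \<Longrightarrow> 3 \<le> L \<Longrightarrow> nbrs d L x = nbr L x ` dirs d"
  using tdist1_eq_1_iff[of x d L] nbr_in_lattice[of x d L] by (auto simp: nbrs_def)

lemma card_nbrs: "x \<in> lattice d L \<Longrightarrow> 3 \<le> L \<Longrightarrow> card (nbrs d L x) = 2 * d"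
  by (simp add: nbrs_eq card_image inj_on_nbr card_dirs)

lemma finite_nbrs: "finite (nbrs d L x)"
  by (simp add: nbrs_def finite_lattice)

lemma nbrs_subset: "nbrs d L x \<subseteq> lattice d L"
  by (auto simp: nbrs_def)

lemma sum_hopT_on:
  assumes "A \<subseteq> lattice d L"
  shows "(\<Sum>y\<in>A. hopT L x y * f y) = (\<Sum>y\<in>nbrs d L x \<inter> A. f y)"
  using assms finite_subset[OF assms finite_lattice]
  by (intro sum.mono_neutral_cong_right) (auto simp: hopT_def nbrs_def)

section \<open>Plane waves and their dispersion relation\<close>

definition phase :: "nat \<Rightarrow> nat \<Rightarrow> complex" where
  "phase L n = cis (2 * pi * real n / real L)"

text \<open>The normalised plane wave of momentum 2 pi k / L; the lattice itself serves as the index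
  set of momenta.\<close>

definition wave :: "nat \<Rightarrow> nat \<Rightarrow> nat list \<Rightarrow> cvec" where
  "wave d L k x = (\<Prod>i<d. phase L (k ! i) ^ (x ! i)) / of_real (sqrt (real (L ^ d)))"

definition energy :: "nat \<Rightarrow> nat \<Rightarrow> nat list \<Rightarrow> real" where
  "energy d L k = (\<Sum>i<d. 2 - 2 * cos (2 * pi * real (k ! i) / real L))"

lemma norm_phase: "cmod (phase L n) = 1"
  by (simp add: phase_def)

lemma phase_power_L:
  assumes "0 < L"
  shows "phase L n ^ L = 1"
proof -
  have "phase L n ^ L = cis (real L * (2 * pi * real n / real L))" unfolding phase_def by (rule Complex.DeMoivre)
  also have "real L * (2 * pi * real n / real L) = 2 * pi * real n" using assms by simp
  also have "cis (2 * pi * real n) = 1" by (rule cis_multiple_2pi) simp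
  finally show ?thesis .
qed

lemma phase_cnj: "cnj (phase L n) * phase L n = 1"
  by (simp add: phase_def cis_cnj cis_mult)

lemma phase_eq_iff:
  assumes "m < L" "n < L"
  shows "phase L m = phase L n \<longleftrightarrow> m = n"
proof -
  have e: "phase L j = exp (2 * of_real pi * \<i> * of_nat j / of_nat L)" for j
    by (simp add: phase_def cis_conv_exp mult_ac)
  show ?thesis
    using complex_root_unity_eq[of L m n] assms unfolding e by (simp add: cong_def)
qed

text \<open>A geometric sum whose ratio is an L-th root of unity, equal to 1 only for m = n.\<close>

lemma sum_phase_orthogonal:
  assumes "m < L" "n < L"
  shows "(\<Sum>j<L. cnj (phase L m ^ j) * phase L n ^ j) = of_nat L * of_bool (m = n)"
proof -
  define z where "z = cnj (phase L m) * phase L n"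
  have "z = 1 \<longleftrightarrow> m = n"
  proof -
    have "z = 1 \<longleftrightarrow> phase L m * z = phase L m" using norm_phase[of L m] by auto
    also have "phase L m * z = phase L n" using phase_cnj[of L m] by (simp add: z_def mult_ac)
    finally show ?thesis using phase_eq_iff[OF assms(2,1)] by auto
  qed
  moreover have "z ^ L = 1"
    using phase_power_L[of L m] phase_power_L[of L n] assms
    by (simp add: z_def power_mult_distrib flip: complex_cnj_power)
  moreover have "(\<Sum>j<L. cnj (phase L m ^ j) * phase L n ^ j) = (\<Sum>j<L. z ^ j)"
    by (simp add: z_def power_mult_distrib)
  ultimately show ?thesis by (auto simp: sum_gp_strict)
qed

lemma orthonormal_wave:
  shows "orthonormal (lattice d L) (lattice d L) (wave d L)"
  unfolding orthonormal_def
proof (intro ballI)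
  fix k k' assume k: "k \<in> lattice d L" and k': "k' \<in> lattice d L"
  show "ip (lattice d L) (wave d L k) (wave d L k') = of_bool (k = k')"
  proof -
    have s: "of_real (sqrt (real (L ^ d))) * of_real (sqrt (real (L ^ d))) = (of_nat (L ^ d) :: complex)"
      by (metis of_nat_0_le_iff of_real_mult of_real_of_nat_eq real_sqrt_mult_self abs_of_nat)
    have "ip (lattice d L) (wave d L k) (wave d L k')
      = (\<Sum>x\<in>lattice d L. \<Prod>i<d. cnj (phase L (k ! i) ^ (x ! i)) * phase L (k' ! i) ^ (x ! i)) / of_nat (L ^ d)"
      unfolding ip_def wave_def sum_divide_distrib
      by (simp add: prod.distrib s del: of_nat_power)
    also have "\<dots> = (\<Prod>i<d. of_nat L * of_bool (k ! i = k' ! i)) / of_nat (L ^ d)"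
      using k k' unfolding sum_lattice_prod[where f = "\<lambda>i n. cnj (phase L (k ! i) ^ n) * phase L (k' ! i) ^ n"]
      by (intro arg_cong2[where f = "(/)"] prod.cong refl sum_phase_orthogonal) (auto simp: lattice_nth)
    also have "\<dots> = of_bool (k = k')"
    proof (cases "k = k'")
      case True
      have "L ^ d \<noteq> 0" using k card_lattice[of d L] finite_lattice[of d L] by (metis card_0_eq empty_iff)
      then show ?thesis using True by simp
    next
      case False
      then obtain i where "i < d" "k ! i \<noteq> k' ! i"
        using k k' by (metis lattice_length nth_equalityI)
      then have "(\<Prod>i<d. of_nat L * of_bool (k ! i = k' ! i) :: complex) = 0" by (intro prod_zero) auto
      then show ?thesis using False by simp
    qed
    finally show ?thesis .
  qed
qed

lemma norm_wave: "cmod (wave d L k x) = 1 / sqrt (real (L ^ d))"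
  by (simp add: wave_def norm_divide norm_power norm_phase flip: prod_norm)

lemma wave_update:
  assumes "x \<in> lattice d L" "i < d"
  shows "wave d L k (x[i := m]) * phase L (k ! i) ^ (x ! i) = wave d L k x * phase L (k ! i) ^ m"
proof -
  have len: "length x = d" using assms by (simp add: lattice_length)
  have "(\<Prod>j\<in>{..<d} - {i}. phase L (k ! j) ^ (x[i := m] ! j)) = (\<Prod>j\<in>{..<d} - {i}. phase L (k ! j) ^ (x ! j))"
    by (intro prod.cong) auto
  then show ?thesis
    using assms len by (simp add: wave_def prod.remove[of "{..<d}" i] mult_ac)
qed

lemma power_mod_of_unity:
  fixes w :: complex
  assumes "w ^ L = 1"
  shows "w ^ (m mod L) = w ^ m"
proof -
  have "w ^ m = w ^ (L * (m div L) + m mod L)" by simp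
  also have "\<dots> = w ^ (m mod L)" unfolding power_add power_mult assms by simp
  finally show ?thesis by simp
qed

lemma wave_nbr:
  assumes x: "x \<in> lattice d L" and i: "i < d"
  shows "wave d L k (nbr L x (i, s)) = (if s then phase L (k ! i) else cnj (phase L (k ! i))) * wave d L k x"
proof -
  let ?w = "phase L (k ! i)"
  have L: "0 < L" using lattice_nth[OF x i] by linarith
  have nz: "?w \<noteq> 0" using norm_phase[of L "k ! i"] by auto
  \<comment> \<open>A backward step raises the exponent by L - 1, which for an L-th root of unity
    means multiplication by its inverse; wrapping around is invisible to the wave.\<close>
  have inv: "?w ^ (L - 1) = cnj ?w"
  proof -
    have "?w ^ (L - 1) = cnj ?w * ?w * ?w ^ (L - 1)" by (simp add: phase_cnj)
    also have "\<dots> = cnj ?w * ?w ^ L" using L by (simp add: power_eq_if)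
    finally show ?thesis using L by (simp add: phase_power_L)
  qed
  have "wave d L k (nbr L x (i, s)) * ?w ^ (x ! i) = wave d L k x * ?w ^ (cstep L s (x ! i))"
    using wave_update[OF x i] by (simp add: nbr_def)
  also have "?w ^ (cstep L s (x ! i)) = (if s then ?w else cnj ?w) * ?w ^ (x ! i)"
    using L by (simp add: cstep_def power_mod_of_unity phase_power_L power_add inv del: One_nat_def add_diff_assoc)
  finally show ?thesis using nz by (cases s) (simp_all add: mult_ac)
qed

lemma phase_add_cnj: "phase L n + cnj (phase L n) = of_real (2 * cos (2 * pi * real n / real L))"
  by (simp add: phase_def complex_eq_iff)

lemma sum_dirs: "(\<Sum>p\<in>dirs d. f p) = (\<Sum>i<d. f (i, True) + f (i, False))"
proof -
  have "(\<Sum>p\<in>dirs d. f p) = (\<Sum>i<d. \<Sum>s\<in>UNIV. f (i, s))"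
    unfolding dirs_def sum.cartesian_product by simp
  then show ?thesis by (simp add: UNIV_bool add.commute)
qed

lemma hermitian_lapl: "hermitian (lattice d L) (mneg (lapl d L))"
  using hopT_commute by (auto simp: hermitian_def mneg_def lapl_def hopT_def)

lemma mv_lapl:
  assumes "x \<in> A" "A \<subseteq> lattice d L"
  shows "mv A (mneg (lapl d L)) v x = of_nat (2 * d) * v x - (\<Sum>y\<in>nbrs d L x \<inter> A. v y)"
proof -
  have fin: "finite A" using assms finite_lattice finite_subset by blast
  have "mv A (mneg (lapl d L)) v x = (\<Sum>y\<in>A. of_bool (x = y) * (of_nat (2 * d) * v y) - hopT L x y * v y)"
    unfolding mv_def mneg_def lapl_def by (intro sum.cong) (auto simp: algebra_simps)
  then show ?thesis
    using sum_mult_of_bool(2)[OF fin assms(1), of "\<lambda>y. of_nat (2 * d) * v y"]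
    by (simp add: sum_subtractf sum_hopT_on[OF assms(2)])
qed

lemma mv_lapl_wave:
  assumes x: "x \<in> lattice d L" and L: "3 \<le> L"
  shows "mv (lattice d L) (mneg (lapl d L)) (wave d L k) x = of_real (energy d L k) * wave d L k x"
proof -
  have "(\<Sum>y\<in>nbrs d L x \<inter> lattice d L. wave d L k y) = (\<Sum>p\<in>dirs d. wave d L k (nbr L x p))"
    using nbrs_subset[of d L x] by (simp add: Int_absorb2 nbrs_eq[OF x L] sum.reindex[OF inj_on_nbr[OF x L]])
  also have "\<dots> = (\<Sum>i<d. (phase L (k ! i) + cnj (phase L (k ! i))) * wave d L k x)"
    unfolding sum_dirs using wave_nbr[OF x] by (intro sum.cong) (auto simp: algebra_simps)
  also have "\<dots> = of_real (\<Sum>i<d. 2 * cos (2 * pi * real (k ! i) / real L)) * wave d L k x"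
    unfolding phase_add_cnj by (simp add: sum_distrib_right)
  finally show ?thesis
    unfolding mv_lapl[OF x order_refl] energy_def by (simp add: sum_subtractf algebra_simps)
qed

lemma eigbasis_lapl:
  assumes "3 \<le> L"
  shows "eigbasis (lattice d L) (mneg (lapl d L)) (lattice d L) (wave d L) (energy d L)"
  unfolding eigbasis_def
  using finite_lattice orthonormal_wave orthonormal_complete_family[OF finite_lattice finite_lattice orthonormal_wave]
    mv_lapl_wave[OF _ assms] by auto

lemma hermitian_Kmu: "hermitian (lattice d L) (Kmu d L \<mu>)"
  using hopT_commute by (auto simp: hermitian_def Kmu_def lapl_def hopT_def)

lemma mv_Kmu:
  assumes "finite S" "x \<in> S"
  shows "mv S (Kmu d L \<mu>) v x = mv S (mneg (lapl d L)) v x - of_real \<mu> * v x"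
proof -
  have "mv S (Kmu d L \<mu>) v x = (\<Sum>y\<in>S. mneg (lapl d L) x y * v y - of_real \<mu> * v y * of_bool (x = y))"
    unfolding mv_def Kmu_def mneg_def by (intro sum.cong) (auto simp: algebra_simps)
  then show ?thesis
    using sum_mult_of_bool(1)[OF assms, of "\<lambda>y. of_real \<mu> * v y"] by (simp add: sum_subtractf mv_def)
qed

lemma eigbasis_Kmu:
  assumes "3 \<le> L"
  shows "eigbasis (lattice d L) (Kmu d L \<mu>) (lattice d L) (wave d L) (\<lambda>k. energy d L k - \<mu>)"
  using eigbasis_lapl[OF assms, of d]
  by (simp add: eigbasis_def mv_Kmu[OF finite_lattice] left_diff_distrib)

lemma energy_nonneg: "0 \<le> energy d L k"
  unfolding energy_def by (intro sum_nonneg) (simp add: cos_le_one)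

lemma energy_le: "energy d L k \<le> 4 * real d"
proof -
  have "energy d L k \<le> (\<Sum>i<d. 4)"
    unfolding energy_def by (intro sum_mono) (use cos_ge_minus_one in \<open>smt (verit)\<close>)
  then show ?thesis by simp
qed

text \<open>The summands of the energy are all nonnegative, so each is at most 1/2. The value 3/4
  obtained here becomes 9/16 after squaring.\<close>

lemma cos_ge_of_energy:
  assumes "energy d L k \<le> 1 / 2" "i < d"
  shows "3 / 4 \<le> cos (2 * pi * real (k ! i) / real L)"
proof -
  have "2 - 2 * cos (2 * pi * real (k ! i) / real L) \<le> energy d L k"
    unfolding energy_def using assms(2)
    by (intro member_le_sum[of i "{..<d}" "\<lambda>i. 2 - 2 * cos (2 * pi * real (k ! i) / real L)"]) (auto simp: cos_le_one)
  then show ?thesis using assms(1) by simp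
qed

subsection \<open>The energy of a domain\<close>

text \<open>Double counting of the bonds between \<open>A\<close> and \<open>B\<close>, by symmetry
  of the distance.\<close>

lemma sum_nbrs_swap:
  assumes "A \<subseteq> lattice d L" "B \<subseteq> lattice d L"
  shows "(\<Sum>x\<in>A. \<Sum>y\<in>nbrs d L x \<inter> B. f x y) = (\<Sum>y\<in>B. \<Sum>x\<in>nbrs d L y \<inter> A. f x y)"
proof -
  have fin: "finite A" "finite B" using assms finite_lattice finite_subset by blast+
  have l: "nbrs d L x \<inter> B = {y. y \<in> B \<and> tdist1 L x y = 1}" for x
    using assms(2) by (auto simp: nbrs_def)
  have r: "nbrs d L y \<inter> A = {x. x \<in> A \<and> tdist1 L x y = 1}" if "y \<in> B" for y
  proof -
    have "tdist1 L x y = tdist1 L y x" if "x \<in> A" for x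
      using assms \<open>y \<in> B\<close> that lattice_length by (intro tdist1_commute) (metis subsetD)
    then show ?thesis using assms(1) by (auto simp: nbrs_def)
  qed
  have "(\<Sum>x\<in>A. \<Sum>y\<in>nbrs d L x \<inter> B. f x y) = (\<Sum>y\<in>B. sum (\<lambda>x. f x y) {x. x \<in> A \<and> tdist1 L x y = 1})"
    unfolding l by (rule sum.swap_restrict[OF fin])
  then show ?thesis by (simp add: r)
qed

lemma sum_nbrs_const_left:
  fixes f :: "nat list \<Rightarrow> real"
  assumes "A \<subseteq> lattice d L" "B \<subseteq> lattice d L"
  shows "(\<Sum>x\<in>A. \<Sum>y\<in>nbrs d L x \<inter> B. f y) = (\<Sum>y\<in>B. card (nbrs d L y \<inter> A) * f y)"
  by (simp add: sum_nbrs_swap[OF assms])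

lemma card_nbrs_split:
  assumes "x \<in> lattice d L" "3 \<le> L"
  shows "real (card (nbrs d L x \<inter> A)) + real (card (nbrs d L x - A)) = 2 * real d"
proof -
  have "card (nbrs d L x) = card (nbrs d L x \<inter> A) + card (nbrs d L x - A)"
    by (rule card_Int_Diff[OF finite_nbrs])
  then show ?thesis using card_nbrs[OF assms] by (metis of_nat_add of_nat_mult of_nat_numeral)
qed

lemma card_nbrs_Int_le:
  assumes "x \<in> lattice d L" "3 \<le> L"
  shows "real (card (nbrs d L x \<inter> A)) \<le> 2 * real d"
  using card_nbrs_split[OF assms, of A] by linarith

lemma lapl_quadratic_form:
  assumes "A \<subseteq> lattice d L"
  shows "Re (ip A v (mv A (mneg (lapl d L)) v))
    = 2 * real d * nsq A v - (\<Sum>x\<in>A. \<Sum>y\<in>nbrs d L x \<inter> A. Re (cnj (v x) * v y))"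
proof -
  have "Re (ip A v (mv A (mneg (lapl d L)) v))
    = (\<Sum>x\<in>A. 2 * real d * (cmod (v x))\<^sup>2 - (\<Sum>y\<in>nbrs d L x \<inter> A. Re (cnj (v x) * v y)))"
    unfolding ip_def Re_sum
  proof (intro sum.cong refl)
    fix x assume x: "x \<in> A"
    have "cnj (v x) * mv A (mneg (lapl d L)) v x
      = of_real (2 * real d * (cmod (v x))\<^sup>2) - (\<Sum>y\<in>nbrs d L x \<inter> A. cnj (v x) * v y)"
      unfolding mv_lapl[OF x assms]
      by (simp add: right_diff_distrib sum_distrib_left complex_norm_square mult_ac flip: of_real_power)
    then show "Re (cnj (v x) * mv A (mneg (lapl d L)) v x)
      = 2 * real d * (cmod (v x))\<^sup>2 - (\<Sum>y\<in>nbrs d L x \<inter> A. Re (cnj (v x) * v y))" by simp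
  qed
  then show ?thesis by (simp add: sum_subtractf nsq_def sum_distrib_left)
qed

lemma abs_Re_cnj_mult_le: "\<bar>Re (cnj a * b)\<bar> \<le> ((cmod a)\<^sup>2 + (cmod b)\<^sup>2) / 2"
proof -
  have "\<bar>Re (cnj a * b)\<bar> \<le> cmod a * cmod b"
    using abs_Re_le_cmod[of "cnj a * b"] by (simp add: norm_mult)
  moreover have "0 \<le> (cmod a - cmod b)\<^sup>2" by simp
  ultimately show ?thesis by (simp add: power2_diff)
qed

lemma abs_hopping_le:
  assumes A: "A \<subseteq> lattice d L"
  shows "\<bar>\<Sum>x\<in>A. \<Sum>y\<in>nbrs d L x \<inter> A. Re (cnj (v x) * v y)\<bar> \<le> (\<Sum>x\<in>A. card (nbrs d L x \<inter> A) * (cmod (v x))\<^sup>2)"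
proof -
  have "\<bar>\<Sum>x\<in>A. \<Sum>y\<in>nbrs d L x \<inter> A. Re (cnj (v x) * v y)\<bar>
    \<le> (\<Sum>x\<in>A. \<Sum>y\<in>nbrs d L x \<inter> A. ((cmod (v x))\<^sup>2 + (cmod (v y))\<^sup>2) / 2)"
    by (intro order_trans[OF sum_abs] sum_mono abs_Re_cnj_mult_le)
  also have "\<dots> = ((\<Sum>x\<in>A. card (nbrs d L x \<inter> A) * (cmod (v x))\<^sup>2) + (\<Sum>x\<in>A. \<Sum>y\<in>nbrs d L x \<inter> A. (cmod (v y))\<^sup>2)) / 2"
    by (simp add: sum.distrib flip: sum_divide_distrib)
  finally show ?thesis by (simp add: sum_nbrs_const_left[OF A A])
qed

text \<open>On \<open>A\<close> the diagonal 2d is kept while bonds leaving \<open>A\<close> are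
  cut, as for a Dirichlet condition. By the arithmetic-geometric mean the inner bonds use up only
  the inner degree of the diagonal, so every cut bond at \<open>x\<close> leaves a full
  |v(x)|^2.\<close>

lemma lapl_quadratic_ge:
  assumes A: "A \<subseteq> lattice d L" and L: "3 \<le> L"
  shows "(\<Sum>x\<in>A. card (nbrs d L x - A) * (cmod (v x))\<^sup>2) \<le> Re (ip A v (mv A (mneg (lapl d L)) v))"
proof -
  have "(\<Sum>x\<in>A. card (nbrs d L x - A) * (cmod (v x))\<^sup>2)
    = (\<Sum>x\<in>A. 2 * real d * (cmod (v x))\<^sup>2 - card (nbrs d L x \<inter> A) * (cmod (v x))\<^sup>2)"
  proof (intro sum.cong refl)
    fix x assume "x \<in> A"
    then have "real (card (nbrs d L x - A)) = 2 * real d - card (nbrs d L x \<inter> A)"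
      using card_nbrs_split[OF _ L, of x d A] A by auto
    then show "card (nbrs d L x - A) * (cmod (v x))\<^sup>2 = 2 * real d * (cmod (v x))\<^sup>2 - card (nbrs d L x \<inter> A) * (cmod (v x))\<^sup>2"
      by (simp add: left_diff_distrib)
  qed
  also have "\<dots> = 2 * real d * nsq A v - (\<Sum>x\<in>A. card (nbrs d L x \<inter> A) * (cmod (v x))\<^sup>2)"
    by (simp add: sum_subtractf nsq_def sum_distrib_left)
  also have "\<dots> \<le> Re (ip A v (mv A (mneg (lapl d L)) v))"
    unfolding lapl_quadratic_form[OF A] using abs_hopping_le[OF A, of v] by linarith
  finally show ?thesis .
qed

lemma lapl_quadratic_nonneg:
  assumes "A \<subseteq> lattice d L" "3 \<le> L"
  shows "0 \<le> Re (ip A v (mv A (mneg (lapl d L)) v))"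
  by (rule order_trans[OF _ lapl_quadratic_ge[OF assms]]) (simp add: sum_nonneg)

lemma lapl_quadratic_le:
  assumes A: "A \<subseteq> lattice d L" and L: "3 \<le> L"
  shows "Re (ip A v (mv A (mneg (lapl d L)) v)) \<le> 4 * real d * nsq A v"
proof -
  have "(\<Sum>x\<in>A. card (nbrs d L x \<inter> A) * (cmod (v x))\<^sup>2) \<le> (\<Sum>x\<in>A. 2 * real d * (cmod (v x))\<^sup>2)"
    using card_nbrs_Int_le[OF _ L] A by (intro sum_mono mult_right_mono) auto
  also have "\<dots> = 2 * real d * nsq A v" by (simp add: nsq_def sum_distrib_left)
  finally show ?thesis unfolding lapl_quadratic_form[OF A] using abs_hopping_le[OF A, of v] by linarith
qed

lemma hermitian_subset: "hermitian S M \<Longrightarrow> A \<subseteq> S \<Longrightarrow> hermitian A M"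
  unfolding hermitian_def by blast

lemma ip_restrict:
  assumes "A \<subseteq> S" "finite S"
  shows "ip S u (\<lambda>x. if x \<in> A then v x else 0) = ip A u v"
  using assms unfolding ip_def
  by (intro sum.mono_neutral_cong_right) auto

lemma mv_restrict:
  assumes "A \<subseteq> S" "finite S"
  shows "mv S M (\<lambda>x. if x \<in> A then v x else 0) = mv A M v"
  using assms unfolding mv_def
  by (intro ext sum.mono_neutral_cong_right) auto

lemma ip_restrict_left:
  assumes "A \<subseteq> S" "finite S"
  shows "ip S (\<lambda>x. if x \<in> A then u x else 0) v = ip A u v"
  using ip_restrict[OF assms, of v u] cnj_ip by metis

lemma psd_subset:
  assumes "psd S M" "A \<subseteq> S" "finite S"
  shows "psd A M"
  unfolding psd_iff
proof (intro conjI allI)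
  show "hermitian A M" using assms hermitian_subset by (auto simp: psd_iff)
  fix v
  have "0 \<le> Re (ip S (\<lambda>x. if x \<in> A then v x else 0) (mv S M (\<lambda>x. if x \<in> A then v x else 0)))"
    using assms(1) by (simp add: psd_iff)
  then show "0 \<le> Re (ip A v (mv A M v))"
    by (simp add: ip_restrict_left[OF assms(2,3)] mv_restrict[OF assms(2,3)])
qed

lemma between01_subset: "between01 S M \<Longrightarrow> A \<subseteq> S \<Longrightarrow> finite S \<Longrightarrow> between01 A M"
  using psd_subset by (auto simp: between01_def)

lemma between01_quadratic:
  assumes "between01 S G" "finite S"
  shows "0 \<le> Re (ip S v (mv S G v))" "Re (ip S v (mv S G v)) \<le> nsq S v"
proof -
  show "0 \<le> Re (ip S v (mv S G v))" using assms by (simp add: between01_def psd_iff)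
  have "0 \<le> Re (ip S v (mv S (\<lambda>x y. idm x y - G x y) v))" using assms by (simp add: between01_def psd_iff)
  then show "Re (ip S v (mv S G v)) \<le> nsq S v" by (simp add: ip_idm_minus[OF assms(2)])
qed

section \<open>The boundary of a domain and the defect of truncated plane waves\<close>

definition bdry :: "nat \<Rightarrow> nat \<Rightarrow> nat list set \<Rightarrow> nat list set" where
  "bdry d L A = {x \<in> A. nbrs d L x - A \<noteq> {}}"

definition sea :: "nat \<Rightarrow> nat \<Rightarrow> real \<Rightarrow> real" where
  "sea d L \<mu> = (\<Sum>k\<in>lattice d L. max 0 (\<mu> - energy d L k)) / real (L ^ d)"

definition leak :: "nat \<Rightarrow> nat \<Rightarrow> nat list set \<Rightarrow> nat list \<Rightarrow> cvec" where
  "leak d L A k x = (\<Sum>y\<in>nbrs d L x - A. wave d L k y)"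

text \<open>Compare with the eigenvalue equation on the whole lattice: the matrix on
  \<open>A\<close> lacks exactly the hops to neighbours outside \<open>A\<close>.\<close>

lemma leak_eq:
  assumes A: "A \<subseteq> lattice d L" and x: "x \<in> A" and L: "3 \<le> L"
  shows "leak d L A k x = mv A (mneg (lapl d L)) (wave d L k) x - of_real (energy d L k) * wave d L k x"
proof -
  have x': "x \<in> lattice d L" using A x by blast
  have "(\<Sum>y\<in>nbrs d L x \<inter> lattice d L. wave d L k y) = (\<Sum>y\<in>nbrs d L x. wave d L k y)"
    by (simp add: Int_absorb2 nbrs_subset)
  also have "\<dots> = (\<Sum>y\<in>nbrs d L x \<inter> A. wave d L k y) + leak d L A k x"
    unfolding leak_def using sum.Int_Diff[OF finite_nbrs] by blast
  finally show ?thesis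
    using mv_lapl_wave[OF x' L, of k] unfolding mv_lapl[OF x A] mv_lapl[OF x' order_refl] by (simp add: algebra_simps)
qed

lemma Re_wave_nbr_ge:
  assumes x: "x \<in> lattice d L" and L: "3 \<le> L" and k: "energy d L k \<le> 1 / 2" and y: "y \<in> nbrs d L x"
  shows "3 / 4 / real (L ^ d) \<le> Re (cnj (wave d L k x) * wave d L k y)"
proof -
  obtain i s where i: "i < d" "y = nbr L x (i, s)"
    using y unfolding nbrs_eq[OF x L] by (auto simp: dirs_def)
  let ?w = "if s then phase L (k ! i) else cnj (phase L (k ! i))"
  have n: "(cmod (wave d L k x))\<^sup>2 = 1 / real (L ^ d)" by (simp add: norm_wave power_divide)
  have "cnj (wave d L k x) * wave d L k y = ?w * (wave d L k x * cnj (wave d L k x))"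
    unfolding i(2) wave_nbr[OF x i(1)] by (simp add: mult_ac)
  also have "\<dots> = of_real (1 / real (L ^ d)) * ?w"
    unfolding complex_norm_square[symmetric] n[symmetric] by simp
  finally have "Re (cnj (wave d L k x) * wave d L k y) = 1 / real (L ^ d) * Re ?w" by simp
  also have "Re ?w = cos (2 * pi * real (k ! i) / real L)" by (simp add: phase_def)
  finally show ?thesis
    using mult_left_mono[OF cos_ge_of_energy[OF k i(1)], of "1 / real (L ^ d)"] by simp
qed

text \<open>Measured against the phase of the wave at \<open>x\<close>, every neighbouring value has
  a positive real part of relative size at least 3/4, so several missing neighbours cannot cancel
  each other.\<close>

lemma norm_leak_ge:
  assumes A: "A \<subseteq> lattice d L" and x: "x \<in> bdry d L A" and L: "3 \<le> L" and k: "energy d L k \<le> 1 / 2"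
  shows "9 / 16 / real (L ^ d) \<le> (cmod (leak d L A k x))\<^sup>2"
proof -
  have x': "x \<in> lattice d L" and ne: "nbrs d L x - A \<noteq> {}" using A x by (auto simp: bdry_def)
  define N where "N = real (L ^ d)"
  have N: "N > 0" using L by (simp add: N_def)
  have "1 \<le> card (nbrs d L x - A)" using ne finite_nbrs by (simp add: Suc_le_eq card_gt_0_iff)
  then have "3 / 4 / N * 1 \<le> 3 / 4 / N * real (card (nbrs d L x - A))"
    using N by (intro mult_left_mono) auto
  also have "\<dots> = (\<Sum>y\<in>nbrs d L x - A. 3 / 4 / N)" by simp
  also have "\<dots> \<le> (\<Sum>y\<in>nbrs d L x - A. Re (cnj (wave d L k x) * wave d L k y))"
    unfolding N_def using Re_wave_nbr_ge[OF x' L k] by (intro sum_mono) auto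
  also have "\<dots> = Re (cnj (wave d L k x) * leak d L A k x)"
    by (simp add: leak_def sum_distrib_left Re_sum del: complex_cnj_mult)
  also have "\<dots> \<le> cmod (wave d L k x) * cmod (leak d L A k x)"
    using complex_Re_le_cmod[of "cnj (wave d L k x) * leak d L A k x"] by (simp add: norm_mult)
  also have "cmod (wave d L k x) = 1 / sqrt N" by (simp add: norm_wave N_def)
  finally have "(3 / 4 / N)\<^sup>2 \<le> (1 / sqrt N * cmod (leak d L A k x))\<^sup>2"
    using N by (intro power_mono) auto
  then have "9 / 16 / N / N \<le> (cmod (leak d L A k x))\<^sup>2 / N"
    using N by (simp add: power_mult_distrib power_divide power2_eq_square)
  then show ?thesis using N unfolding N_def[symmetric] by (simp only: divide_le_cancel)
qed

text \<open>A state localised on the boundary of \<open>A\<close> has energy at least 1, hence a fraction of it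
  lies above the Fermi level \<open>\<mu> \<le> 1/2\<close>; since \<open>leak\<close> is the defect of the truncated
  plane wave as an eigenvector, the truncated wave itself leaks above the Fermi level.\<close>

lemma leakage_above_fermi_level:
  assumes A: "A \<subseteq> lattice d L" and L: "3 \<le> L" and d: "1 \<le> d" and \<mu>: "0 < \<mu>" "\<mu> \<le> 1 / 2"
    and e: "eigbasis A (mneg (lapl d L)) I \<phi> l" and k: "energy d L k < \<mu>"
  shows "9 / (2048 * real d ^ 3) * card (bdry d L A) / real (L ^ d)
    \<le> (\<Sum>i | i \<in> I \<and> \<mu> \<le> l i. (cmod (ip A (\<phi> i) (wave d L k)))\<^sup>2)"
proof -
  let ?h = "mneg (lapl d L)"
  define \<beta> where "\<beta> = leak d L A k"
  define J where "J = {i \<in> I. \<mu> \<le> l i}"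
  have fin: "finite A" using A finite_lattice finite_subset by blast
  have finI: "finite I" and on: "orthonormal A I \<phi>" and cf: "complete_family A I \<phi>"
    using e by (auto simp: eigbasis_def)
  have h: "hermitian A ?h" using hermitian_subset[OF hermitian_lapl A] .
  have l: "0 \<le> l i \<and> l i \<le> 4 * real d" if i: "i \<in> I" for i
  proof -
    have n: "nsq A (\<phi> i) = 1" by (rule orthonormal_nsq[OF on i])
    have "ip A (\<phi> i) (mv A ?h (\<phi> i)) = of_real (l i)"
      using eigbasis_ip_mv[OF e h i, of "\<phi> i"] n by (simp add: ip_self)
    then show ?thesis
      using lapl_quadratic_nonneg[OF A L, of "\<phi> i"] lapl_quadratic_le[OF A L, of "\<phi> i"] n by simp
  qed
  \<comment> \<open>The coefficient of the defect is that of the wave times an energy difference,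
    which transfers a lower bound from the defect to the wave at the price (4d)^2.\<close>
  have b: "ip A (\<phi> i) \<beta> = of_real (l i - energy d L k) * ip A (\<phi> i) (wave d L k)" if i: "i \<in> I" for i
  proof -
    have "ip A (\<phi> i) \<beta> = ip A (\<phi> i) (\<lambda>x. mv A ?h (wave d L k) x - of_real (energy d L k) * wave d L k x)"
      unfolding \<beta>_def by (intro ip_cong) (simp_all add: leak_eq[OF A _ L])
    then show ?thesis
      by (simp add: ip_diff_right ip_scale_right eigbasis_ip_mv[OF e h i] left_diff_distrib)
  qed
  define p where "p i = (cmod (ip A (\<phi> i) \<beta>))\<^sup>2" for i
  have p0: "0 \<le> p i" for i by (simp add: p_def)
  have pl: "p i \<le> 16 * (real d)\<^sup>2 * (cmod (ip A (\<phi> i) (wave d L k)))\<^sup>2" if i: "i \<in> I" for i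
  proof -
    have "(l i - energy d L k)\<^sup>2 \<le> (4 * real d)\<^sup>2"
      using l[OF i] energy_nonneg[of d L k] energy_le[of d L k] by (intro power2_le_iff_abs_le[THEN iffD2]) auto
    moreover have "p i = (l i - energy d L k)\<^sup>2 * (cmod (ip A (\<phi> i) (wave d L k)))\<^sup>2"
      unfolding p_def b[OF i] norm_mult norm_of_real by (simp add: power_mult_distrib)
    ultimately show ?thesis by (simp add: mult_right_mono power_mult_distrib)
  qed
  have split: "(\<Sum>i\<in>I. f i) = (\<Sum>i\<in>I - J. f i) + (\<Sum>i\<in>J. f i)" for f :: "_ \<Rightarrow> real"
    using finI by (intro sum.subset_diff) (auto simp: J_def)
  have nb: "nsq A \<beta> = (\<Sum>i\<in>I - J. p i) + (\<Sum>i\<in>J. p i)"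
    unfolding parseval[OF fin cf] p_def[symmetric] by (rule split)
  have Y0: "0 \<le> (\<Sum>i\<in>J. p i)" using p0 by (intro sum_nonneg)
  \<comment> \<open>The defect vanishes at sites without cut bonds, and everywhere else at least one
    bond is cut.\<close>
  have "nsq A \<beta> \<le> (\<Sum>x\<in>A. card (nbrs d L x - A) * (cmod (\<beta> x))\<^sup>2)"
    unfolding nsq_def
  proof (rule sum_mono)
    fix x assume "x \<in> A"
    show "(cmod (\<beta> x))\<^sup>2 \<le> card (nbrs d L x - A) * (cmod (\<beta> x))\<^sup>2"
    proof (cases "nbrs d L x - A = {}")
      case True
      then show ?thesis by (simp only: \<beta>_def leak_def sum.empty) simp
    next
      case False
      then have "1 \<le> real (card (nbrs d L x - A))" using finite_nbrs by (simp add: Suc_le_eq card_gt_0_iff)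
      then show ?thesis using mult_right_mono[of 1 _ "(cmod (\<beta> x))\<^sup>2"] by simp
    qed
  qed
  also have "\<dots> \<le> Re (ip A \<beta> (mv A ?h \<beta>))" by (rule lapl_quadratic_ge[OF A L])
  also have "\<dots> = (\<Sum>i\<in>I - J. l i * p i) + (\<Sum>i\<in>J. l i * p i)"
    unfolding eigbasis_quadratic_form[OF fin e h] p_def[symmetric] by (rule split)
  \<comment> \<open>Energies are at most 1/2 below the Fermi level and at most 4d above it. The
    first part is absorbed into half of the norm, which leaves the share 1/(8d) above the
    level.\<close>
  also have "\<dots> \<le> (\<Sum>i\<in>I - J. 1 / 2 * p i) + (\<Sum>i\<in>J. 4 * real d * p i)"
    using l p0 \<mu>(2) by (intro add_mono sum_mono mult_right_mono) (auto simp: J_def)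
  also have "\<dots> = 1 / 2 * (\<Sum>i\<in>I - J. p i) + 4 * real d * (\<Sum>i\<in>J. p i)"
    by (simp only: sum_distrib_left)
  finally have "nsq A \<beta> \<le> 1 / 2 * nsq A \<beta> + 4 * real d * (\<Sum>i\<in>J. p i)"
    using nb Y0 by linarith
  then have "nsq A \<beta> \<le> 8 * real d * (\<Sum>i\<in>J. p i)" by linarith
  also have "\<dots> \<le> 8 * real d * (\<Sum>i\<in>J. 16 * (real d)\<^sup>2 * (cmod (ip A (\<phi> i) (wave d L k)))\<^sup>2)"
    using pl by (intro mult_left_mono sum_mono) (auto simp: J_def)
  also have "\<dots> = 128 * real d ^ 3 * (\<Sum>i\<in>J. (cmod (ip A (\<phi> i) (wave d L k)))\<^sup>2)"
    by (simp add: sum_distrib_left[symmetric] power2_eq_square power3_eq_cube)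
  finally have up: "nsq A \<beta> \<le> 128 * real d ^ 3 * (\<Sum>i\<in>J. (cmod (ip A (\<phi> i) (wave d L k)))\<^sup>2)" .
  have "card (bdry d L A) * (9 / 16 / real (L ^ d)) \<le> (\<Sum>x\<in>bdry d L A. (cmod (\<beta> x))\<^sup>2)"
    unfolding \<beta>_def using norm_leak_ge[OF A _ L, of _ k] k \<mu> by (intro sum_bounded_below) auto
  also have "\<dots> \<le> nsq A \<beta>"
    unfolding nsq_def using fin by (intro sum_mono2) (auto simp: bdry_def)
  finally have "card (bdry d L A) * (9 / 16 / real (L ^ d)) \<le> 128 * real d ^ 3 * (\<Sum>i\<in>J. (cmod (ip A (\<phi> i) (wave d L k)))\<^sup>2)"
    using up by linarith
  then have "card (bdry d L A) * (9 / 16 / real (L ^ d)) / (128 * real d ^ 3) \<le> (\<Sum>i\<in>J. (cmod (ip A (\<phi> i) (wave d L k)))\<^sup>2)"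
    using d by (subst pos_divide_le_eq) (simp, simp only: mult.commute)
  then show ?thesis by (simp add: J_def mult_ac)
qed

text \<open>Expanding an eigenvector of the domain in plane waves bounds its energy through the
  depths w_k of the momenta below \<mu>. Summed over the eigenvectors below \<mu>, each momentum is
  charged with its weight |A|/N on the domain, less the part that leaks to eigenvectors at or above
  \<mu>.\<close>

theorem domain_energy_ge:
  assumes A: "A \<subseteq> lattice d L" and L: "3 \<le> L" and d: "1 \<le> d" and \<mu>: "0 < \<mu>" "\<mu> \<le> 1 / 2"
    and G: "between01 A G"
  shows "- sea d L \<mu> * card A + 9 / (2048 * real d ^ 3) * sea d L \<mu> * card (bdry d L A)
    \<le> Re (mtrace A (mmul A (Kmu d L \<mu>) G))"
proof -
  let ?h = "mneg (lapl d L)" and ?S = "lattice d L"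
  define N where "N = real (L ^ d)"
  define c where "c = 9 / (2048 * real d ^ 3)"
  define w where "w k = max 0 (\<mu> - energy d L k)" for k
  have fin: "finite A" using A finite_lattice finite_subset by blast
  have h: "hermitian A ?h" using hermitian_subset[OF hermitian_lapl A] .
  obtain \<phi> l where e: "eigbasis A ?h {..<card A} \<phi> l" using spectral_theorem[OF fin h] .
  define I where "I = {..<card A}"
  note e = e[folded I_def]
  have finI: "finite I" and on: "orthonormal A I \<phi>" and cf: "complete_family A I \<phi>"
    using e by (auto simp: eigbasis_def)
  have eK: "eigbasis A (Kmu d L \<mu>) I \<phi> (\<lambda>i. l i - \<mu>)"
    using e by (simp add: eigbasis_def mv_Kmu[OF fin] left_diff_distrib)
  note nrm = orthonormal_nsq[OF on]
  define J where "J = {i \<in> I. l i < \<mu>}"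
  define q where "q i k = (cmod (ip A (\<phi> i) (wave d L k)))\<^sup>2" for i k
  have cfw: "complete_family ?S ?S (wave d L)" and hS: "hermitian ?S ?h"
    using eigbasis_lapl[OF L, of d] hermitian_lapl by (auto simp: eigbasis_def)
  have exp_l: "- (\<Sum>k\<in>?S. w k * q i k) \<le> l i - \<mu>" if i: "i \<in> I" for i
  proof -
    let ?v = "\<lambda>x. if x \<in> A then \<phi> i x else 0"
    have ipv: "(cmod (ip ?S (wave d L k) ?v))\<^sup>2 = q i k" for k
      unfolding ip_restrict[OF A finite_lattice] q_def by (metis cnj_ip complex_mod_cnj)
    have "l i = Re (ip A (\<phi> i) (mv A ?h (\<phi> i)))"
      using eigbasis_ip_mv[OF e h i, of "\<phi> i"] nrm[OF i] by (simp add: ip_self)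
    also have "\<dots> = Re (ip ?S ?v (mv ?S ?h ?v))"
      by (simp add: ip_restrict_left[OF A finite_lattice] mv_restrict[OF A finite_lattice])
    also have "\<dots> = (\<Sum>k\<in>?S. energy d L k * q i k)"
      unfolding eigbasis_quadratic_form[OF finite_lattice eigbasis_lapl[OF L] hS] ipv ..
    finally have l: "l i = (\<Sum>k\<in>?S. energy d L k * q i k)" .
    have "nsq ?S ?v = nsq A (\<phi> i)"
      unfolding nsq_def using A finite_lattice by (intro sum.mono_neutral_cong_right) auto
    then have "1 = (\<Sum>k\<in>?S. q i k)" using parseval[OF finite_lattice cfw, of ?v] nrm[OF i] by (simp add: ipv)
    then have "\<mu> = (\<Sum>k\<in>?S. \<mu> * q i k)" by (simp flip: sum_distrib_left)
    then have "l i - \<mu> = (\<Sum>k\<in>?S. (energy d L k - \<mu>) * q i k)"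
      unfolding l by (simp add: left_diff_distrib sum_subtractf)
    also have "\<dots> \<ge> (\<Sum>k\<in>?S. - w k * q i k)"
      by (intro sum_mono mult_right_mono) (auto simp: w_def q_def)
    finally show ?thesis by (simp add: sum_negf)
  qed
  \<comment> \<open>All eigenvectors together carry the weight |A|/N of the wave; those at or above
    the Fermi level take the leaked share.\<close>
  have qJ: "(\<Sum>i\<in>J. q i k) \<le> card A / N - c * card (bdry d L A) / N" if k: "energy d L k < \<mu>" for k
  proof -
    have "(\<Sum>i\<in>I. q i k) = card A / N"
      using parseval[OF fin cf, of "wave d L k"]
      by (simp add: q_def nsq_def norm_wave N_def power_divide)
    moreover have "(\<Sum>i\<in>I. q i k) = (\<Sum>i | i \<in> I \<and> \<mu> \<le> l i. q i k) + (\<Sum>i\<in>J. q i k)"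
    proof -
      have "{i. i \<in> I \<and> \<mu> \<le> l i} = I - J" by (auto simp: J_def)
      then show ?thesis using sum.subset_diff[of J I "\<lambda>i. q i k"] finI by (simp add: J_def)
    qed
    ultimately show ?thesis
      using leakage_above_fermi_level[OF A L d \<mu> e k] by (simp add: q_def N_def c_def)
  qed
  have "- sea d L \<mu> * card A + c * sea d L \<mu> * card (bdry d L A)
    = - (\<Sum>k\<in>?S. w k * (card A / N - c * card (bdry d L A) / N))"
    unfolding sea_def w_def[symmetric] N_def[symmetric] sum_distrib_right[symmetric]
    by (simp add: algebra_simps)
  also have "\<dots> \<le> - (\<Sum>k\<in>?S. w k * (\<Sum>i\<in>J. q i k))"
  proof -
    have "w k * (\<Sum>i\<in>J. q i k) \<le> w k * (card A / N - c * card (bdry d L A) / N)" for k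
    proof (cases "energy d L k < \<mu>")
      case True
      then show ?thesis using qJ by (intro mult_left_mono) (auto simp: w_def)
    next
      case False
      then have "w k = 0" by (simp add: w_def)
      then show ?thesis by simp
    qed
    then show ?thesis by (simp add: sum_mono)
  qed
  also have "\<dots> = (\<Sum>i\<in>J. - (\<Sum>k\<in>?S. w k * q i k))"
    unfolding sum_distrib_left by (subst sum.swap) (simp add: sum_negf)
  also have "\<dots> \<le> (\<Sum>i\<in>J. l i - \<mu>)"
    using exp_l by (intro sum_mono) (auto simp: J_def)
  \<comment> \<open>The diagonal expectations of \<open>G\<close> lie in [0,1], so filling exactly
    the states in \<open>J\<close> is optimal.\<close>
  also have "\<dots> \<le> (\<Sum>i\<in>I. (l i - \<mu>) * Re (ip A (\<phi> i) (mv A G (\<phi> i))))"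
  proof -
    have n01: "0 \<le> Re (ip A (\<phi> i) (mv A G (\<phi> i)))" "Re (ip A (\<phi> i) (mv A G (\<phi> i))) \<le> 1" if "i \<in> I" for i
      using between01_quadratic[OF G fin, of "\<phi> i"] nrm[OF that] by auto
    have "(\<Sum>i\<in>J. l i - \<mu>) = (\<Sum>i\<in>I. min (l i - \<mu>) 0)"
      using finI by (intro sum.mono_neutral_cong_left) (auto simp: J_def)
    also have "\<dots> \<le> (\<Sum>i\<in>I. (l i - \<mu>) * Re (ip A (\<phi> i) (mv A G (\<phi> i))))"
    proof (rule sum_mono)
      fix i assume i: "i \<in> I"
      show "min (l i - \<mu>) 0 \<le> (l i - \<mu>) * Re (ip A (\<phi> i) (mv A G (\<phi> i)))"
      proof (cases "l i < \<mu>")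
        case True
        then show ?thesis using mult_left_mono_neg[OF n01(2)[OF i], of "l i - \<mu>"] by simp
      next
        case False
        then show ?thesis using n01(1)[OF i] by (simp add: min_def)
      qed
    qed
    finally show ?thesis .
  qed
  also have "\<dots> = Re (mtrace A (mmul A (Kmu d L \<mu>) G))"
    unfolding eigbasis_trace[OF fin eK] by simp
  finally show ?thesis unfolding c_def .
qed

subsection \<open>Localisation to the two magnetised domains\<close>

lemma ip_point_left: "finite S \<Longrightarrow> x \<in> S \<Longrightarrow> ip S (\<lambda>y. of_bool (y = x)) u = u x"
  using ip_point[of S x u] cnj_ip complex_cnj_cnj by metis

lemma psd_offdiag:
  assumes S: "finite S" and G: "psd S G" and xy: "x \<in> S" "y \<in> S"
  shows "0 \<le> a\<^sup>2 * Re (G x x) + b\<^sup>2 * Re (G y y) + 2 * a * b * Re (G x y)"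
proof -
  let ?ex = "\<lambda>z. of_bool (z = x) :: complex" and ?ey = "\<lambda>z. of_bool (z = y) :: complex"
  let ?v = "\<lambda>z. of_real a * ?ex z + of_real b * ?ey z"
  have "ip S ?v (mv S G ?v) = of_real (a\<^sup>2) * G x x + of_real (a * b) * G x y + of_real (a * b) * G y x + of_real (b\<^sup>2) * G y y"
    unfolding mv_add mv_scale ip_add_left ip_add_right ip_scale_left ip_scale_right
      mv_point[OF S xy(1)] mv_point[OF S xy(2)] ip_point_left[OF S xy(1)] ip_point_left[OF S xy(2)]
    by (simp add: algebra_simps power2_eq_square)
  moreover have "Re (G y x) = Re (G x y)"
  proof -
    have "G y x = cnj (G x y)" using G xy unfolding psd_iff hermitian_def by blast
    then show ?thesis by simp
  qed
  ultimately have "Re (ip S ?v (mv S G ?v)) = a\<^sup>2 * Re (G x x) + b\<^sup>2 * Re (G y y) + 2 * a * b * Re (G x y)"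
    by (simp add: mult_ac)
  moreover have "0 \<le> Re (ip S ?v (mv S G ?v))" using G unfolding psd_iff by blast
  ultimately show ?thesis by simp
qed

text \<open>Test the form on two points with amplitudes - sqrt t and 1 / sqrt t. This is
  Cauchy-Schwarz in a form that leaves the weight free.\<close>

lemma psd_offdiag_weighted:
  assumes "finite S" "psd S G" "x \<in> S" "y \<in> S" "0 < t"
  shows "2 * Re (G x y) \<le> t * Re (G x x) + Re (G y y) / t"
  using psd_offdiag[OF assms(1-4), of "- sqrt t" "1 / sqrt t"] assms(5)
  by (simp add: power_divide)

lemma between01_diag:
  assumes "between01 S G" "finite S" "x \<in> S"
  shows "0 \<le> Re (G x x)" "Re (G x x) \<le> 1"
  using between01_quadratic[OF assms(1,2), of "\<lambda>y. of_bool (y = x)"] assms(2,3)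
  by (simp_all add: mv_point ip_point_left nsq_point)

text \<open>A point vector with zero expectation lies in the kernel, so its whole column
  vanishes.\<close>

lemma psd_zero_diag:
  assumes "finite S" "psd S G" "\<And>x. x \<in> S \<Longrightarrow> Re (G x x) = 0" "x \<in> S" "y \<in> S"
  shows "G x y = 0"
  using psd_kernel[OF assms(1,2), of "\<lambda>z. of_bool (z = y)"] assms
  by (simp add: mv_point ip_point_left)

definition kin :: "nat \<Rightarrow> nat \<Rightarrow> real \<Rightarrow> nat list set \<Rightarrow> cmat \<Rightarrow> real" where
  "kin d L \<mu> A G = Re (mtrace A (mmul A (Kmu d L \<mu>) G))"

lemma kin_eq:
  assumes "A \<subseteq> lattice d L"
  shows "kin d L \<mu> A G = (2 * real d - \<mu>) * (\<Sum>x\<in>A. Re (G x x)) - (\<Sum>x\<in>A. \<Sum>y\<in>nbrs d L x \<inter> A. Re (G y x))"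
proof -
  have fin: "finite A" using assms finite_lattice finite_subset by blast
  have "Re (mmul A (Kmu d L \<mu>) G x x) = (2 * real d - \<mu>) * Re (G x x) - (\<Sum>y\<in>nbrs d L x \<inter> A. Re (G y x))"
    if x: "x \<in> A" for x
    unfolding mmul_col mv_Kmu[OF fin x] mv_lapl[OF x assms] by (simp add: left_diff_distrib)
  then show ?thesis by (simp add: kin_def mtrace_def sum_subtractf sum_distrib_left)
qed

text \<open>With weight 1 the hopping is bounded by degree times density, so the Laplacian part is
  nonnegative and only the chemical potential is left.\<close>

lemma kin_ge:
  assumes A: "A \<subseteq> lattice d L" and L: "3 \<le> L" and G: "psd (lattice d L) G"
  shows "- \<mu> * (\<Sum>x\<in>A. Re (G x x)) \<le> kin d L \<mu> A G"
proof -
  have "(\<Sum>x\<in>A. \<Sum>y\<in>nbrs d L x \<inter> A. Re (G y x)) \<le> (\<Sum>x\<in>A. \<Sum>y\<in>nbrs d L x \<inter> A. (Re (G y y) + Re (G x x)) / 2)"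
  proof (intro sum_mono)
    fix x y assume "x \<in> A" "y \<in> nbrs d L x \<inter> A"
    then show "Re (G y x) \<le> (Re (G y y) + Re (G x x)) / 2"
      using psd_offdiag_weighted[OF finite_lattice G, of y x 1] A by (auto simp: subset_iff)
  qed
  also have "\<dots> = ((\<Sum>x\<in>A. \<Sum>y\<in>nbrs d L x \<inter> A. Re (G y y)) + (\<Sum>x\<in>A. card (nbrs d L x \<inter> A) * Re (G x x))) / 2"
    by (simp add: sum.distrib flip: sum_divide_distrib)
  also have "\<dots> = (\<Sum>x\<in>A. card (nbrs d L x \<inter> A) * Re (G x x))"
    unfolding sum_nbrs_const_left[OF A A, of "\<lambda>y. Re (G y y)"] by simp
  also have "\<dots> \<le> (\<Sum>x\<in>A. 2 * real d * Re (G x x))"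
  proof (intro sum_mono mult_right_mono)
    fix x assume "x \<in> A"
    then have x: "x \<in> lattice d L" using A by blast
    show "real (card (nbrs d L x \<inter> A)) \<le> 2 * real d" by (rule card_nbrs_Int_le[OF x L])
    show "0 \<le> Re (G x x)" using psd_offdiag[OF finite_lattice G x x, of 1 0] by simp
  qed
  finally show ?thesis unfolding kin_eq[OF A] by (simp add: left_diff_distrib flip: sum_distrib_left)
qed

lemma kin_split:
  assumes A: "A \<subseteq> lattice d L" and G: "hermitian (lattice d L) G"
  shows "kin d L \<mu> (lattice d L) G = kin d L \<mu> A G + kin d L \<mu> (lattice d L - A) G
     - 2 * (\<Sum>y\<in>lattice d L - A. \<Sum>x\<in>nbrs d L y \<inter> A. Re (G x y))"
proof -
  let ?S = "lattice d L" and ?R = "lattice d L - A"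
  have R: "?R \<subseteq> ?S" by blast
  have sp: "(\<Sum>x\<in>?S. f x) = (\<Sum>x\<in>?R. f x) + (\<Sum>x\<in>A. f x)" for f :: "_ \<Rightarrow> real"
    by (rule sum.subset_diff[OF A finite_lattice])
  have sn: "(\<Sum>y\<in>nbrs d L x \<inter> ?S. f y) = (\<Sum>y\<in>nbrs d L x \<inter> ?R. f y) + (\<Sum>y\<in>nbrs d L x \<inter> A. f y)" for f :: "_ \<Rightarrow> real" and x
    using A finite_nbrs[of d L x] by (subst sum.union_disjoint[symmetric]) (auto intro: sum.cong)
  have "(\<Sum>x\<in>A. \<Sum>y\<in>nbrs d L x \<inter> ?R. Re (G y x)) = (\<Sum>y\<in>?R. \<Sum>x\<in>nbrs d L y \<inter> A. Re (G y x))"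
    by (rule sum_nbrs_swap[OF A R])
  also have "\<dots> = (\<Sum>y\<in>?R. \<Sum>x\<in>nbrs d L y \<inter> A. Re (G x y))"
  proof (intro sum.cong refl)
    fix x y assume "y \<in> ?R" "x \<in> nbrs d L y \<inter> A"
    then have "G y x = cnj (G x y)" using G A unfolding hermitian_def by blast
    then show "Re (G y x) = Re (G x y)" by simp
  qed
  finally show ?thesis
    unfolding kin_eq[OF A] kin_eq[OF R] kin_eq[OF order_refl] sp sn sum.distrib by (simp add: algebra_simps)
qed

text \<open>Densities in \<open>A\<close> are at most 1, so a cut bond costs at most t + \<rho>/t,
  and the part outside \<open>A\<close> has energy at least - \<mu> \<rho> per site. The weight may
  vary with the outer site because sites of the other domain and empty sites have different
  budgets.\<close>

lemma kin_localise:
  assumes A: "A \<subseteq> lattice d L" and L: "3 \<le> L" and G: "between01 (lattice d L) G"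
    and t: "\<And>y. y \<in> lattice d L - A \<Longrightarrow> 0 < t y"
  shows "kin d L \<mu> A G - (\<Sum>y\<in>lattice d L - A. \<mu> * Re (G y y) + card (nbrs d L y \<inter> A) * (t y + Re (G y y) / t y))
    \<le> kin d L \<mu> (lattice d L) G"
proof -
  let ?R = "lattice d L - A"
  have psd: "psd (lattice d L) G" and h: "hermitian (lattice d L) G"
    using G by (auto simp: between01_def psd_iff)
  have "2 * (\<Sum>y\<in>?R. \<Sum>x\<in>nbrs d L y \<inter> A. Re (G x y)) = (\<Sum>y\<in>?R. \<Sum>x\<in>nbrs d L y \<inter> A. 2 * Re (G x y))"
    by (simp add: sum_distrib_left)
  also have "\<dots> \<le> (\<Sum>y\<in>?R. \<Sum>x\<in>nbrs d L y \<inter> A. t y + Re (G y y) / t y)"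
  proof (intro sum_mono)
    fix x y assume y: "y \<in> ?R" and "x \<in> nbrs d L y \<inter> A"
    then have x: "x \<in> lattice d L" using A by blast
    have "2 * Re (G x y) \<le> t y * Re (G x x) + Re (G y y) / t y"
      using psd_offdiag_weighted[OF finite_lattice psd x _ t[OF y]] y by blast
    also have "t y * Re (G x x) \<le> t y"
      using mult_left_mono[OF between01_diag(2)[OF G finite_lattice x], of "t y"] t[OF y] by simp
    finally show "2 * Re (G x y) \<le> t y + Re (G y y) / t y" by simp
  qed
  finally have "2 * (\<Sum>y\<in>?R. \<Sum>x\<in>nbrs d L y \<inter> A. Re (G x y)) \<le> (\<Sum>y\<in>?R. card (nbrs d L y \<inter> A) * (t y + Re (G y y) / t y))"
    by simp
  then show ?thesis
    using kin_ge[OF _ L psd, of ?R \<mu>] unfolding kin_split[OF A h]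
    by (simp add: sum.distrib flip: sum_distrib_left)
qed

lemma sea_le:
  assumes "0 < \<mu>" "0 < L"
  shows "sea d L \<mu> \<le> \<mu>"
proof -
  have "(\<Sum>k\<in>lattice d L. max 0 (\<mu> - energy d L k)) \<le> (\<Sum>k\<in>lattice d L. \<mu>)"
    using assms energy_nonneg by (intro sum_mono) auto
  then show ?thesis using assms by (simp add: sea_def card_lattice pos_divide_le_eq mult.commute)
qed

lemma hfz_kin:
  "hfz d L \<mu> U gu gd = kin d L \<mu> (lattice d L) gu + kin d L \<mu> (lattice d L) gd
    + U * (\<Sum>x\<in>lattice d L. Re (gu x x) * Re (gd x x))"
  by (simp add: hfz_def kin_def mtrace_def mmul_def distrib_left sum.distrib)

section \<open>Energy balance site by site\<close>

definition dense :: "nat \<Rightarrow> nat \<Rightarrow> real \<Rightarrow> cmat \<Rightarrow> nat list set" where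
  "dense d L \<delta> G = {x \<in> lattice d L. \<delta> \<le> Re (G x x)}"

lemma card_nbrs_Int_eq_0:
  assumes "y \<in> B" "y \<notin> bdry d L B" "A \<inter> B = {}"
  shows "card (nbrs d L y \<inter> A) = 0"
proof -
  have "nbrs d L y \<inter> A = {}" using assms by (auto simp: bdry_def)
  then show ?thesis by simp
qed

text \<open>On a site of the domain \<open>B\<close> the repulsion \<open>U \<delta> u\<close> pays for the chemical potential and
  for cutting the bonds, up to half of the boundary energy \<open>a\<close>.\<close>

lemma site_energy_domain:
  fixes a t u v U \<mu> \<delta> c d :: real
  assumes "0 < a" "1 \<le> d" "0 < \<mu>" "\<mu> \<le> 1 / 2" "a \<le> 1" "0 \<le> u" "\<delta> \<le> v" "0 < U"
    and U: "16 * d\<^sup>2 / a \<le> U * \<delta>" and t: "t = a / (4 * d)"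
    and c: "0 \<le> c" "c \<le> 2 * d" "\<not> b \<Longrightarrow> c = 0"
  shows "a / 2 * of_bool b + \<mu> * u
    \<le> a * of_bool b - (\<mu> * u + c * (t + u / t)) + U * (u * v)"
proof -
  have t0: "0 < t" using assms by simp
  have "8 \<le> 8 * d\<^sup>2" using assms by (simp add: one_le_power)
  also have "\<dots> \<le> 8 * d\<^sup>2 / a" using assms by (simp add: pos_le_divide_eq mult_left_le)
  finally have big: "8 \<le> 8 * d\<^sup>2 / a" .
  \<comment> \<open>The choice t = a/(4d) makes at most 2d bonds cost at most a/2; off the boundary
    no bond is cut.\<close>
  have ct: "c * t \<le> a / 2 * of_bool b"
  proof (cases b)
    case True
    have "c * t \<le> 2 * d * t" using c t0 by (intro mult_right_mono) auto
    then show ?thesis using assms True by simp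
  qed (use c in simp)
  have "c * (u / t) \<le> 2 * d * (u / t)" using c t0 assms by (intro mult_right_mono) auto
  also have "\<dots> = 8 * d\<^sup>2 / a * u" using assms by (simp add: power2_eq_square)
  finally have cu: "c * (u / t) \<le> 8 * d\<^sup>2 / a * u" .
  \<comment> \<open>U \<delta> \<ge> 16 d^2/a is used in two halves: one pays the \<rho>/t part of
    the bonds, the other covers 2 \<mu> u. One \<mu> u pays the chemical potential, the other is
    kept as surplus so that equality will force the minority density to vanish.\<close>
  have "16 * d\<^sup>2 / a * u \<le> U * \<delta> * u" using U assms by (intro mult_right_mono) auto
  also have "\<dots> \<le> U * v * u" using assms by (intro mult_right_mono mult_left_mono) auto
  finally have Uv: "2 * (8 * d\<^sup>2 / a * u) \<le> U * (u * v)" by (simp add: mult_ac)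
  have "2 * \<mu> * u \<le> 8 * d\<^sup>2 / a * u" using big assms by (intro mult_right_mono) auto
  then show ?thesis using ct cu Uv unfolding distrib_left[of c] by (cases b; simp; linarith)
qed

text \<open>\<delta> = t^2 balances the bond cost t + u/t, both parts being at most t. At most 2d
  bonds, shared by two disjoint domains, then cost at most E/2 and the chemical potential at most
  E/4, so E/4 of the saving remains.\<close>

lemma site_energy_empty:
  fixes E u v U \<mu> \<delta> c c' d t :: real
  assumes E: "0 < E" "E \<le> 1 / 2" and d: "1 \<le> d" and \<mu>: "0 < \<mu>" "\<mu> \<le> 1 / 2" and U: "0 < U"
    and \<delta>: "\<delta> = (E / (8 * d))\<^sup>2" and t: "t = E / (8 * d)"
    and u: "0 \<le> u" "u < \<delta>" and v: "0 \<le> v" "v < \<delta>"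
    and c: "0 \<le> c" "0 \<le> c'" "c + c' \<le> 2 * d"
  shows "E / 4 \<le> E - (\<mu> * u + c * (t + u / t)) - (\<mu> * v + c' * (t + v / t)) + U * (u * v)"
proof -
  have t0: "0 < t" using E d by (simp add: t)
  have "\<delta> / t = t" using t0 by (simp add: \<delta> t power2_eq_square)
  then have ut: "t + u / t \<le> 2 * t" "t + v / t \<le> 2 * t"
    using u v t0 divide_right_mono[of u \<delta> t] divide_right_mono[of v \<delta> t] by auto
  have "c * (t + u / t) + c' * (t + v / t) \<le> c * (2 * t) + c' * (2 * t)"
    using c ut by (intro add_mono mult_left_mono) auto
  also have "\<dots> = (c + c') * (2 * t)" by (simp add: distrib_right)
  also have "\<dots> \<le> 2 * d * (2 * t)" using c t0 by (intro mult_right_mono) auto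
  also have "\<dots> = E / 2" using d by (simp add: t)
  finally have 1: "c * (t + u / t) + c' * (t + v / t) \<le> E / 2" .
  have "\<mu> * u + \<mu> * v \<le> 1 / 2 * \<delta> + 1 / 2 * \<delta>"
    using \<mu> u v by (intro add_mono mult_mono) auto
  also have "\<dots> = t * t" by (simp add: \<delta> t power2_eq_square)
  also have "\<dots> \<le> E / 8 * (1 / 16)"
    using E d by (intro mult_mono) (auto simp: t field_simps)
  finally have 2: "\<mu> * u + \<mu> * v \<le> E / 4" using E by simp
  have "0 \<le> U * (u * v)" using U u v by simp
  then show ?thesis using 1 2 E by linarith
qed

text \<open>The reference energy - E per site is spent on \<open>A\<close> and \<open>B\<close> by
  their domain energies and is left over on the remaining sites. All surplus terms stay explicit on
  the left since each has to vanish in the equality case.\<close>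

theorem hfz_ge:
  assumes L: "3 \<le> L" and d: "1 \<le> d" and \<mu>: "0 < \<mu>" "\<mu> \<le> 1 / 2"
    and gu: "between01 (lattice d L) gu" and gd: "between01 (lattice d L) gd"
    and E: "E = sea d L \<mu>" "0 < E" and a: "a = 9 / (2048 * real d ^ 3) * E"
    and \<delta>: "\<delta> = (E / (8 * real d))\<^sup>2" and U: "16 * (real d)\<^sup>2 / (a * \<delta>) \<le> U"
    and A: "A = dense d L \<delta> gu" and B: "B = dense d L \<delta> gd - A"
  shows "- E * real (L ^ d) + a / 2 * card (bdry d L A) + a / 2 * card (bdry d L B)
      + E / 4 * card (lattice d L - (A \<union> B)) + \<mu> * (\<Sum>x\<in>A. Re (gd x x)) + \<mu> * (\<Sum>x\<in>B. Re (gu x x))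
    \<le> hfz d L \<mu> U gu gd"
proof -
  let ?S = "lattice d L" and ?C = "lattice d L - (A \<union> B)"
  define u where "u x = Re (gu x x)" for x
  define v where "v x = Re (gd x x)" for x
  define t where "t = a / (4 * real d)"
  define t' where "t' = E / (8 * real d)"
  define cA where "cA x = real (card (nbrs d L x \<inter> A))" for x
  define cB where "cB x = real (card (nbrs d L x \<inter> B))" for x
  have AS: "A \<subseteq> ?S" and BS: "B \<subseteq> ?S" and AB: "A \<inter> B = {}" by (auto simp: A B dense_def)
  have finA: "finite A" and finB: "finite B" using AS BS finite_lattice finite_subset by blast+
  have d0: "1 \<le> real d" using d by simp
  have a0: "0 < a" using E d by (simp add: a)
  have \<delta>0: "0 < \<delta>" using E d by (simp add: \<delta>)
  have Eh: "E \<le> 1 / 2" using sea_le[OF \<mu>(1), of L d] L \<mu> E by simp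
  have a1: "a \<le> 1"
  proof -
    have "a \<le> 1 * (1 / 2)" unfolding a using Eh E(2) d0
      by (intro mult_mono) (auto simp: pos_divide_le_eq intro: order_trans[OF _ mult_left_mono[OF one_le_power[OF d0, of 3]]])
    then show ?thesis by simp
  qed
  have pos: "0 < 16 * (real d)\<^sup>2 / (a * \<delta>)" using a0 \<delta>0 d by simp
  have U0: "0 < U" using pos U by linarith
  have U\<delta>: "16 * (real d)\<^sup>2 / a \<le> U * \<delta>"
    using mult_right_mono[OF U, of \<delta>] \<delta>0 by simp
  have u0: "0 \<le> u x" and v0: "0 \<le> v x" if "x \<in> ?S" for x
    using between01_diag(1)[OF gu finite_lattice that] between01_diag(1)[OF gd finite_lattice that]
    by (auto simp: u_def v_def)
  have t0: "0 < t" "0 < t'" using a0 E d by (auto simp: t_def t'_def)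
  have cA0: "0 \<le> cA x" and cB0: "0 \<le> cB x" for x by (auto simp: cA_def cB_def)
  have cAl: "cA x \<le> 2 * real d" and cBl: "cB x \<le> 2 * real d" if "x \<in> ?S" for x
    using card_nbrs_Int_le[OF that L] by (auto simp: cA_def cB_def)
  have cAB: "cA x + cB x \<le> 2 * real d" if "x \<in> ?S" for x
  proof -
    have "card (nbrs d L x \<inter> (A \<union> B)) = card (nbrs d L x \<inter> A) + card (nbrs d L x \<inter> B)"
      using AB finite_nbrs unfolding Int_Un_distrib by (intro card_Un_disjoint) auto
    then show ?thesis using card_nbrs_Int_le[OF that L, of "A \<union> B"] by (simp add: cA_def cB_def)
  qed
  have eu: "kin d L \<mu> A gu - ((\<Sum>y\<in>B. \<mu> * u y + cA y * (t + u y / t)) + (\<Sum>y\<in>?C. \<mu> * u y + cA y * (t' + u y / t')))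
    \<le> kin d L \<mu> ?S gu"
  proof -
    \<comment> \<open>Weight \<open>t\<close> on the other domain, where the repulsion pays, and
      \<open>t'\<close> on the empty sites, where the saving E pays.\<close>
    define s where "s y = (if y \<in> B then t else t')" for y
    have "(\<Sum>y\<in>?S - A. \<mu> * u y + cA y * (s y + u y / s y))
      = (\<Sum>y\<in>B. \<mu> * u y + cA y * (s y + u y / s y)) + (\<Sum>y\<in>?C. \<mu> * u y + cA y * (s y + u y / s y))"
      using AB BS finB finite_lattice by (subst sum.union_disjoint[symmetric]) (auto intro: sum.cong)
    also have "\<dots> = (\<Sum>y\<in>B. \<mu> * u y + cA y * (t + u y / t)) + (\<Sum>y\<in>?C. \<mu> * u y + cA y * (t' + u y / t'))"
      by (intro arg_cong2[where f = "(+)"] sum.cong refl) (auto simp: s_def)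
    finally show ?thesis
      using kin_localise[OF AS L gu, of s \<mu>] t0 by (simp add: u_def cA_def s_def)
  qed
  have ed: "kin d L \<mu> B gd - ((\<Sum>y\<in>A. \<mu> * v y + cB y * (t + v y / t)) + (\<Sum>y\<in>?C. \<mu> * v y + cB y * (t' + v y / t')))
    \<le> kin d L \<mu> ?S gd"
  proof -
    define s where "s y = (if y \<in> A then t else t')" for y
    have "(\<Sum>y\<in>?S - B. \<mu> * v y + cB y * (s y + v y / s y))
      = (\<Sum>y\<in>A. \<mu> * v y + cB y * (s y + v y / s y)) + (\<Sum>y\<in>?C. \<mu> * v y + cB y * (s y + v y / s y))"
      using AB AS finA finite_lattice by (subst sum.union_disjoint[symmetric]) (auto intro: sum.cong)
    also have "\<dots> = (\<Sum>y\<in>A. \<mu> * v y + cB y * (t + v y / t)) + (\<Sum>y\<in>?C. \<mu> * v y + cB y * (t' + v y / t'))"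
      by (intro arg_cong2[where f = "(+)"] sum.cong refl) (auto simp: s_def)
    finally show ?thesis
      using kin_localise[OF BS L gd, of s \<mu>] t0 by (simp add: v_def cB_def s_def)
  qed
  have dA: "- E * card A + a * card (bdry d L A) \<le> kin d L \<mu> A gu"
    using domain_energy_ge[OF AS L d \<mu> between01_subset[OF gu AS finite_lattice]] by (simp add: E(1) a kin_def)
  have dB: "- E * card B + a * card (bdry d L B) \<le> kin d L \<mu> B gd"
    using domain_energy_ge[OF BS L d \<mu> between01_subset[OF gd BS finite_lattice]] by (simp add: E(1) a kin_def)
  have bd: "real (card (bdry d L X)) = (\<Sum>x\<in>X. of_bool (x \<in> bdry d L X))" if "finite X" for X
  proof -
    have "{x \<in> X. x \<in> bdry d L X} = bdry d L X" by (auto simp: bdry_def)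
    then show ?thesis using that by (simp add: of_bool_def sum.If_cases Int_def)
  qed
  have sB: "a / 2 * card (bdry d L B) + \<mu> * (\<Sum>x\<in>B. u x)
    \<le> a * card (bdry d L B) - (\<Sum>y\<in>B. \<mu> * u y + cA y * (t + u y / t)) + U * (\<Sum>y\<in>B. u y * v y)"
  proof -
    have "(\<Sum>y\<in>B. a / 2 * of_bool (y \<in> bdry d L B) + \<mu> * u y)
      \<le> (\<Sum>y\<in>B. a * of_bool (y \<in> bdry d L B) - (\<mu> * u y + cA y * (t + u y / t)) + U * (u y * v y))"
    proof (rule sum_mono)
      fix y assume y: "y \<in> B"
      have "cA y = 0" if "y \<notin> bdry d L B" using card_nbrs_Int_eq_0[OF y that AB] by (simp add: cA_def)
      moreover have "\<delta> \<le> v y" using y by (simp add: B dense_def v_def)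
      ultimately show "a / 2 * of_bool (y \<in> bdry d L B) + \<mu> * u y
        \<le> a * of_bool (y \<in> bdry d L B) - (\<mu> * u y + cA y * (t + u y / t)) + U * (u y * v y)"
        using y BS by (intro site_energy_domain[OF a0 d0 \<mu> a1 _ _ U0 U\<delta> t_def] u0 cA0 cAl) auto
    qed
    then show ?thesis
      unfolding bd[OF finB] sum.distrib sum_subtractf sum_distrib_left by simp
  qed
  have sA: "a / 2 * card (bdry d L A) + \<mu> * (\<Sum>x\<in>A. v x)
    \<le> a * card (bdry d L A) - (\<Sum>y\<in>A. \<mu> * v y + cB y * (t + v y / t)) + U * (\<Sum>y\<in>A. u y * v y)"
  proof -
    have "(\<Sum>y\<in>A. a / 2 * of_bool (y \<in> bdry d L A) + \<mu> * v y)
      \<le> (\<Sum>y\<in>A. a * of_bool (y \<in> bdry d L A) - (\<mu> * v y + cB y * (t + v y / t)) + U * (v y * u y))"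
    proof (rule sum_mono)
      fix y assume y: "y \<in> A"
      have "cB y = 0" if "y \<notin> bdry d L A" using card_nbrs_Int_eq_0[OF y that] AB by (simp add: cB_def Int_commute)
      moreover have "\<delta> \<le> u y" using y by (simp add: A dense_def u_def)
      ultimately show "a / 2 * of_bool (y \<in> bdry d L A) + \<mu> * v y
        \<le> a * of_bool (y \<in> bdry d L A) - (\<mu> * v y + cB y * (t + v y / t)) + U * (v y * u y)"
        using y AS by (intro site_energy_domain[OF a0 d0 \<mu> a1 _ _ U0 U\<delta> t_def] v0 cB0 cBl) auto
    qed
    then show ?thesis
      unfolding bd[OF finA] sum.distrib sum_subtractf sum_distrib_left by (simp add: mult_ac)
  qed
  have sC: "E / 4 * card ?C
    \<le> E * card ?C - (\<Sum>y\<in>?C. \<mu> * u y + cA y * (t' + u y / t')) - (\<Sum>y\<in>?C. \<mu> * v y + cB y * (t' + v y / t')) + U * (\<Sum>y\<in>?C. u y * v y)"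
  proof -
    have "(\<Sum>y\<in>?C. E / 4) \<le> (\<Sum>y\<in>?C. E - (\<mu> * u y + cA y * (t' + u y / t')) - (\<mu> * v y + cB y * (t' + v y / t')) + U * (u y * v y))"
    proof (rule sum_mono)
      fix y assume y: "y \<in> ?C"
      then have yS: "y \<in> ?S" and "u y < \<delta>" "v y < \<delta>" by (auto simp: A B dense_def u_def v_def)
      then show "E / 4 \<le> E - (\<mu> * u y + cA y * (t' + u y / t')) - (\<mu> * v y + cB y * (t' + v y / t')) + U * (u y * v y)"
        by (intro site_energy_empty[OF E(2) Eh d0 \<mu> U0 \<delta> t'_def] u0 v0 cA0 cB0 cAB)
    qed
    then show ?thesis
      unfolding sum.distrib sum_subtractf sum_distrib_left by (simp add: mult_ac)
  qed
  have part: "(\<Sum>x\<in>?S. f x) = (\<Sum>x\<in>A. f x) + (\<Sum>x\<in>B. f x) + (\<Sum>x\<in>?C. f x)" for f :: "_ \<Rightarrow> real"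
  proof -
    have "(\<Sum>x\<in>?S. f x) = (\<Sum>x\<in>?C. f x) + (\<Sum>x\<in>A \<union> B. f x)"
      using AS BS by (intro sum.subset_diff finite_lattice) auto
    then show ?thesis using sum.union_disjoint[OF finA finB AB, of f] by simp
  qed
  have cd: "real (L ^ d) = card A + card B + card ?C"
    using part[of "\<lambda>_. 1"] by (simp add: card_lattice)
  have "U * (\<Sum>x\<in>?S. u x * v x) = U * (\<Sum>x\<in>A. u x * v x) + U * (\<Sum>x\<in>B. u x * v x) + U * (\<Sum>x\<in>?C. u x * v x)"
    unfolding part by (simp add: distrib_left)
  moreover have "- E * real (L ^ d) = - E * card A - E * card B - E * card ?C"
    unfolding cd by (simp add: distrib_left)
  ultimately show ?thesis
    using eu ed dA dB sA sB sC unfolding hfz_kin u_def[symmetric] v_def[symmetric] by linarith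
qed

subsection \<open>Ground states\<close>

text \<open>Without boundary the set is invariant under forward steps, and going round the cycle
  reaches every value of coordinate \<open>i\<close>.\<close>

lemma closed_imp_update:
  assumes L: "3 \<le> L" and A: "A \<subseteq> lattice d L" and b: "bdry d L A = {}"
    and x: "x \<in> A" and i: "i < d" and m: "m < L"
  shows "x[i := m] \<in> A"
proof -
  have step: "z[i := (z ! i + 1) mod L] \<in> A" if z: "z \<in> A" for z
  proof -
    have zS: "z \<in> lattice d L" using A z by blast
    have "nbr L z (i, True) \<in> nbrs d L z" using i unfolding nbrs_eq[OF zS L] by (auto simp: dirs_def)
    moreover have "nbrs d L z \<subseteq> A" using b z by (auto simp: bdry_def)
    ultimately show ?thesis by (auto simp: nbr_def cstep_def)
  qed
  have len: "length x = d" and xi: "x ! i < L" using A x i by (auto simp: lattice_length lattice_nth)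
  have shift: "x[i := (x ! i + n) mod L] \<in> A" for n
  proof (induction n)
    case 0
    then show ?case using x xi by simp
  next
    case (Suc n)
    have "((x ! i + n) mod L + 1) mod L = (x ! i + Suc n) mod L" by (simp add: mod_Suc_eq)
    then show ?case using step[OF Suc] i len by simp
  qed
  \<comment> \<open>L - x_i steps lead to 0 and \<open>m\<close> more lead to \<open>m\<close>,
    whichever of x_i and \<open>m\<close> is larger.\<close>
  have "(x ! i + (L - x ! i + m)) mod L = m" using xi m by simp
  then show ?thesis using shift[of "L - x ! i + m"] by simp
qed

text \<open>Connectedness of the torus: the coordinates of \<open>x\<close> are replaced by those of
  \<open>y\<close> one at a time through the hybrids \<open>take j y @ drop j x\<close>.\<close>

lemma closed_imp_all:
  assumes L: "3 \<le> L" and A: "A \<subseteq> lattice d L" and b: "bdry d L A = {}" and ne: "A \<noteq> {}"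
  shows "A = lattice d L"
proof
  obtain x where x: "x \<in> A" using ne by blast
  have lx: "length x = d" using A x by (auto simp: lattice_length)
  show "lattice d L \<subseteq> A"
  proof
    fix y assume y: "y \<in> lattice d L"
    have ly: "length y = d" using y by (rule lattice_length)
    have "take j y @ drop j x \<in> A" if "j \<le> d" for j
      using that
    proof (induction j)
      case 0
      then show ?case using x by simp
    next
      case (Suc j)
      have "take (Suc j) y @ drop (Suc j) x = (take j y @ drop j x)[j := y ! j]"
        using Suc.prems lx ly by (auto simp: list_eq_iff_nth_eq nth_append nth_list_update less_Suc_eq)
      then show ?case
        using closed_imp_update[OF L A b Suc.IH, of j "y ! j"] Suc.prems lattice_nth[OF y, of j] by simp
    qed
    from this[of d] show "y \<in> A" using lx ly by simp
  qed
qed (rule A)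

section \<open>Energy and uniqueness of the free Fermi sea\<close>

lemma sum_min_energy:
  assumes "3 \<le> L"
  shows "(\<Sum>k\<in>lattice d L. min (energy d L k - \<mu>) 0) = - sea d L \<mu> * real (L ^ d)"
proof -
  have "(\<Sum>k\<in>lattice d L. min (energy d L k - \<mu>) 0) = - (\<Sum>k\<in>lattice d L. max 0 (\<mu> - energy d L k))"
    unfolding sum_negf[symmetric] by (intro sum.cong refl) (simp add: min_def max_def)
  then show ?thesis using assms by (simp add: sea_def)
qed

lemma tr_neg_Kmu:
  assumes "3 \<le> L"
  shows "tr_neg (lattice d L) (Kmu d L \<mu>) = - sea d L \<mu> * real (L ^ d)"
  unfolding tr_neg_eq[OF finite_lattice eigbasis_Kmu[OF assms] hermitian_Kmu] by (rule sum_min_energy[OF assms])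

definition fermi :: "nat \<Rightarrow> nat \<Rightarrow> real \<Rightarrow> cmat" where
  "fermi d L \<mu> = spec_part (lattice d L) {k \<in> lattice d L. energy d L k < \<mu>} (wave d L)"

lemma spec_proj_below_lapl:
  assumes "3 \<le> L"
  shows "spec_proj_below (lattice d L) (mneg (lapl d L)) \<mu> = fermi d L \<mu>"
  unfolding fermi_def by (rule spec_proj_below_eq[OF finite_lattice eigbasis_lapl[OF assms] hermitian_lapl])

lemma kin_waves:
  assumes "3 \<le> L"
  shows "kin d L \<mu> (lattice d L) G
    = (\<Sum>k\<in>lattice d L. (energy d L k - \<mu>) * Re (ip (lattice d L) (wave d L k) (mv (lattice d L) G (wave d L k))))"
  unfolding kin_def eigbasis_trace[OF finite_lattice eigbasis_Kmu[OF assms]] by simp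

lemma between01_fermi: "between01 (lattice d L) (fermi d L \<mu>)"
  unfolding fermi_def by (rule between01_spec_part[OF finite_lattice finite_lattice orthonormal_wave]) auto

lemma between01_zero: "between01 (lattice d L) (\<lambda>x y. 0)"
proof -
  have "spec_part (lattice d L) {} (wave d L) = (\<lambda>x y. 0)" by (intro ext) (simp add: spec_part_def)
  then show ?thesis
    using between01_spec_part[OF finite_lattice finite_lattice orthonormal_wave, of "{}" d L] by simp
qed

lemma kin_fermi:
  assumes "3 \<le> L"
  shows "kin d L \<mu> (lattice d L) (fermi d L \<mu>) = - sea d L \<mu> * real (L ^ d)"
proof -
  have "Re (ip (lattice d L) (wave d L k) (mv (lattice d L) (fermi d L \<mu>) (wave d L k))) = of_bool (energy d L k < \<mu>)"
    if k: "k \<in> lattice d L" for k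
    unfolding fermi_def
    by (subst ip_spec_part_quadratic[OF _ orthonormal_wave _ k]) (use k finite_lattice in auto)
  then show ?thesis
    unfolding kin_waves[OF assms] sum_min_energy[OF assms, symmetric]
    by (intro sum.cong) auto
qed

lemma nsq_wave: "k \<in> lattice d L \<Longrightarrow> nsq (lattice d L) (wave d L k) = 1"
  by (rule orthonormal_nsq[OF orthonormal_wave])

text \<open>The energy is a sum of (e_k - \<mu>) n_k with occupations 0 \<le> n_k \<le> 1;
  minimality with e_k \<noteq> \<mu> forces n_k = 1 below and n_k = 0 above the level. An extremal
  expectation puts the wave into the kernel of 1 - G or of G, so the plane waves are an eigenbasis
  of \<open>G\<close> and determine it.\<close>

lemma kin_minimizer:
  assumes L: "3 \<le> L" and G: "between01 (lattice d L) G"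
    and eq: "kin d L \<mu> (lattice d L) G = - sea d L \<mu> * real (L ^ d)"
    and ne: "\<And>k. k \<in> lattice d L \<Longrightarrow> energy d L k \<noteq> \<mu>"
  shows "meq (lattice d L) G (fermi d L \<mu>)"
proof -
  let ?S = "lattice d L"
  define n where "n k = Re (ip ?S (wave d L k) (mv ?S G (wave d L k)))" for k
  have n01: "0 \<le> n k" "n k \<le> 1" if "k \<in> ?S" for k
    using between01_quadratic[OF G finite_lattice, of "wave d L k"] nsq_wave[OF that] by (auto simp: n_def)
  have le: "min (energy d L k - \<mu>) 0 \<le> (energy d L k - \<mu>) * n k" if k: "k \<in> ?S" for k
  proof (cases "energy d L k < \<mu>")
    case True
    then show ?thesis using mult_left_mono_neg[OF n01(2)[OF k], of "energy d L k - \<mu>"] by simp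
  next
    case False
    then show ?thesis using n01(1)[OF k] by (simp add: min_def)
  qed
  have "(\<Sum>k\<in>?S. (energy d L k - \<mu>) * n k - min (energy d L k - \<mu>) 0) = 0"
    using eq unfolding kin_waves[OF L] sum_min_energy[OF L, symmetric] n_def by (simp add: sum_subtractf)
  moreover have "0 \<le> (energy d L k - \<mu>) * n k - min (energy d L k - \<mu>) 0" if "k \<in> ?S" for k
    using le[OF that] by simp
  ultimately have n: "(energy d L k - \<mu>) * n k - min (energy d L k - \<mu>) 0 = 0" if "k \<in> ?S" for k
    using that sum_nonneg_eq_0_iff[OF finite_lattice, of d L "\<lambda>k. (energy d L k - \<mu>) * n k - min (energy d L k - \<mu>) 0"]
    by blast
  have eig: "mv ?S G (wave d L k) x = of_real (of_bool (energy d L k < \<mu>)) * wave d L k x"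
    if k: "k \<in> ?S" and x: "x \<in> ?S" for k x
  proof (cases "energy d L k < \<mu>")
    case True
    then have "n k = 1" using n[OF k] by simp
    then have "Re (ip ?S (wave d L k) (mv ?S (\<lambda>x y. idm x y - G x y) (wave d L k))) = 0"
      using nsq_wave[OF k] by (simp add: ip_idm_minus[OF finite_lattice] n_def)
    then have "mv ?S (\<lambda>x y. idm x y - G x y) (wave d L k) x = 0"
      using psd_kernel[OF finite_lattice, of d L "\<lambda>x y. idm x y - G x y"] G x by (auto simp: between01_def)
    then show ?thesis using True by (simp add: mv_idm_minus[OF finite_lattice x])
  next
    case False
    then have "n k = 0" using n[OF k] ne[OF k] by (simp add: min_def)
    then have "mv ?S G (wave d L k) x = 0"
      using psd_kernel[OF finite_lattice, of d L G] G x by (auto simp: between01_def n_def)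
    then show ?thesis using False by simp
  qed
  have "eigbasis ?S G ?S (wave d L) (\<lambda>k. of_bool (energy d L k < \<mu>))"
    using eig eigbasis_lapl[OF L, of d] by (simp add: eigbasis_def)
  note entry = eigbasis_entry[OF finite_lattice this]
  show ?thesis
    unfolding meq_def
  proof (intro ballI)
    fix x y assume xy: "x \<in> ?S" "y \<in> ?S"
    have "G x y = (\<Sum>k\<in>{k \<in> ?S. energy d L k < \<mu>}. wave d L k x * cnj (wave d L k y))"
      unfolding entry[OF xy] by (intro sum.mono_neutral_cong_right finite_lattice) auto
    then show "G x y = fermi d L \<mu> x y" using xy by (simp add: fermi_def spec_part_def)
  qed
qed

lemma is_eigenvalue_energy:
  assumes L: "3 \<le> L" and k: "k \<in> lattice d L"
  shows "is_eigenvalue (lattice d L) (mneg (lapl d L)) (of_real (energy d L k))"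
proof -
  let ?S = "lattice d L"
  define v where "v x = (if x \<in> ?S then wave d L k x else 0)" for x
  have "mv ?S (mneg (lapl d L)) v = mv ?S (mneg (lapl d L)) (wave d L k)"
    by (intro mv_cong) (simp add: v_def)
  then have "apply_mat ?S (mneg (lapl d L)) v = (\<lambda>x. of_real (energy d L k) * v x)"
    using mv_lapl_wave[OF _ L, of _ d k]
    by (intro ext) (metis apply_mat_mv apply_mat_outside mult_zero_right v_def)
  then have "v \<in> eigspace ?S (mneg (lapl d L)) (of_real (energy d L k))"
    by (simp add: eigspace_def vecs_def v_def)
  \<comment> \<open>The momentum \<open>k\<close> is reused as a lattice site; the wave vanishes
    nowhere.\<close>
  moreover have "v k \<noteq> 0"
    using k norm_wave[of d L k k] L by (auto simp: v_def)
  ultimately show ?thesis unfolding is_eigenvalue_def using k by blast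
qed

text \<open>A fully polarised Fermi sea has no repulsion and attains the bound of
  \<open>hfz_ge\<close>. The threshold for U is expressed by the exact E at the given L; its
  comparison with \<open>U_star\<close> is a separate matter.\<close>

theorem ferromagnetism_of_strong_coupling:
  assumes L: "3 \<le> L" and d: "1 \<le> d" and \<mu>: "0 < \<mu>" "\<mu> \<le> 1 / 2"
    and E: "E = sea d L \<mu>" "0 < E" and a: "a = 9 / (2048 * real d ^ 3) * E"
    and \<delta>: "\<delta> = (E / (8 * real d))\<^sup>2" and U: "16 * (real d)\<^sup>2 / (a * \<delta>) \<le> U"
  shows "hfz_energy d L \<mu> U = tr_neg (lattice d L) (Kmu d L \<mu>)"
    and "\<not> is_eigenvalue (lattice d L) (mneg (lapl d L)) (complex_of_real \<mu>) \<Longrightarrow>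
      hfz_minimizer d L \<mu> U gu gd \<Longrightarrow>
      meq (lattice d L) gu (fermi d L \<mu>) \<and> meq (lattice d L) gd (\<lambda>x y. 0) \<or>
      meq (lattice d L) gu (\<lambda>x y. 0) \<and> meq (lattice d L) gd (fermi d L \<mu>)"
proof -
  let ?S = "lattice d L"
  note main = hfz_ge[OF L d \<mu> _ _ E a \<delta> U refl refl]
  have a0: "0 < a" using E d by (simp add: a)
  have diag: "0 \<le> Re (G x x)" if "between01 ?S G" "x \<in> ?S" for G x
    using between01_diag(1)[OF that(1) finite_lattice that(2)] .
  have extra: "0 \<le> \<mu> * (\<Sum>x\<in>X. Re (G x x))" if "between01 ?S G" "X \<subseteq> ?S" for G X
    using diag[OF that(1)] that(2) \<mu> by (intro mult_nonneg_nonneg sum_nonneg) auto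
  have dS: "dense d L \<delta> G \<subseteq> ?S" for G by (auto simp: dense_def)
  have low: "- E * real (L ^ d) \<le> hfz d L \<mu> U g g'" if g: "between01 ?S g" "between01 ?S g'" for g g'
  proof -
    let ?A = "dense d L \<delta> g" and ?B = "dense d L \<delta> g' - dense d L \<delta> g"
    have "0 \<le> a / 2 * card (bdry d L ?A)" "0 \<le> a / 2 * card (bdry d L ?B)" "0 \<le> E / 4 * card (?S - (?A \<union> ?B))"
      using a0 E by auto
    moreover have "0 \<le> \<mu> * (\<Sum>x\<in>?A. Re (g' x x))" "0 \<le> \<mu> * (\<Sum>x\<in>?B. Re (g x x))"
      using extra[OF g(2) dS[of g]] extra[OF g(1), of ?B] dS[of g'] by auto
    ultimately show ?thesis using main[OF g] by linarith
  qed
  have kz: "kin d L \<mu> ?S (\<lambda>x y. 0) = 0" by (simp add: kin_def mtrace_def mmul_def)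
  have att: "hfz d L \<mu> U (fermi d L \<mu>) (\<lambda>x y. 0) = - E * real (L ^ d)"
    unfolding hfz_kin kz kin_fermi[OF L] E(1) by simp
  have adm: "hfz_admissible d L (fermi d L \<mu>) (\<lambda>x y. 0)"
    by (simp add: hfz_admissible_def between01_fermi between01_zero)
  show "hfz_energy d L \<mu> U = tr_neg ?S (Kmu d L \<mu>)"
    unfolding hfz_energy_def tr_neg_Kmu[OF L] E(1)[symmetric]
  proof (rule cInf_eq_minimum)
    show "- E * real (L ^ d) \<in> {hfz d L \<mu> U gu gd |gu gd. hfz_admissible d L gu gd}"
      using att adm by (metis (mono_tags, lifting) mem_Collect_eq)
    show "- E * real (L ^ d) \<le> x" if "x \<in> {hfz d L \<mu> U gu gd |gu gd. hfz_admissible d L gu gd}" for x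
      using that low by (auto simp: hfz_admissible_def)
  qed
  assume nev: "\<not> is_eigenvalue ?S (mneg (lapl d L)) (complex_of_real \<mu>)"
    and min: "hfz_minimizer d L \<mu> U gu gd"
  have ne: "energy d L k \<noteq> \<mu>" if "k \<in> ?S" for k using is_eigenvalue_energy[OF L that] nev by auto
  have g: "between01 ?S gu" "between01 ?S gd" using min by (auto simp: hfz_minimizer_def hfz_admissible_def)
  have eq: "hfz d L \<mu> U gu gd \<le> - E * real (L ^ d)"
    using min adm att by (metis hfz_minimizer_def)
  define A where "A = dense d L \<delta> gu"
  define B where "B = dense d L \<delta> gd - A"
  have AS: "A \<subseteq> ?S" and BS: "B \<subseteq> ?S" using dS by (auto simp: A_def B_def)
  have finA: "finite A" and finB: "finite B" using AS BS finite_lattice finite_subset by blast+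
  have nonneg: "0 \<le> a / 2 * card (bdry d L A)" "0 \<le> a / 2 * card (bdry d L B)" "0 \<le> E / 4 * card (?S - (A \<union> B))"
    using a0 E by auto
  have nonneg': "0 \<le> \<mu> * (\<Sum>x\<in>A. Re (gd x x))" "0 \<le> \<mu> * (\<Sum>x\<in>B. Re (gu x x))"
    by (rule extra[OF g(2) AS], rule extra[OF g(1) BS])
  have zero: "a / 2 * card (bdry d L A) = 0" "a / 2 * card (bdry d L B) = 0"
      "E / 4 * card (?S - (A \<union> B)) = 0" "\<mu> * (\<Sum>x\<in>A. Re (gd x x)) = 0" "\<mu> * (\<Sum>x\<in>B. Re (gu x x)) = 0"
    using main[OF g, folded A_def, folded B_def] eq nonneg nonneg' by linarith+
  have bA: "bdry d L A = {}" and bB: "bdry d L B = {}"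
    using zero a0 finA finB by (auto simp: card_eq_0_iff bdry_def)
  have cov: "A \<union> B = ?S" using zero(3) E AS BS finite_lattice by (auto simp: card_eq_0_iff)
  have vanish: "meq ?S G (\<lambda>x y. 0)" if G: "between01 ?S G" and z: "\<mu> * (\<Sum>x\<in>?S. Re (G x x)) = 0" for G
  proof -
    have "Re (G x x) = 0" if "x \<in> ?S" for x
      using z \<mu> that diag[OF G] finite_lattice by (simp add: sum_nonneg_eq_0_iff)
    then show ?thesis
      using psd_zero_diag[OF finite_lattice] G by (auto simp: meq_def between01_def)
  qed
  have kmeq: "kin d L \<mu> ?S G = 0" if "meq ?S G (\<lambda>x y. 0)" for G
    using that by (simp add: kin_def mtrace_def mmul_def meq_def)
  have ground: "meq ?S G (fermi d L \<mu>)" if G: "between01 ?S G" and "kin d L \<mu> ?S G \<le> - E * real (L ^ d)" for G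
  proof -
    \<comment> \<open>Pairing \<open>G\<close> with the zero matrix turns the two-spin bound into a
      one-spin bound.\<close>
    have "- E * real (L ^ d) \<le> kin d L \<mu> ?S G"
      using low[OF G between01_zero] unfolding hfz_kin kz by simp
    then show ?thesis using that ne by (intro kin_minimizer[OF L G]) (auto simp: E(1))
  qed
  show "meq ?S gu (fermi d L \<mu>) \<and> meq ?S gd (\<lambda>x y. 0) \<or> meq ?S gu (\<lambda>x y. 0) \<and> meq ?S gd (fermi d L \<mu>)"
  proof (cases "A = {}")
    case False
    then have "A = ?S" by (rule closed_imp_all[OF L AS bA])
    \<comment> \<open>Sites dense for both spins were assigned to \<open>A\<close>; the surplus
      \<mu> times the other density now rules them out.\<close>
    then have gd0: "meq ?S gd (\<lambda>x y. 0)" using zero(4) by (intro vanish g) simp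
    then have "hfz d L \<mu> U gu gd = kin d L \<mu> ?S gu"
      unfolding hfz_kin kmeq[OF gd0] by (simp add: meq_def)
    then show ?thesis using ground[OF g(1)] eq gd0 by simp
  next
    case True
    then have "B = ?S" using cov by simp
    then have gu0: "meq ?S gu (\<lambda>x y. 0)" using zero(5) by (intro vanish g) simp
    then have "hfz d L \<mu> U gu gd = kin d L \<mu> ?S gd"
      unfolding hfz_kin kmeq[OF gu0] by (simp add: meq_def)
    then show ?thesis using ground[OF g(2)] eq gu0 by simp
  qed
qed

subsection \<open>Constants\<close>

lemma two_minus_two_cos_le: "2 - 2 * cos (x::real) \<le> x\<^sup>2"
proof -
  have "(sin (x / 2))\<^sup>2 \<le> (x / 2)\<^sup>2"
    using abs_sin_x_le_abs_x[of "x / 2"] by (metis abs_ge_zero power2_abs power_mono)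
  moreover have "cos x = 1 - 2 * (sin (x / 2))\<^sup>2" using cos_double_sin[of "x / 2"] by simp
  ultimately show ?thesis by (simp add: power_divide)
qed

text \<open>Depth \<mu>/2 times the fraction of momentum space filled by a cube of side sqrt (\<mu>
  / 2d).\<close>

definition seaconst :: "nat \<Rightarrow> real \<Rightarrow> real" where
  "seaconst d \<mu> = \<mu> / 2 * (sqrt (\<mu> / (2 * real d)) / (2 * pi)) ^ d"

text \<open>All momenta with components in \<open>[0, sqrt (\<mu> / 2d)]\<close> have energy at most \<open>\<mu> / 2\<close>.\<close>

lemma sea_ge:
  assumes \<mu>: "0 < \<mu>" "\<mu> \<le> 1 / 2" and L: "3 \<le> L" and d: "1 \<le> d"
  shows "seaconst d \<mu> \<le> sea d L \<mu>"
proof -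
  define s where "s = sqrt (\<mu> / (2 * real d))"
  define r where "r = s / (2 * pi)"
  \<comment> \<open>Per axis the momenta 0, ..., m are counted, and m + 1 \<ge> L r: including 0
    makes up for the rounding, so nothing is lost at finite L.\<close>
  define m where "m = nat \<lfloor>real L * r\<rfloor>"
  have s0: "0 < s" using \<mu> d by (simp add: s_def)
  have "\<mu> / (2 * real d) \<le> 1" using \<mu> d by (simp add: divide_le_eq)
  then have s1: "s \<le> 1" by (simp add: s_def)
  have r0: "0 < r" using s0 by (simp add: r_def)
  have "s < 2 * pi" using s1 pi_gt3 by linarith
  then have r1: "r < 1" by (simp add: r_def)
  have "0 \<le> real L * r" using r0 by simp
  then have mle: "real m \<le> real L * r" and mge: "real L * r \<le> real m + 1"
    unfolding m_def by linarith+
  have "real L * r < real L" using r1 L by simp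
  then have mL: "m < L" using mle by linarith
  \<comment> \<open>The cube of momenta is itself a lattice, of side \<open>Suc m\<close>.\<close>
  have sub: "lattice d (Suc m) \<subseteq> lattice d L" using mL by (auto simp: lattice_def)
  have en: "energy d L k \<le> \<mu> / 2" if k: "k \<in> lattice d (Suc m)" for k
  proof -
    have "energy d L k \<le> (\<Sum>i<d. s\<^sup>2)"
      unfolding energy_def
    proof (rule sum_mono)
      fix i assume "i \<in> {..<d}"
      then have "real (k ! i) \<le> real m" using lattice_nth[OF k, of i] by simp
      then have "real (k ! i) \<le> real L * r" using mle by linarith
      then have "2 * pi * real (k ! i) / real L \<le> s"
        using L pi_gt_zero by (simp add: r_def field_simps)
      then have "(2 * pi * real (k ! i) / real L)\<^sup>2 \<le> s\<^sup>2" by (intro power_mono) auto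
      then show "2 - 2 * cos (2 * pi * real (k ! i) / real L) \<le> s\<^sup>2"
        using two_minus_two_cos_le order_trans by blast
    qed
    also have "\<dots> = \<mu> / 2" using \<mu> d by (simp add: s_def)
    finally show ?thesis .
  qed
  have "(real L * r) ^ d * (\<mu> / 2) \<le> (real m + 1) ^ d * (\<mu> / 2)"
    using mge r0 \<mu> by (intro mult_right_mono power_mono) auto
  also have "\<dots> = (\<Sum>k\<in>lattice d (Suc m). \<mu> / 2)" by (simp add: card_lattice add.commute)
  also have "\<dots> \<le> (\<Sum>k\<in>lattice d (Suc m). max 0 (\<mu> - energy d L k))"
  proof (rule sum_mono)
    fix k assume "k \<in> lattice d (Suc m)"
    then show "\<mu> / 2 \<le> max 0 (\<mu> - energy d L k)" using en[of k] by linarith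
  qed
  also have "\<dots> \<le> (\<Sum>k\<in>lattice d L. max 0 (\<mu> - energy d L k))"
    by (intro sum_mono2 finite_lattice sub) auto
  finally have "(real L * r) ^ d * (\<mu> / 2) / real (L ^ d) \<le> sea d L \<mu>"
    unfolding sea_def by (intro divide_right_mono) auto
  moreover have "(real L * r) ^ d * (\<mu> / 2) / real (L ^ d) = seaconst d \<mu>"
    unfolding power_mult_distrib seaconst_def r_def s_def using L by simp
  ultimately show ?thesis by simp
qed

lemma seaconst_pos: "0 < \<mu> \<Longrightarrow> 1 \<le> d \<Longrightarrow> 0 < seaconst d \<mu>"
  by (simp add: seaconst_def)

text \<open>Multiplication by x \<ge> 1 in Gamma(x + 1) = x Gamma(x) preserves the bound, so
  \<open>n\<close> follows from n - 2 once n \<ge> 4; the values at 1/2, 1 and 3/2 are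
  explicit.\<close>

lemma Gamma_half_ge: "1 \<le> n \<Longrightarrow> 1 / 2 \<le> Gamma (real n / 2 :: real)"
proof (induction n rule: nat_less_induct)
  case (1 n)
  have sp: "1 \<le> sqrt pi" using pi_gt3 by simp
  consider "n = 1" | "n = 2" | "n = 3" | "4 \<le> n" using 1(2) by linarith
  then show ?case
  proof cases
    case 1
    then have "Gamma (real n / 2 :: real) = sqrt pi" by (simp add: Gamma_one_half_real)
    then show ?thesis using sp by linarith
  next
    case 2
    then show ?thesis by simp
  next
    case 3
    have "Gamma (1 / 2 + 1 :: real) = 1 / 2 * Gamma (1 / 2)"
      by (rule Gamma_plus1) (auto elim: nonpos_Ints_cases)
    then show ?thesis using sp 3 by (simp add: Gamma_one_half_real)
  next
    case 4
    define x where "x = real (n - 2) / 2"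
    have x: "1 \<le> x" "real n / 2 = x + 1" using 4 by (auto simp: x_def of_nat_diff diff_divide_distrib)
    have "n - 2 < n" "1 \<le> n - 2" using 4 by auto
    then have "1 / 2 \<le> Gamma x" using 1(1) unfolding x_def by blast
    then have "1 * (1 / 2) \<le> x * Gamma x" using x by (intro mult_mono) auto
    also have "x * Gamma x = Gamma (x + 1)"
      using x by (intro Gamma_plus1[symmetric]) (auto elim!: nonpos_Ints_cases)
    finally show ?thesis unfolding x(2) by linarith
  qed
qed

section \<open>Comparison with \<open>alpha_star\<close> and \<open>U_star\<close>\<close>

lemma powr_half_nat: "0 < x \<Longrightarrow> x powr (real n / 2) = sqrt x ^ n"
  by (simp add: powr_half_sqrt[symmetric] powr_powr flip: powr_realpow)

lemma sphere_area_pos: "1 \<le> d \<Longrightarrow> 0 < sphere_area d"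
  by (simp add: sphere_area_def Gamma_real_pos)

lemma sphere_area_le:
  assumes "1 \<le> d"
  shows "sphere_area d \<le> 4 * sqrt pi ^ d"
proof -
  have g: "1 / 2 \<le> Gamma (real d / 2)" by (rule Gamma_half_ge[OF assms])
  have "2 * sqrt pi ^ d * (1 / 2) \<le> 2 * sqrt pi ^ d * Gamma (real d / 2)"
    using g by (intro mult_left_mono) auto
  then have "2 * sqrt pi ^ d \<le> 4 * sqrt pi ^ d * Gamma (real d / 2)" by simp
  then show ?thesis using g by (simp add: sphere_area_def powr_half_nat pos_divide_le_eq)
qed

lemma sphere_area_1: "sphere_area 1 = 2"
  by (simp add: sphere_area_def Gamma_one_half_real powr_half_sqrt)

text \<open>Both constants contain \<mu>^(1 + d/2) / (2 pi)^d. Factoring it out turns the comparison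
  of coupling thresholds into one between powers of \<open>seaconst\<close>.\<close>

lemma alpha_star_eq:
  assumes "0 < \<mu>" "1 \<le> d"
  shows "alpha_star d \<mu> = seaconst d \<mu> * (sphere_area d * sqrt (real d) ^ d / (4 * real d) ^ 5)"
proof -
  have m: "\<mu> powr ((2 + real d) / 2) = \<mu> * sqrt \<mu> ^ d"
    using assms by (simp add: add_divide_distrib powr_add powr_half_nat)
  have t: "(2::real) powr (1 + real d / 2) = 2 * sqrt 2 ^ d"
    by (simp add: powr_add powr_half_nat)
  show ?thesis
    unfolding alpha_star_def m t seaconst_def using assms
    by (simp add: real_sqrt_divide real_sqrt_mult power_divide power_mult_distrib)
qed

lemma kappa_pos:
  assumes "0 < \<mu>" "\<mu> \<le> 1 / 2" "1 \<le> d"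
  shows "0 < kappa d \<mu>"
proof -
  have "1 \<le> 4 * real d / \<mu>" using assms by (simp add: pos_le_divide_eq)
  then have "0 \<le> ln (4 * real d / \<mu>)" by (rule ln_ge_zero)
  moreover have "0 \<le> 2 * ln 2 * (1 / real d + 1)" by simp
  ultimately have "0 < 1 + 2 * ln 2 * (1 / real d + 1) + ln (4 * real d / \<mu>)" by linarith
  then show ?thesis using assms by (simp add: kappa_def)
qed

text \<open>The left side is of order d^7/E^3 and decreases in E, so it suffices to bound \<alpha>
  \<eta> by a multiple of F^3 for F the lower bound on E. For d = 1 the entry \<alpha>^2/(12 d)^2 of
  \<open>delta_star\<close> does this at once. For large d the factor \<open>sphere_area d\<close>
  d^(d/2) in \<alpha> grows exponentially, so for d \<ge> 2 the entry with (4 M + 1)^d is used: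
  \<alpha>^2 supplies F^2 and the d-th power supplies the third F.\<close>

lemma U_star_ge:
  assumes \<mu>: "0 < \<mu>" "\<mu> \<le> 1 / 2" and d: "1 \<le> d"
    and E: "seaconst d \<mu> \<le> E" and a: "a = 9 / (2048 * real d ^ 3) * E"
    and \<delta>: "\<delta> = (E / (8 * real d))\<^sup>2"
  shows "16 * (real d)\<^sup>2 / (a * \<delta>) \<le> U_star d \<mu> (alpha_star d \<mu>)"
proof -
  define F where "F = seaconst d \<mu>"
  define \<alpha> where "\<alpha> = alpha_star d \<mu>"
  define \<eta> where "\<eta> = delta_star d \<mu> \<alpha>"
  have d0: "1 \<le> real d" using d by simp
  have F0: "0 < F" using seaconst_pos \<mu> d by (simp add: F_def)
  have \<alpha>: "\<alpha> = F * (sphere_area d * sqrt (real d) ^ d / (4 * real d) ^ 5)"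
    using alpha_star_eq[OF \<mu>(1) d] by (simp add: \<alpha>_def F_def)
  have \<alpha>0: "0 < \<alpha>" using sphere_area_pos[OF d] F0 d by (simp add: \<alpha>)
  have M0: "0 < Mstar d \<mu>" using \<mu> d by (simp add: Mstar_def)
  have \<eta>0: "0 < \<eta>"
    unfolding \<eta>_def delta_star_def using \<alpha>0 \<mu> d M0 kappa_pos[OF \<mu> d] by (subst Min_gr_iff) auto
  have \<eta>1: "\<eta> \<le> \<alpha>\<^sup>2 / (12 * real d)\<^sup>2" and \<eta>2: "\<eta> \<le> \<alpha> / (3 * \<mu> * (4 * Mstar d \<mu> + 1) ^ d)"
    unfolding \<eta>_def delta_star_def by (intro Min_le; simp)+
  \<comment> \<open>2097152 = 2^21 = 16 * 2048 * 64 collects the constants of 16 d^2 / (a \<delta>),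
    and 24 comes from the second entry of \<open>U_star\<close>.\<close>
  have key: "\<alpha> * \<eta> * (2097152 / 9 * real d ^ 5) \<le> 24 * F ^ 3"
  proof (cases "d = 1")
    case True
    then have \<alpha>F: "\<alpha> = F / 512" by (simp add: \<alpha> sphere_area_1[unfolded One_nat_def])
    have "\<alpha> * \<eta> \<le> \<alpha> * (\<alpha>\<^sup>2 / 144)" using \<eta>1 \<alpha>0 True by (intro mult_left_mono) auto
    also have "\<dots> = F ^ 3 * (1 / (144 * 512 ^ 3))"
      unfolding \<alpha>F by (simp add: power2_eq_square power3_eq_cube)
    also have "\<dots> \<le> F ^ 3 * (1 / 10000)" using F0 by (intro mult_left_mono) auto
    finally have "\<alpha> * \<eta> \<le> F ^ 3 * (1 / 10000)" .
    moreover have "0 < F ^ 3" using F0 by simp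
    moreover have "2097152 / 9 * real d ^ 5 = 2097152 / 9" using True by simp
    ultimately show ?thesis by (simp only:)
  next
    case False
    then have d2: "2 \<le> d" using d by simp
    have M4: "(768 * (real d)\<^sup>2 / \<mu>\<^sup>2) ^ d \<le> (4 * Mstar d \<mu> + 1) ^ d"
      using M0 by (intro power_mono) (auto simp: Mstar_def power2_eq_square)
    have q: "\<alpha>\<^sup>2 = F\<^sup>2 * ((sphere_area d)\<^sup>2 * real d ^ d / (4 * real d) ^ 10)"
    proof -
      have "(sqrt (real d) ^ d)\<^sup>2 = real d ^ d"
        by (simp only: power_mult[symmetric] mult.commute[of d]) (simp add: power_mult)
      then show ?thesis unfolding \<alpha> power_mult_distrib power_divide by (simp flip: power_mult)
    qed
    have sa: "(sphere_area d)\<^sup>2 \<le> 16 * pi ^ d"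
    proof -
      have "(sphere_area d)\<^sup>2 \<le> (4 * sqrt pi ^ d)\<^sup>2"
        using sphere_area_le[OF d] sphere_area_pos[OF d] by (intro power_mono) auto
      also have "\<dots> = 16 * ((sqrt pi)\<^sup>2) ^ d" by (simp only: power_mult_distrib power_mult[symmetric] mult.commute[of d]) simp
      finally show ?thesis by simp
    qed
    \<comment> \<open>One \<mu> cancels against 3 \<mu> in the denominator, another becomes the
      prefactor of \<open>seaconst\<close>, and the rest is traded for sqrt \<mu>^d. This needs 4 (d
      - 1) \<ge> d, hence d \<ge> 2.\<close>
    have m4: "(\<mu>\<^sup>2) ^ d \<le> \<mu>\<^sup>2 * sqrt \<mu> ^ d"
    proof -
      have s: "0 \<le> sqrt \<mu>" "sqrt \<mu> \<le> 1" using \<mu> by auto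
      have "(\<mu>\<^sup>2) ^ (d - 1) = sqrt \<mu> ^ (4 * (d - 1))"
      proof -
        have "sqrt \<mu> ^ 4 = ((sqrt \<mu>)\<^sup>2)\<^sup>2" by simp
        also have "\<dots> = \<mu>\<^sup>2" using \<mu> by simp
        finally show ?thesis by (simp add: power_mult)
      qed
      also have "\<dots> \<le> sqrt \<mu> ^ d" using d2 by (intro power_decreasing s) simp
      finally have "\<mu>\<^sup>2 * (\<mu>\<^sup>2) ^ (d - 1) \<le> \<mu>\<^sup>2 * sqrt \<mu> ^ d" by (intro mult_left_mono) auto
      then show ?thesis using d by (simp add: power_eq_if)
    qed
    \<comment> \<open>The collected d-th powers are compared with the base of the d-th power in
      \<open>seaconst\<close>; the factor 768 d absorbs the powers of pi.\<close>
    have base: "pi / (768 * real d) * sqrt \<mu> \<le> sqrt (\<mu> / (2 * real d)) / (2 * pi)"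
    proof -
      have sq: "sqrt 2 * sqrt (real d) \<le> 2 * real d"
        using d0 real_sqrt_le_mono[of 2 4] real_le_lsqrt[of "real d" "real d"]
        by (intro mult_mono) (auto simp: power2_eq_square)
      have "2 * pi * pi \<le> 2 * 4 * 4" using pi_less_4 by (intro mult_mono) auto
      then have "2 * pi * pi * (sqrt 2 * sqrt (real d)) \<le> 2 * 4 * 4 * (2 * real d)"
        by (rule mult_mono[OF _ sq]) auto
      also have "\<dots> \<le> 768 * real d" using d0 by simp
      finally have "pi / (768 * real d) \<le> 1 / (2 * pi * (sqrt 2 * sqrt (real d)))"
        using d0 by (simp add: field_simps)
      then have "pi / (768 * real d) * sqrt \<mu> \<le> 1 / (2 * pi * (sqrt 2 * sqrt (real d))) * sqrt \<mu>"
        using \<mu> by (intro mult_right_mono) auto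
      then show ?thesis by (simp add: real_sqrt_divide real_sqrt_mult mult_ac)
    qed
    have num: "3 * \<mu> * (768 * (real d)\<^sup>2 / \<mu>\<^sup>2) ^ d \<le> 3 * \<mu> * (4 * Mstar d \<mu> + 1) ^ d"
      using M4 \<mu> by (intro mult_left_mono) auto
    have "\<alpha> / (3 * \<mu> * (4 * Mstar d \<mu> + 1) ^ d) \<le> \<alpha> / (3 * \<mu> * (768 * (real d)\<^sup>2 / \<mu>\<^sup>2) ^ d)"
      using \<alpha>0 \<mu> d M0 by (intro divide_left_mono[OF num]) auto
    then have "\<alpha> * \<eta> \<le> \<alpha> * (\<alpha> / (3 * \<mu> * (768 * (real d)\<^sup>2 / \<mu>\<^sup>2) ^ d))"
      using \<eta>2 \<alpha>0 by (intro mult_left_mono) auto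
    also have "\<dots> = \<alpha>\<^sup>2 * (\<mu>\<^sup>2) ^ d / (3 * \<mu> * (768 * (real d)\<^sup>2) ^ d)"
      by (simp add: power2_eq_square power_divide)
    also have "\<dots> \<le> \<alpha>\<^sup>2 * (\<mu>\<^sup>2 * sqrt \<mu> ^ d) / (3 * \<mu> * (768 * (real d)\<^sup>2) ^ d)"
      using m4 \<mu> by (intro divide_right_mono mult_left_mono) auto
    also have "\<dots> = F\<^sup>2 * (((sphere_area d)\<^sup>2 * real d ^ d / (4 * real d) ^ 10) * (\<mu> * sqrt \<mu> ^ d) / (3 * (768 * (real d)\<^sup>2) ^ d))"
      unfolding q using \<mu> by (simp add: power2_eq_square)
    also have "\<dots> \<le> F\<^sup>2 * ((16 * pi ^ d * real d ^ d / (4 * real d) ^ 10) * (\<mu> * sqrt \<mu> ^ d) / (3 * (768 * (real d)\<^sup>2) ^ d))"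
      using sa \<mu> by (intro mult_left_mono divide_right_mono mult_right_mono) auto
    also have "\<dots> = F\<^sup>2 * (16 / 3 / (4 * real d) ^ 10 * \<mu> * (pi / (768 * real d) * sqrt \<mu>) ^ d)"
      using d by (simp add: power_mult_distrib power_divide power2_eq_square mult_ac)
    also have "\<dots> \<le> F\<^sup>2 * (16 / 3 / (4 * real d) ^ 10 * \<mu> * (sqrt (\<mu> / (2 * real d)) / (2 * pi)) ^ d)"
      using base \<mu> by (intro mult_left_mono power_mono) auto
    also have "\<dots> = F\<^sup>2 * (32 / 3 / (4 * real d) ^ 10 * F)"
      by (simp add: F_def seaconst_def)
    finally have "\<alpha> * \<eta> \<le> 32 / 3 / (4 * real d) ^ 10 * F ^ 3" by (simp add: power2_eq_square power3_eq_cube)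
    then have "\<alpha> * \<eta> * (2097152 / 9 * real d ^ 5) \<le> 32 / 3 / (4 * real d) ^ 10 * F ^ 3 * (2097152 / 9 * real d ^ 5)"
      by (intro mult_right_mono) auto
    also have "\<dots> = 64 / 27 / real d ^ 5 * F ^ 3"
    proof -
      define z where "z = real d ^ 5"
      have "z \<noteq> 0" "real d ^ 10 = z * z" using d by (simp_all add: z_def flip: power_add)
      then show ?thesis unfolding power_mult_distrib z_def[symmetric] by simp
    qed
    also have "\<dots> \<le> 24 * F ^ 3"
    proof (intro mult_right_mono)
      show "64 / 27 / real d ^ 5 \<le> 24" using one_le_power[OF d0, of 5] by (simp add: divide_le_eq)
    qed (use F0 in auto)
    finally show ?thesis .
  qed
  have F3: "F ^ 3 \<le> E ^ 3" using E F0 by (intro power_mono) (auto simp: F_def)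
  have E0: "0 < E" using E F0 by (simp add: F_def)
  have "16 * (real d)\<^sup>2 / (a * \<delta>) = (2097152 / 9 * real d ^ 7) / E ^ 3"
    using d E0 by (simp add: a \<delta> field_simps power2_eq_square eval_nat_numeral)
  also have "\<dots> \<le> (2097152 / 9 * real d ^ 7) / F ^ 3"
    using F3 F0 E0 by (intro divide_left_mono) auto
  also have "\<dots> \<le> 24 * (real d)\<^sup>2 / (\<alpha> * \<eta>)"
  proof -
    have d7: "real d ^ 7 = real d ^ 5 * (real d)\<^sup>2" by (simp flip: power_add)
    have "2097152 / 9 * real d ^ 7 * (\<alpha> * \<eta>) = \<alpha> * \<eta> * (2097152 / 9 * real d ^ 5) * (real d)\<^sup>2"
      unfolding d7 by (simp only: mult_ac)
    also have "\<dots> \<le> 24 * F ^ 3 * (real d)\<^sup>2" by (intro mult_right_mono key) auto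
    also have "\<dots> = 24 * (real d)\<^sup>2 * F ^ 3" by (simp only: mult_ac)
    finally have "2097152 / 9 * real d ^ 7 * (\<alpha> * \<eta>) \<le> 24 * (real d)\<^sup>2 * F ^ 3" .
    then have "2097152 / 9 * real d ^ 7 * (\<alpha> * \<eta>) / F ^ 3 \<le> 24 * (real d)\<^sup>2"
      by (subst pos_divide_le_eq) (use F0 in simp)
    then show ?thesis
      by (subst pos_le_divide_eq) (use \<alpha>0 \<eta>0 in simp, simp only: times_divide_eq_left)
  qed
  also have "\<dots> \<le> U_star d \<mu> (alpha_star d \<mu>)"
    unfolding U_star_def \<alpha>_def[symmetric] \<eta>_def[symmetric] by simp
  finally show ?thesis .
qed

theorem theorem1p2:
  fixes d L :: nat and \<mu> U :: real
  assumes "d \<ge> 1" and "0 < \<mu>" and "\<mu> \<le> 1/2"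
    and "even L" and "real L \<ge> Lstar d \<mu>"
    and "U \<ge> U_star d \<mu> (alpha_star d \<mu>)"
  shows "hfz_energy d L \<mu> U = tr_neg (lattice d L) (Kmu d L \<mu>)
    \<and> (\<not> is_eigenvalue (lattice d L) (mneg (lapl d L)) (complex_of_real \<mu>) \<longrightarrow>
        (\<forall>gu gd. hfz_minimizer d L \<mu> U gu gd \<longrightarrow>
          (meq (lattice d L) gu (spec_proj_below (lattice d L) (mneg (lapl d L)) \<mu>)
             \<and> meq (lattice d L) gd (\<lambda>x y. 0))
          \<or> (meq (lattice d L) gu (\<lambda>x y. 0)
             \<and> meq (lattice d L) gd (spec_proj_below (lattice d L) (mneg (lapl d L)) \<mu>))))"
proof -
  \<comment> \<open>\<open>Lstar\<close> equals 384 d^2 / \<mu>^2; the resulting L \<ge> 3 makes the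
    2d neighbours of each site distinct.\<close>
  have "3 \<le> Lstar d \<mu>"
  proof -
    have "\<mu>\<^sup>2 \<le> 1\<^sup>2" using assms by (intro power_mono) auto
    moreover have "1 \<le> (real d)\<^sup>2" using assms(1) by (simp add: one_le_power)
    ultimately have "3 * \<mu>\<^sup>2 \<le> 384 * (real d)\<^sup>2" by simp
    then show ?thesis using assms(2) by (simp add: Lstar_def Mstar_def pos_le_divide_eq power_mult_distrib)
  qed
  then have L: "3 \<le> L" using assms(5) by linarith
  have sea: "seaconst d \<mu> \<le> sea d L \<mu>" by (rule sea_ge[OF assms(2,3) L assms(1)])
  then have pos: "0 < sea d L \<mu>" using seaconst_pos[OF assms(2,1)] by linarith
  have U: "16 * (real d)\<^sup>2 / (9 / (2048 * real d ^ 3) * sea d L \<mu> * (sea d L \<mu> / (8 * real d))\<^sup>2) \<le> U"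
    using U_star_ge[OF assms(2,3,1) sea refl refl] assms(6) by linarith
  note main = ferromagnetism_of_strong_coupling[OF L assms(1-3) refl pos refl refl U]
  show ?thesis unfolding spec_proj_below_lapl[OF L] using main by blast
qed

end
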